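(* Let $f(Z)=\sum_{i=1}^d \alpha_i Z^i\in\mathbb{R}[Z]$ be a polynomial of degree $d\ge 2$, let $a,q$ be integers with $q\ge 1$, $\gcd(a,q)=1$ and $$\left|\alpha_d-\frac aq\right|<\frac1{q^2},$$ and let $h\neq 0$ be an integer. Put $$T_f(h,N)=\sum_{n=1}^N\mathbf{e}(hf(n)),\qquad D=\gcd(h,q),\qquad \Delta=|h|q^{-1}+N^{-1}+qN^{-d}+DN^{-d+1}.$$ Then $$|T_f(h,N)|\le N^{1+o(1)}\Delta^{1/(d(d-1))}$$ and $$T_f(h,N)\ll N\Delta^{1/(d^2-d+2)}\log N,$$ as $N\to\infty$.
   Context: $\mathbf{e}(z)=\exp(2\pi i z)$. $A\ll B$ means $|A|\le cB$ for some constant $c>0$ and all $N$ larger than some threshold, where $c$ and the threshold depend only on $d$ (and not on $f,a,q,h$). The notation $N^{o(1)}$ means: for every $\varepsilon>0$ there is $N_0$, depending only on $\varepsilon$ and $d$, such that for all $N\ge N_0$ the bound holds with $o(1)$ replaced by $\varepsilon$. *)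

theory Defs
  imports Complex_Main "HOL-Computational_Algebra.Polynomial"
begin

definition expi :: "complex \<Rightarrow> complex" where
  "expi z = exp (2 * of_real pi * \<i> * z)"

definition T :: "real poly \<Rightarrow> int \<Rightarrow> nat \<Rightarrow> complex" where
  "T f h N = (\<Sum>n=1..N. expi (of_real (of_int h * poly f (of_nat n))))"

definition \<Delta> :: "nat \<Rightarrow> int \<Rightarrow> int \<Rightarrow> nat \<Rightarrow> real" where
  "\<Delta> d h q N =
     (let D = gcd h q in
      \<bar>of_int h\<bar> * inverse (of_int q) + inverse (of_nat N)
      + of_int q * of_nat N powi (- int d)
      + of_int D * of_nat N powi (- int d + 1))"

text \<open>
  The hypotheses on \<open>f, a, q, h\<close>.  A polynomial
  \<open>\<alpha>\<^sub>1 Z + \<dots> + \<alpha>\<^sub>d Z\<^sup>d\<close> of degree \<open>d\<close> is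
  a polynomial of degree exactly \<open>d\<close> without constant term.
\<close>
definition admissible :: "nat \<Rightarrow> real poly \<Rightarrow> int \<Rightarrow> int \<Rightarrow> int \<Rightarrow> bool" where
  "admissible d f a q h \<longleftrightarrow>
     degree f = d \<and> coeff f 0 = 0 \<and>
     q \<ge> 1 \<and> coprime a q \<and>
     \<bar>coeff f d - of_int a / of_int q\<bar> < 1 / (of_int q)\<^sup>2 \<and>
     h \<noteq> 0"

end

theory Submission
  imports Defs "HOL-Analysis.Analysis" "HOL-Number_Theory.Cong"
begin

text \<open>
  The core is the optimal Vinogradov mean value estimate of degree \<open>k = d - 1\<close>, at the exponent
  \<open>k (k + 1)\<close>. It follows from an \<open>\<ell>\<^sup>p\<close> decoupling inequality for exponential sums
  over residue classes modulo powers of one fixed prime, proved by induction on \<open>k\<close> in the style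
  of Guo, Li, Yung and Zorin-Kranich and of Wooley: on a product of two sums over residue classes
  that are incongruent modulo \<open>p\<close>, the powers of one factor can be decoupled by the inequality
  of lower degree without disturbing the other factor; alternating this with Hoelder's inequality gains an
  arbitrarily large multiple of the exponent of the decoupling constant, so that exponent must vanish.

  Averaging over shifts \<open>n \<mapsto> n + y\<close> turns the leading coefficient \<open>\<beta>\<close> of a polynomial of degree
  \<open>d\<close> into coefficients \<open>d \<beta> y\<close> of degree \<open>d - 1\<close>. The dual large sieve in this single
  coefficient and the mean value estimate give Weyl's bound with exponent \<open>1 / (d (d - 1))\<close> for
  \<open>\<beta> \<approx> b / r\<close>. A rational approximation \<open>b / r\<close> of \<open>h \<alpha>\<^sub>d\<close> with error \<open>\<delta>\<close> satisfies
  \<open>1 / \<lambda> \<le> 2 \<Delta>\<close> for \<open>\<lambda> = r max (1, N\<^sup>d \<bar>\<delta>\<bar>)\<close>, which gives the first bound.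

  For the second bound, the gap between the exponents \<open>1 / (d (d - 1))\<close> and \<open>1 / (d\<^sup>2 - d + 2)\<close> absorbs
  \<open>N\<^sup>\<epsilon>\<close> when \<open>\<lambda>\<close> is a power of \<open>N\<close>. When \<open>\<lambda>\<close> is smaller, the sum is cut into arithmetic progressions
  of length about \<open>\<lambda>\<^sup>2\<close>, on which the loss is only \<open>\<lambda>\<close> to a small power. The logarithm is then not needed.
\<close>

section \<open>Exponential sums over residue classes\<close>

text \<open>The classes are p-adic because an integer polynomial divided by a power of
  \<open>p\<close> then acts on the coefficients as an exact translation of a finite group: averages
  are invariant, and no cutoff functions or boundary terms arise. The prime is fixed in terms of the
  degree, so a fixed power of \<open>p\<close> is a constant. The obstacle is that lower-degree
  decoupling of one factor must leave the other untouched. Around \<xi> and \<eta> with \<xi> -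
  \<eta> prime to \<open>p\<close>, one polynomial can look like a monomial near \<xi> and be
  divisible by a high power of \<open>p\<close> near \<eta>; degree \<open>l\<close> is possible
  until the scale of the first class reaches \<open>a = (k - l + 1) b / l\<close>, and this law
  dictates all scales. With \<open>k = d - 1\<close> the exponent \<open>d (d - 1)\<close> is
  \<open>k (k + 1)\<close>: a saving in the moment of that order over the shifts reaches the sum
  itself only after the root of that order. The other exponent \<open>d (d - 1) + 2\<close> is
  strictly weaker, and any fixed positive gap between the two suffices for the removal of the power
  of \<open>N\<close>.\<close>

lemma pow_le_base:
  fixes a b :: real
  assumes "a ^ n \<le> b ^ n" "0 \<le> b" "0 < n"
  shows "a \<le> b"
  by (rule power_le_imp_le_base[of a "n - 1" b]) (use assms in simp_all)

section \<open>Inequalities of Young and Hoelder with natural exponents\<close>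

lemma weighted_am_gm_power:
  fixes x a b :: real
  assumes "x \<ge> 0" "a \<ge> 0" "b \<ge> 0" "0 < r" "r < P" "x ^ P \<le> a ^ r * b ^ (P - r)"
  shows "x \<le> real r / real P * a + (1 - real r / real P) * b"
proof (cases "a = 0 \<or> b = 0")
  case True
  hence "a ^ r * b ^ (P - r) = 0" using assms(4,5) by auto
  hence "x ^ P \<le> 0" using assms(6) by linarith
  hence "x = 0" using assms(1) by (metis power_eq_0_iff zero_le_power order_antisym)
  thus ?thesis using assms by simp
next
  case False
  hence ab: "a > 0" "b > 0" using assms by auto
  define t where "t = real r / real P"
  have t: "0 < t" "t < 1" using assms by (auto simp: t_def)
  have "(a powr t * b powr (1 - t)) ^ P = a ^ r * b ^ (P - r)"
  proof -
    have 1: "(a powr t) ^ P = a ^ r"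
      using ab assms by (simp add: t_def powr_powr flip: powr_realpow)
    have "(1 - t) * real P = real (P - r)"
      using assms by (simp add: t_def field_simps of_nat_diff)
    hence 2: "(b powr (1 - t)) ^ P = b ^ (P - r)"
      using ab by (simp add: powr_powr flip: powr_realpow)
    show ?thesis by (simp add: power_mult_distrib 1 2)
  qed
  with assms have "x ^ P \<le> (a powr t * b powr (1 - t)) ^ P" by simp
  hence "x \<le> a powr t * b powr (1 - t)"
    by (rule pow_le_base) (use assms in auto)
  also have "\<dots> \<le> t * a + (1 - t) * b"
    by (rule Youngs_inequality_0) (use t ab in auto)
  finally show ?thesis by (simp add: t_def)
qed

text \<open>Dividing by \<open>C\<close>, the bound to be shown for the sum of \<open>u\<close>,
  turns each pointwise hypothesis into Young's inequality, whose weights add up to 1. The form with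
  powers on both sides keeps natural exponents in all later uses.\<close>

lemma holder_sum_power:
  fixes u v w :: "'a \<Rightarrow> real"
  assumes nonneg: "\<And>i. i \<in> I \<Longrightarrow> u i \<ge> 0" "\<And>i. i \<in> I \<Longrightarrow> v i \<ge> 0" "\<And>i. i \<in> I \<Longrightarrow> w i \<ge> 0"
    and r: "r \<le> P" "P > 0"
    and le: "\<And>i. i \<in> I \<Longrightarrow> u i ^ P \<le> v i ^ r * w i ^ (P - r)"
  shows "sum u I ^ P \<le> sum v I ^ r * sum w I ^ (P - r)"
proof (cases "finite I")
  case False
  thus ?thesis using r by (simp add: power_0_left)
next
  case fin: True
  consider "r = 0" | "r = P" | "0 < r" "r < P" using r by linarith
  thus ?thesis
  proof cases
    case 1
    have "u i \<le> w i" if "i \<in> I" for i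
      by (rule pow_le_base[of "u i" P]) (use le[OF that] nonneg[OF that] r 1 in auto)
    hence "sum u I \<le> sum w I" by (rule sum_mono)
    thus ?thesis using 1 nonneg by (auto intro!: power_mono sum_nonneg)
  next
    case 2
    have "u i \<le> v i" if "i \<in> I" for i
      by (rule pow_le_base[of "u i" P]) (use le[OF that] nonneg[OF that] r 2 in auto)
    hence "sum u I \<le> sum v I" by (rule sum_mono)
    thus ?thesis using 2 nonneg by (auto intro!: power_mono sum_nonneg)
  next
    case 3
    define V where "V = sum v I"
    define W where "W = sum w I"
    have VW: "V \<ge> 0" "W \<ge> 0" unfolding V_def W_def using nonneg by (auto intro!: sum_nonneg)
    show ?thesis
    proof (cases "V = 0 \<or> W = 0")
      case True
      hence "(\<forall>i\<in>I. v i = 0) \<or> (\<forall>i\<in>I. w i = 0)"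
        using nonneg fin by (simp add: V_def W_def sum_nonneg_eq_0_iff)
      hence "u i = 0" if "i \<in> I" for i
      proof -
        have "v i ^ r * w i ^ (P - r) = 0"
          using that 3 \<open>(\<forall>i\<in>I. v i = 0) \<or> (\<forall>i\<in>I. w i = 0)\<close> by (auto simp: power_0_left)
        hence "u i ^ P \<le> 0" using le[OF that] by linarith
        thus ?thesis using nonneg(1)[OF that] by (metis power_eq_0_iff zero_le_power order_antisym)
      qed
      hence "sum u I = 0" by simp
      thus ?thesis using r VW by (simp add: power_0_left flip: V_def W_def)
    next
      case False
      hence VW0: "V > 0" "W > 0" using VW by auto
      define C where "C = V powr (real r / real P) * W powr (1 - real r / real P)"
      have C0: "C > 0" using VW0 by (simp add: C_def)
      have CP: "C ^ P = V ^ r * W ^ (P - r)"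
      proof -
        have 1: "(V powr (real r / real P)) ^ P = V ^ r"
          using VW0 3 by (simp add: powr_powr flip: powr_realpow)
        have "(1 - real r / real P) * real P = real (P - r)"
          using 3 by (simp add: field_simps of_nat_diff)
        hence 2: "(W powr (1 - real r / real P)) ^ P = W ^ (P - r)"
          using VW0 by (simp add: powr_powr flip: powr_realpow)
        show ?thesis by (simp add: C_def power_mult_distrib 1 2)
      qed
      have "u i / C \<le> real r / real P * (v i / V) + (1 - real r / real P) * (w i / W)" if "i \<in> I" for i
      proof (rule weighted_am_gm_power)
        have "(u i / C) ^ P = u i ^ P / (V ^ r * W ^ (P - r))" by (simp add: power_divide CP)
        also have "\<dots> \<le> (v i ^ r * w i ^ (P - r)) / (V ^ r * W ^ (P - r))"
          using le[OF that] VW0 by (intro divide_right_mono) auto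
        finally show "(u i / C) ^ P \<le> (v i / V) ^ r * (w i / W) ^ (P - r)"
          by (simp add: power_divide)
      qed (use nonneg[OF that] C0 VW0 3 in auto)
      hence "sum (\<lambda>i. u i / C) I \<le> sum (\<lambda>i. real r / real P * (v i / V) + (1 - real r / real P) * (w i / W)) I"
        by (rule sum_mono)
      also have "\<dots> = real r / real P * (V / V) + (1 - real r / real P) * (W / W)"
        by (simp only: sum.distrib V_def W_def sum_distrib_left[symmetric] sum_divide_distrib[symmetric])
      also have "\<dots> = 1" using VW0 by simp
      finally have "sum u I / C \<le> 1" by (simp add: sum_divide_distrib)
      hence "sum u I \<le> C" using C0 by simp
      hence "sum u I ^ P \<le> C ^ P" using nonneg by (intro power_mono sum_nonneg) auto
      thus ?thesis using CP by (simp add: V_def W_def)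
    qed
  qed
qed

section \<open>Additive characters and averages over coefficient vectors\<close>

definition ee :: "real \<Rightarrow> complex" where
  "ee x = cis (2 * pi * x)"

lemma ee_add: "ee (x + y) = ee x * ee y"
  by (simp add: ee_def cis_mult distrib_left)

lemma ee_diff: "ee (x - y) = ee x * cnj (ee y)"
  by (simp add: ee_def cis_mult right_diff_distrib cis_cnj)

lemma norm_ee [simp]: "cmod (ee x) = 1"
  by (simp add: ee_def)

lemma ee_0 [simp]: "ee 0 = 1"
  by (simp add: ee_def)

lemma ee_Ints: "x \<in> \<int> \<Longrightarrow> ee x = 1"
  by (simp add: ee_def)

lemma ee_of_int [simp]: "ee (of_int n) = 1"
  by (rule ee_Ints) simp

lemma ee_sum: "ee (sum f I) = prod (\<lambda>i. ee (f i)) I"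
  by (induction I rule: infinite_finite_induct) (simp_all add: ee_add)

lemma ee_cong:
  assumes "[a = b] (mod Q)"
  shows "ee (of_int a / of_int Q) = ee (of_int b / of_int Q)"
proof (cases "Q = 0")
  case True
  with assms show ?thesis by (simp add: cong_def)
next
  case False
  from assms obtain t where t: "a = b + Q * t"
    by (metis cong_iff_lin cong_sym)
  have "of_int a / of_int Q = of_int b / of_int Q + (of_int t :: real)"
    using False by (simp add: t field_simps)
  thus ?thesis by (simp add: ee_add)
qed

definition cube :: "nat \<Rightarrow> int \<Rightarrow> (nat \<Rightarrow> int) set" where
  "cube k Q = PiE {..k} (\<lambda>_. {0..<Q})"

lemma finite_cube [simp]: "finite (cube k Q)"
  by (simp add: cube_def finite_PiE)

lemma card_cube: "Q \<ge> 0 \<Longrightarrow> real (card (cube k Q)) = of_int Q ^ (k + 1)"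
  by (simp add: cube_def card_PiE)

definition av :: "nat \<Rightarrow> int \<Rightarrow> ((nat \<Rightarrow> int) \<Rightarrow> real) \<Rightarrow> real" where
  "av k Q H = (\<Sum>\<alpha>\<in>cube k Q. H \<alpha>) / of_int Q ^ (k + 1)"

lemma av_mono: "Q > 0 \<Longrightarrow> (\<And>\<alpha>. \<alpha> \<in> cube k Q \<Longrightarrow> H \<alpha> \<le> G \<alpha>) \<Longrightarrow> av k Q H \<le> av k Q G"
  by (auto simp: av_def intro!: divide_right_mono sum_mono)

lemma av_nonneg: "Q > 0 \<Longrightarrow> (\<And>\<alpha>. H \<alpha> \<ge> 0) \<Longrightarrow> av k Q H \<ge> 0"
  by (auto simp: av_def intro!: divide_nonneg_nonneg sum_nonneg)

lemma av_cong: "(\<And>\<alpha>. \<alpha> \<in> cube k Q \<Longrightarrow> H \<alpha> = G \<alpha>) \<Longrightarrow> av k Q H = av k Q G"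
  by (simp add: av_def)

lemma av_add: "av k Q (\<lambda>\<alpha>. H \<alpha> + G \<alpha>) = av k Q H + av k Q G"
  by (simp add: av_def sum.distrib add_divide_distrib)

lemma av_cmult: "av k Q (\<lambda>\<alpha>. c * H \<alpha>) = c * av k Q H"
  by (simp add: av_def flip: sum_distrib_left)

lemma av_cmult_right: "av k Q (\<lambda>\<alpha>. H \<alpha> * c) = av k Q H * c"
  by (simp add: av_def flip: sum_distrib_right)

lemma av_sum: "av k Q (\<lambda>\<alpha>. \<Sum>i\<in>I. H i \<alpha>) = (\<Sum>i\<in>I. av k Q (H i))"
  unfolding av_def by (subst sum.swap) (simp add: sum_divide_distrib)

lemma av_const: "Q > 0 \<Longrightarrow> av k Q (\<lambda>_. c) = c"
  using card_cube[of Q k] by (simp add: av_def)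

lemma av_swap: "av k Q (\<lambda>\<alpha>. av l R (\<lambda>u. H \<alpha> u)) = av l R (\<lambda>u. av k Q (\<lambda>\<alpha>. H \<alpha> u))"
proof -
  have "(\<Sum>\<alpha>\<in>cube k Q. \<Sum>u\<in>cube l R. H \<alpha> u) = (\<Sum>u\<in>cube l R. \<Sum>\<alpha>\<in>cube k Q. H \<alpha> u)"
    by (rule sum.swap)
  thus ?thesis by (simp add: av_def mult.commute flip: sum_divide_distrib)
qed

lemma holder_av_power:
  assumes "Q > 0" "\<And>\<alpha>. u \<alpha> \<ge> 0" "\<And>\<alpha>. v \<alpha> \<ge> 0" "\<And>\<alpha>. w \<alpha> \<ge> 0"
    and r: "r \<le> P" "P > 0"
    and le: "\<And>\<alpha>. \<alpha> \<in> cube k Q \<Longrightarrow> u \<alpha> ^ P \<le> v \<alpha> ^ r * w \<alpha> ^ (P - r)"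
  shows "av k Q u ^ P \<le> av k Q v ^ r * av k Q w ^ (P - r)"
proof -
  let ?n = "of_int Q ^ (k + 1) :: real"
  have "av k Q u ^ P = sum u (cube k Q) ^ P / ?n ^ P" by (simp add: av_def power_divide)
  also have "\<dots> \<le> (sum v (cube k Q) ^ r * sum w (cube k Q) ^ (P - r)) / ?n ^ P"
    by (intro divide_right_mono holder_sum_power) (use assms in auto)
  also have "?n ^ P = ?n ^ r * ?n ^ (P - r)"
    using r by (simp flip: power_add)
  finally show ?thesis by (simp add: av_def power_divide)
qed

text \<open>Only the coordinates up to \<open>k\<close> are compared, so a periodic function does
  not see that the elements of \<open>cube\<close> are \<open>undefined\<close> beyond
  \<open>k\<close>.\<close>

definition periodic :: "nat \<Rightarrow> int \<Rightarrow> ((nat \<Rightarrow> int) \<Rightarrow> 'a) \<Rightarrow> bool" where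
  "periodic k Q H \<longleftrightarrow> (\<forall>\<alpha> \<beta>. (\<forall>j\<le>k. [\<alpha> j = \<beta> j] (mod Q)) \<longrightarrow> H \<alpha> = H \<beta>)"

lemma periodicD: "periodic k Q H \<Longrightarrow> (\<And>j. j \<le> k \<Longrightarrow> [\<alpha> j = \<beta> j] (mod Q)) \<Longrightarrow> H \<alpha> = H \<beta>"
  unfolding periodic_def by blast

text \<open>Translation followed by reduction modulo \<open>Q\<close> permutes the cube. The
  translate itself leaves the cube, so the values of \<open>H\<close> there have to be tied to those
  inside by periodicity.\<close>

lemma av_translate:
  assumes "Q > 0" "periodic k Q H"
  shows "av k Q (\<lambda>\<alpha>. H (\<lambda>j. \<alpha> j + \<tau> j)) = av k Q H"
proof -
  have "(\<Sum>\<alpha>\<in>cube k Q. H (\<lambda>j. \<alpha> j + \<tau> j)) = (\<Sum>\<alpha>\<in>cube k Q. H \<alpha>)"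
  proof (rule sum.reindex_bij_witness[where
        i = "\<lambda>\<beta>. restrict (\<lambda>j. (\<beta> j - \<tau> j) mod Q) {..k}" and
        j = "\<lambda>\<alpha>. restrict (\<lambda>j. (\<alpha> j + \<tau> j) mod Q) {..k}"])
    fix \<alpha> assume a: "\<alpha> \<in> cube k Q"
    have 1: "\<alpha> j \<in> {0..<Q}" if "j \<le> k" for j using a that by (auto simp: cube_def)
    have 2: "\<alpha> j = undefined" if "\<not> j \<le> k" for j using a that by (auto simp: cube_def PiE_def extensional_def)
    show "restrict (\<lambda>j. (restrict (\<lambda>j. (\<alpha> j + \<tau> j) mod Q) {..k} j - \<tau> j) mod Q) {..k} = \<alpha>"
    proof
      fix j show "restrict (\<lambda>j. (restrict (\<lambda>j. (\<alpha> j + \<tau> j) mod Q) {..k} j - \<tau> j) mod Q) {..k} j = \<alpha> j"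
        using 1[of j] 2[of j] by (auto simp: mod_diff_left_eq)
    qed
    show "restrict (\<lambda>j. (restrict (\<lambda>j. (\<alpha> j - \<tau> j) mod Q) {..k} j + \<tau> j) mod Q) {..k} = \<alpha>"
    proof
      fix j show "restrict (\<lambda>j. (restrict (\<lambda>j. (\<alpha> j - \<tau> j) mod Q) {..k} j + \<tau> j) mod Q) {..k} j = \<alpha> j"
        using 1[of j] 2[of j] by (auto simp: mod_add_left_eq)
    qed
    show "restrict (\<lambda>j. (\<alpha> j + \<tau> j) mod Q) {..k} \<in> cube k Q"
      "restrict (\<lambda>j. (\<alpha> j - \<tau> j) mod Q) {..k} \<in> cube k Q"
      using assms(1) by (auto simp: cube_def)
    show "H (restrict (\<lambda>j. (\<alpha> j + \<tau> j) mod Q) {..k}) = H (\<lambda>j. \<alpha> j + \<tau> j)"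
      by (rule periodicD[OF assms(2)]) (auto simp: cong_def)
  qed
  thus ?thesis by (simp add: av_def)
qed

definition lin :: "nat \<Rightarrow> (nat \<Rightarrow> int) \<Rightarrow> int \<Rightarrow> int" where
  "lin k \<alpha> x = (\<Sum>j\<le>k. \<alpha> j * x ^ j)"

lemma lin_add: "lin k (\<lambda>j. \<alpha> j + \<beta> j) x = lin k \<alpha> x + lin k \<beta> x"
  by (simp add: lin_def sum.distrib algebra_simps)

lemma lin_cong: "(\<And>j. j \<le> k \<Longrightarrow> [\<alpha> j = \<beta> j] (mod Q)) \<Longrightarrow> [lin k \<alpha> x = lin k \<beta> x] (mod Q)"
  unfolding lin_def by (intro cong_sum cong_mult) auto

text \<open>
  The constant term is kept among the coefficients \<open>\<alpha>\<^sub>0, \<dots>, \<alpha>\<^sub>k\<close>, so that every integer polynomial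
  of degree at most \<open>k\<close> acts by a translation of \<open>\<alpha>\<close>, under which averages are invariant.
\<close>

definition F :: "nat \<Rightarrow> int \<Rightarrow> int set \<Rightarrow> (int \<Rightarrow> complex) \<Rightarrow> (nat \<Rightarrow> int) \<Rightarrow> complex" where
  "F k Q A c \<alpha> = (\<Sum>x\<in>A. c x * ee (of_int (lin k \<alpha> x) / of_int Q))"

lemma periodic_F: "periodic k Q (F k Q A c)"
  unfolding periodic_def F_def
  by (intro allI impI sum.cong refl arg_cong2[where f = times] ee_cong lin_cong) auto

lemma F_translate:
  "F k Q A c (\<lambda>j. \<alpha> j + \<tau> j) = (\<Sum>x\<in>A. c x * ee (of_int (lin k \<alpha> x) / of_int Q) * ee (of_int (lin k \<tau> x) / of_int Q))"
  by (simp add: F_def lin_add add_divide_distrib ee_add mult.assoc)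

section \<open>Residue classes modulo powers of the fixed prime\<close>

locale prime_base =
  fixes p :: int
  assumes prime_p: "prime p" and p_ge: "p \<ge> 8"
begin

lemma p_pos [simp]: "p > 0" "p \<ge> 0" "p \<noteq> 0" "p > 1" "p \<ge> 1"
  using p_ge by auto

definition cls :: "nat \<Rightarrow> int \<Rightarrow> int set" where
  "cls a \<xi> = {x. [x = \<xi>] (mod p ^ a)}"

text \<open>
  \<open>\<ell>\<^sup>p\<close> decoupling into residue classes modulo \<open>p ^ m\<close> with constant \<open>D\<close>, at the exponent \<open>k (k + 1)\<close>.
  The normalisation makes \<open>D = 1\<close> the square root cancellation that the induction approaches:
  for \<open>A\<close> meeting each class at most once and \<open>\<bar>c x\<bar> \<le> 1\<close>, the right-hand side is at most
  \<open>D (p ^ m) ^ (k (k + 1) / 2)\<close>.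
\<close>

definition dec :: "nat \<Rightarrow> nat \<Rightarrow> real \<Rightarrow> bool" where
  "dec k m D \<longleftrightarrow> (\<forall>A c. finite A \<longrightarrow>
     av k (p ^ (k * m)) (\<lambda>\<alpha>. cmod (F k (p ^ (k * m)) A c \<alpha>) ^ (k * (k + 1)))
     \<le> D * of_int p ^ (m * (k * (k + 1) div 2 - 1)) *
       (\<Sum>\<zeta>\<in>{0..<p ^ m}. av k (p ^ (k * m)) (\<lambda>\<alpha>. cmod (F k (p ^ (k * m)) (A \<inter> cls m \<zeta>) c \<alpha>) ^ (k * (k + 1)))))"

lemma cls_affine_iff: "\<xi> + p ^ a * z \<in> cls (a + m) (\<xi> + p ^ a * \<zeta>) \<longleftrightarrow> z \<in> cls m \<zeta>"
proof -
  have "[\<xi> + p ^ a * z = \<xi> + p ^ a * \<zeta>] (mod p ^ a * p ^ m) \<longleftrightarrow> [z = \<zeta>] (mod p ^ m)"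
    by (simp add: cong_add_lcancel cong_iff_dvd_diff flip: right_diff_distrib)
  thus ?thesis by (simp add: cls_def power_add)
qed

text \<open>
  Averaging first over the translates \<open>\<tau> u\<close> reduces the inequality of degree \<open>k\<close> to the one of degree \<open>l\<close>,
  in the variable \<open>z\<close> of \<open>x = \<xi> + p ^ a z\<close>; any weight \<open>\<Phi>\<close> that does not see these translates is carried along.
\<close>

lemma transfer:
  assumes dec: "dec l m D" and Q: "Q > 0" and A: "finite A" "A \<subseteq> cls a \<xi>"
    and \<Phi>: "\<And>\<alpha>. \<Phi> \<alpha> \<ge> 0" "periodic k Q \<Phi>"
      "\<And>u \<alpha>. u \<in> cube l (p ^ (l * m)) \<Longrightarrow> \<Phi> (\<lambda>j. \<alpha> j + \<tau> u j) = \<Phi> \<alpha>"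
    and g: "\<And>u. u \<in> cube l (p ^ (l * m)) \<Longrightarrow> cmod (g u) = 1"
    and phase: "\<And>u z. u \<in> cube l (p ^ (l * m)) \<Longrightarrow>
      ee (of_int (lin k (\<tau> u) (\<xi> + p ^ a * z)) / of_int Q) = g u * ee (of_int (lin l u z) / of_int (p ^ (l * m)))"
  shows "av k Q (\<lambda>\<alpha>. cmod (F k Q A c \<alpha>) ^ (l * (l + 1)) * \<Phi> \<alpha>)
    \<le> D * of_int p ^ (m * (l * (l + 1) div 2 - 1)) *
       (\<Sum>\<zeta>\<in>{0..<p ^ m}. av k Q (\<lambda>\<alpha>. cmod (F k Q (A \<inter> cls (a + m) (\<xi> + p ^ a * \<zeta>)) c \<alpha>) ^ (l * (l + 1)) * \<Phi> \<alpha>))"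
proof -
  define R where "R = p ^ (l * m)"
  have R: "R > 0" by (simp add: R_def)
  define h where "h = (\<lambda>z. \<xi> + p ^ a * z)"
  have inj: "inj h" by (auto simp: h_def inj_def)
  have rng: "B \<subseteq> range h" if "B \<subseteq> A" for B
  proof
    fix x assume "x \<in> B"
    hence "[x = \<xi>] (mod p ^ a)" using that A by (auto simp: cls_def)
    then obtain z where "x = \<xi> + p ^ a * z" by (metis cong_iff_lin cong_sym)
    thus "x \<in> range h" by (auto simp: h_def)
  qed
  \<comment> \<open>For fixed \<alpha> the old phase joins the coefficients; this is allowed because
    \<open>dec\<close> holds for arbitrary coefficients.\<close>
  define c' where "c' = (\<lambda>\<alpha> z. c (h z) * ee (of_int (lin k \<alpha> (h z)) / of_int Q))"
  have Ftr: "cmod (F k Q B c (\<lambda>j. \<alpha> j + \<tau> u j)) = cmod (F l R (h -` B) (c' \<alpha>) u)"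
    if "B \<subseteq> A" "u \<in> cube l R" for B u \<alpha>
  proof -
    have "F k Q B c (\<lambda>j. \<alpha> j + \<tau> u j) = (\<Sum>x\<in>h ` (h -` B). c x * ee (of_int (lin k \<alpha> x) / of_int Q) * ee (of_int (lin k (\<tau> u) x) / of_int Q))"
      using rng[OF that(1)] by (simp add: F_translate image_vimage_eq Int_absorb2)
    also have "\<dots> = (\<Sum>z\<in>h -` B. c (h z) * ee (of_int (lin k \<alpha> (h z)) / of_int Q) * ee (of_int (lin k (\<tau> u) (h z)) / of_int Q))"
      using inj by (subst sum.reindex) (auto intro: inj_on_subset)
    also have "\<dots> = (\<Sum>z\<in>h -` B. g u * (c' \<alpha> z * ee (of_int (lin l u z) / of_int R)))"
      using phase[of u] that(2) by (intro sum.cong refl) (simp add: c'_def h_def R_def)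
    also have "\<dots> = g u * F l R (h -` B) (c' \<alpha>) u"
      by (simp add: F_def sum_distrib_left)
    finally show ?thesis using g[of u] that(2) by (simp add: norm_mult R_def)
  qed
  \<comment> \<open>An average over \<open>u\<close> is inserted for free by translation invariance
    in \<alpha>. After the exchange of averages each fixed \<alpha> carries a sum of degree
    \<open>l\<close>, to which \<open>dec\<close> applies.\<close>
  have key: "av k Q (\<lambda>\<alpha>. cmod (F k Q B c \<alpha>) ^ e * \<Phi> \<alpha>) =
      av k Q (\<lambda>\<alpha>. av l R (\<lambda>u. cmod (F l R (h -` B) (c' \<alpha>) u) ^ e) * \<Phi> \<alpha>)" if "B \<subseteq> A" for B e
  proof -
    have per: "periodic k Q (\<lambda>\<alpha>. cmod (F k Q B c \<alpha>) ^ e * \<Phi> \<alpha>)"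
      using periodic_F[of k Q B c] \<Phi>(2) unfolding periodic_def by metis
    have "av k Q (\<lambda>\<alpha>. cmod (F k Q B c \<alpha>) ^ e * \<Phi> \<alpha>) = av l R (\<lambda>u. av k Q (\<lambda>\<alpha>. cmod (F k Q B c \<alpha>) ^ e * \<Phi> \<alpha>))"
      using R by (simp add: av_const)
    also have "\<dots> = av l R (\<lambda>u. av k Q (\<lambda>\<alpha>. cmod (F k Q B c (\<lambda>j. \<alpha> j + \<tau> u j)) ^ e * \<Phi> (\<lambda>j. \<alpha> j + \<tau> u j)))"
      by (intro av_cong av_translate[OF Q per, symmetric])
    also have "\<dots> = av l R (\<lambda>u. av k Q (\<lambda>\<alpha>. cmod (F l R (h -` B) (c' \<alpha>) u) ^ e * \<Phi> \<alpha>))"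
      using \<Phi>(3) that by (intro av_cong) (simp add: Ftr R_def)
    also have "\<dots> = av k Q (\<lambda>\<alpha>. av l R (\<lambda>u. cmod (F l R (h -` B) (c' \<alpha>) u) ^ e * \<Phi> \<alpha>))"
      by (rule av_swap[symmetric])
    finally show ?thesis by (simp add: av_cmult_right)
  qed
  have fin: "finite (h -` A)" using A inj by (intro finite_vimageI)
  have vim: "h -` (A \<inter> cls (a + m) (\<xi> + p ^ a * \<zeta>)) = h -` A \<inter> cls m \<zeta>" for \<zeta>
    using cls_affine_iff by (auto simp: h_def)
  have "av k Q (\<lambda>\<alpha>. cmod (F k Q A c \<alpha>) ^ (l * (l + 1)) * \<Phi> \<alpha>) =
     av k Q (\<lambda>\<alpha>. av l R (\<lambda>u. cmod (F l R (h -` A) (c' \<alpha>) u) ^ (l * (l + 1))) * \<Phi> \<alpha>)"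
    by (rule key) simp
  also have "\<dots> \<le> av k Q (\<lambda>\<alpha>. (D * of_int p ^ (m * (l * (l + 1) div 2 - 1)) *
       (\<Sum>\<zeta>\<in>{0..<p ^ m}. av l R (\<lambda>u. cmod (F l R (h -` A \<inter> cls m \<zeta>) (c' \<alpha>) u) ^ (l * (l + 1))))) * \<Phi> \<alpha>)"
    using dec fin \<Phi>(1) Q by (intro av_mono mult_right_mono) (auto simp: dec_def R_def)
  also have "\<dots> = D * of_int p ^ (m * (l * (l + 1) div 2 - 1)) *
     (\<Sum>\<zeta>\<in>{0..<p ^ m}. av k Q (\<lambda>\<alpha>. av l R (\<lambda>u. cmod (F l R (h -` A \<inter> cls m \<zeta>) (c' \<alpha>) u) ^ (l * (l + 1))) * \<Phi> \<alpha>))"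
    by (simp only: mult.assoc av_cmult sum_distrib_right av_sum)
  also have "(\<Sum>\<zeta>\<in>{0..<p ^ m}. av k Q (\<lambda>\<alpha>. av l R (\<lambda>u. cmod (F l R (h -` A \<inter> cls m \<zeta>) (c' \<alpha>) u) ^ (l * (l + 1))) * \<Phi> \<alpha>)) =
     (\<Sum>\<zeta>\<in>{0..<p ^ m}. av k Q (\<lambda>\<alpha>. cmod (F k Q (A \<inter> cls (a + m) (\<xi> + p ^ a * \<zeta>)) c \<alpha>) ^ (l * (l + 1)) * \<Phi> \<alpha>))"
    by (intro sum.cong refl) (simp only: key[OF Int_lower1] vim)
  finally show ?thesis .
qed

end

section \<open>Transverse residue classes\<close>

text \<open>
  The polynomial vanishes to high order at \<open>0\<close> and looks like a monomial \<open>y ^ j\<close> at the transverse point \<open>w\<close>.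
  Up to the factor \<open>fact k\<close>, which clears denominators, it is the antiderivative of \<open>X ^ (k - l) S\<close>,
  where \<open>S\<close> is \<open>y ^ (j - 1)\<close> times the inverse of \<open>(w + y) ^ (k - l)\<close> modulo \<open>y ^ l\<close>, cleared of powers of \<open>w\<close>.
\<close>

lemma transverse_poly:
  fixes w :: int
  assumes "1 \<le> j" "j \<le> l" "l \<le> k"
  shows "\<exists>(q :: int poly) R \<kappa>. degree q \<le> k \<and> monom 1 (k - l + 1) dvd q \<and>
    (\<forall>y. poly q (w + y) = \<kappa> + (fact k div int j) * w ^ (l * (k - l)) * y ^ j + y ^ (l + 1) * poly R y)"
proof -
  define n where "n = k - l"
  define X where "X = [:w, 1:]"
  define Y where "Y = (monom 1 1 :: int poly)"
  \<comment> \<open>By the geometric series, \<open>V\<close> inverts \<open>w + y\<close> modulo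
    \<open>y ^ l\<close> up to the factor \<open>w ^ l\<close>, with integral coefficients.\<close>
  define V where "V = (\<Sum>i<l. [:w:] ^ (l - Suc i) * (- Y) ^ i)"
  have XV: "X * V = [:w ^ l:] - (- Y) ^ l"
  proof -
    have "(- Y) ^ l - [:w:] ^ l = (- Y - [:w:]) * V"
      unfolding V_def by (rule power_diff_sumr2)
    moreover have "- Y - [:w:] = - X" by (simp add: X_def Y_def monom_altdef)
    ultimately show ?thesis by (simp add: poly_const_pow algebra_simps)
  qed
  have Ydvd: "Y ^ l dvd X ^ n * V ^ n - [:w ^ (l * n):]"
  proof -
    have "X * V - [:w ^ l:] dvd (X * V) ^ n - [:w ^ l:] ^ n"
      by (simp add: power_diff_sumr2)
    moreover have "X * V - [:w ^ l:] = Y ^ l * (- ((- 1) ^ l))"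
      by (simp add: XV power_minus[of Y l])
    ultimately have "Y ^ l dvd (X * V) ^ n - [:w ^ l:] ^ n"
      by (metis dvd_triv_left dvd_trans)
    thus ?thesis
      by (simp add: power_mult_distrib poly_const_pow power_mult)
  qed
  have Yl: "Y ^ i = monom 1 i" for i by (simp add: Y_def monom_power)
  define S0 where "S0 = Y ^ (j - 1) * V ^ n"
  \<comment> \<open>Truncation below degree \<open>l\<close> changes nothing modulo
    \<open>Y ^ l\<close> and keeps the degree of the antiderivative at most
    \<open>k\<close>.\<close>
  define S where "S = (\<Sum>i<l. monom (coeff S0 i) i)"
  have cS: "coeff S i = (if i < l then coeff S0 i else 0)" for i
    by (auto simp: S_def coeff_sum)
  have "Y ^ l dvd S0 - S"
    by (simp add: Yl monom_1_dvd_iff' cS)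
  hence "Y ^ l dvd X ^ n * (S0 - S)" by (rule dvd_mult)
  moreover have "Y ^ l dvd Y ^ (j - 1) * (X ^ n * V ^ n - [:w ^ (l * n):])"
    using Ydvd by (rule dvd_mult)
  ultimately have "Y ^ l dvd Y ^ (j - 1) * (X ^ n * V ^ n - [:w ^ (l * n):]) - X ^ n * (S0 - S)"
    by (rule dvd_diff[rotated])
  hence Gdvd: "monom 1 l dvd X ^ n * S - monom (w ^ (l * n)) (j - 1)"
    by (simp add: S0_def algebra_simps Yl smult_monom)
  have degS: "degree S \<le> l - 1"
    by (rule degree_le) (use assms in \<open>auto simp: cS\<close>)
  define G' where "G' = monom 1 n * pcompose S [:-w, 1:]"
  have degG: "degree G' < k"
  proof -
    have "degree G' \<le> n + (l - 1)"
      unfolding G'_def using degree_mult_le[of "monom 1 n" "pcompose S [:-w, 1:]"] degS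
      by (simp add: degree_monom_eq degree_pcompose)
    thus ?thesis using assms by (simp add: n_def)
  qed
  have G: "pcompose G' X = X ^ n * S"
  proof -
    have "pcompose (pcompose S [:-w, 1:]) X = S"
      by (simp add: pcompose_assoc[symmetric] X_def pcompose_pCons)
    moreover have "pcompose (monom 1 i) X = X ^ i" for i
      by (induction i) (simp_all add: monom_0 monom_Suc pcompose_pCons)
    ultimately show ?thesis by (simp add: G'_def pcompose_mult)
  qed
  define q where "q = (\<Sum>i<k. monom (fact k div int (i + 1) * coeff G' i) (i + 1))"
  have cq: "coeff q (Suc i) = (if i < k then fact k div int (i + 1) * coeff G' i else 0)" for i
    by (auto simp: q_def coeff_sum)
  have cq0: "coeff q 0 = 0" by (simp add: q_def coeff_sum)
  have degq: "degree q \<le> k"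
  proof (rule degree_le, intro allI impI)
    fix i assume "i > k" thus "coeff q i = 0" by (cases i) (auto simp: cq)
  qed
  have dvdfact: "int i dvd fact k" if "1 \<le> i" "i \<le> k" for i
  proof -
    have "int i dvd int (fact k)" using that by (intro of_nat_dvd_iff[THEN iffD2] dvd_fact) auto
    thus ?thesis by simp
  qed
  have "pderiv q = smult (fact k) G'"
  proof (rule poly_eqI)
    fix i
    show "coeff (pderiv q) i = coeff (smult (fact k) G') i"
    proof (cases "i < k")
      case True
      hence "int (i + 1) * (fact k div int (i + 1)) = fact k"
        by (intro dvd_mult_div_cancel dvdfact) auto
      thus ?thesis using True
        by (simp add: coeff_pderiv cq mult.assoc[symmetric] del: of_nat_Suc of_nat_add)
    next
      case False
      thus ?thesis using degG by (simp add: coeff_pderiv cq coeff_eq_0)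
    qed
  qed
  moreover define H where "H = pcompose q X"
  ultimately have dH: "pderiv H = smult (fact k) (X ^ n * S)"
    by (simp add: pderiv_pcompose G pcompose_smult) (simp add: X_def pderiv_pCons)
  have cH: "int (Suc i) * coeff H (Suc i) = fact k * (if i = j - 1 then w ^ (l * n) else 0)" if "i < l" for i
  proof -
    have "coeff (X ^ n * S - monom (w ^ (l * n)) (j - 1)) i = 0"
      using Gdvd that by (simp only: monom_1_dvd_iff')
    moreover have "int (Suc i) * coeff H (Suc i) = fact k * coeff (X ^ n * S) i"
      using arg_cong[OF dH, of "\<lambda>p. coeff p i"] by (simp add: coeff_pderiv)
    ultimately show ?thesis by auto
  qed
  have cHj: "coeff H j = fact k div int j * w ^ (l * n)"
  proof -
    have "int j * coeff H j = fact k * w ^ (l * n)" using cH[of "j - 1"] assms by simp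
    also have "fact k = int j * (fact k div int j)"
      using dvdfact[of j] assms by simp
    finally show ?thesis using assms by (simp add: mult.assoc)
  qed
  have cH0: "coeff H i = 0" if "1 \<le> i" "i \<le> l" "i \<noteq> j" for i
  proof -
    have "i - 1 \<noteq> j - 1" "i - 1 < l" "Suc (i - 1) = i" using that assms by linarith+
    thus ?thesis using cH[of "i - 1"] that by simp
  qed
  define c where "c = coeff H 0"
  have "monom 1 (l + 1) dvd H - [:c:] - monom (fact k div int j * w ^ (l * n)) j"
    unfolding monom_1_dvd_iff'
  proof (intro allI impI)
    fix i assume i: "i < l + 1"
    show "coeff (H - [:c:] - monom (fact k div int j * w ^ (l * n)) j) i = 0"
      using assms i cHj cH0[of i] by (cases "i = 0") (auto simp: c_def coeff_pCons split: nat.splits)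
  qed
  then obtain R where R: "H - [:c:] - monom (fact k div int j * w ^ (l * n)) j = monom 1 (l + 1) * R"
    by (elim dvdE)
  have "poly q (w + y) = c + (fact k div int j) * w ^ (l * n) * y ^ j + y ^ (l + 1) * poly R y" for y
  proof -
    have "poly H y = poly q (w + y)" by (simp add: H_def poly_pcompose X_def)
    moreover have "poly (H - [:c:] - monom (fact k div int j * w ^ (l * n)) j) y = poly (monom 1 (l + 1) * R) y"
      by (simp only: R)
    ultimately show ?thesis by (simp add: poly_monom algebra_simps)
  qed
  moreover have "monom 1 (n + 1) dvd q"
    unfolding monom_1_dvd_iff'
  proof (intro allI impI)
    fix i assume "i < n + 1"
    moreover have "coeff G' i = 0" if "i < n" for i
      using that by (simp add: G'_def coeff_monom_mult)
    ultimately show "coeff q i = 0" by (cases i) (auto simp: cq cq0)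
  qed
  ultimately show ?thesis using degq unfolding n_def by blast
qed

context prime_base
begin

section \<open>Splitting, rescaling and bilinear inequalities\<close>

lemma mem_cls: "x \<in> cls a \<xi> \<Longrightarrow> \<exists>z. x = \<xi> + p ^ a * z"
  unfolding cls_def by (metis cong_iff_lin cong_sym mem_Collect_eq)

lemma cls_mono: "a \<le> a' \<Longrightarrow> cls a' (\<xi> + p ^ a * z) \<subseteq> cls a \<xi>"
proof
  fix x assume "a \<le> a'" "x \<in> cls a' (\<xi> + p ^ a * z)"
  hence "[x = \<xi> + p ^ a * z] (mod p ^ a)"
    by (auto simp: cls_def intro: cong_dvd_modulus le_imp_power_dvd)
  also have "[\<xi> + p ^ a * z = \<xi>] (mod p ^ a)" by (simp add: cong_iff_dvd_diff)
  finally show "x \<in> cls a \<xi>" by (simp add: cls_def)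
qed

lemma sum_cls:
  assumes "finite A" "A \<subseteq> cls a \<xi>"
  shows "(\<Sum>\<zeta>\<in>{0..<p ^ m}. \<Sum>x\<in>A \<inter> cls (a + m) (\<xi> + p ^ a * \<zeta>). f x) = (\<Sum>x\<in>A. f x)"
proof -
  define g where "g = (\<lambda>x. ((x - \<xi>) div p ^ a) mod p ^ m)"
  have "{x \<in> A. g x = \<zeta>} = A \<inter> cls (a + m) (\<xi> + p ^ a * \<zeta>)" if "\<zeta> \<in> {0..<p ^ m}" for \<zeta>
  proof -
    have "g x = \<zeta> \<longleftrightarrow> x \<in> cls (a + m) (\<xi> + p ^ a * \<zeta>)" if "x \<in> A" for x
    proof -
      from that assms(2) obtain z where z: "x = \<xi> + p ^ a * z" using mem_cls by blast
      show ?thesis using \<open>\<zeta> \<in> {0..<p ^ m}\<close> unfolding z cls_affine_iff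
        by (auto simp: g_def cls_def cong_def)
    qed
    thus ?thesis by auto
  qed
  hence "(\<Sum>\<zeta>\<in>{0..<p ^ m}. \<Sum>x\<in>A \<inter> cls (a + m) (\<xi> + p ^ a * \<zeta>). f x) = (\<Sum>\<zeta>\<in>{0..<p ^ m}. sum f {x \<in> A. g x = \<zeta>})"
    by (intro sum.cong) auto
  also have "\<dots> = sum f A"
    by (rule sum.group) (use assms in \<open>auto simp: g_def\<close>)
  finally show ?thesis .
qed

lemma F_cls:
  assumes "finite A" "A \<subseteq> cls a \<xi>"
  shows "F k Q A c \<alpha> = (\<Sum>\<zeta>\<in>{0..<p ^ m}. F k Q (A \<inter> cls (a + m) (\<xi> + p ^ a * \<zeta>)) c \<alpha>)"
  unfolding F_def by (rule sum_cls[OF assms, symmetric])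

lemma power_mean_norm:
  fixes f :: "'a \<Rightarrow> complex"
  assumes "e \<ge> 1"
  shows "cmod (sum f I) ^ e \<le> real (card I) ^ (e - 1) * (\<Sum>i\<in>I. cmod (f i) ^ e)"
proof -
  have "cmod (sum f I) ^ e \<le> (\<Sum>i\<in>I. cmod (f i)) ^ e"
    by (intro power_mono norm_sum) auto
  also have "\<dots> \<le> (\<Sum>i\<in>I. cmod (f i) ^ e) ^ 1 * (\<Sum>i\<in>I. 1) ^ (e - 1)"
    by (rule holder_sum_power) (use assms in auto)
  finally show ?thesis by (simp add: mult.commute)
qed

text \<open>This loses \<open>p ^ (m e / 2)\<close> against the normalisation of square root
  cancellation. It supplies the starting exponent of the induction and, later, the price for
  reaching fine scales.\<close>

lemma trivial_split:
  assumes "e \<ge> 1" "Q > 0" "finite A" "A \<subseteq> cls a \<xi>" "\<And>\<alpha>. \<Phi> \<alpha> \<ge> 0"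
  shows "av k Q (\<lambda>\<alpha>. cmod (F k Q A c \<alpha>) ^ e * \<Phi> \<alpha>) \<le> of_int p ^ (m * (e - 1)) *
    (\<Sum>\<zeta>\<in>{0..<p ^ m}. av k Q (\<lambda>\<alpha>. cmod (F k Q (A \<inter> cls (a + m) (\<xi> + p ^ a * \<zeta>)) c \<alpha>) ^ e * \<Phi> \<alpha>))"
proof -
  have "av k Q (\<lambda>\<alpha>. cmod (F k Q A c \<alpha>) ^ e * \<Phi> \<alpha>) \<le> av k Q (\<lambda>\<alpha>. of_int p ^ (m * (e - 1)) *
    (\<Sum>\<zeta>\<in>{0..<p ^ m}. cmod (F k Q (A \<inter> cls (a + m) (\<xi> + p ^ a * \<zeta>)) c \<alpha>) ^ e * \<Phi> \<alpha>))"
  proof (rule av_mono[OF assms(2)])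
    fix \<alpha>
    have "cmod (F k Q A c \<alpha>) ^ e \<le> of_int p ^ (m * (e - 1)) * (\<Sum>\<zeta>\<in>{0..<p ^ m}. cmod (F k Q (A \<inter> cls (a + m) (\<xi> + p ^ a * \<zeta>)) c \<alpha>) ^ e)"
      using power_mean_norm[OF assms(1), of "\<lambda>\<zeta>. F k Q (A \<inter> cls (a + m) (\<xi> + p ^ a * \<zeta>)) c \<alpha>" "{0..<p ^ m}"]
      by (simp add: F_cls[OF assms(3,4), of _ _ _ _ m, symmetric] power_mult)
    hence "cmod (F k Q A c \<alpha>) ^ e * \<Phi> \<alpha> \<le> of_int p ^ (m * (e - 1)) * (\<Sum>\<zeta>\<in>{0..<p ^ m}. cmod (F k Q (A \<inter> cls (a + m) (\<xi> + p ^ a * \<zeta>)) c \<alpha>) ^ e) * \<Phi> \<alpha>"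
      using assms(5) by (rule mult_right_mono)
    thus "cmod (F k Q A c \<alpha>) ^ e * \<Phi> \<alpha> \<le> of_int p ^ (m * (e - 1)) * (\<Sum>\<zeta>\<in>{0..<p ^ m}. cmod (F k Q (A \<inter> cls (a + m) (\<xi> + p ^ a * \<zeta>)) c \<alpha>) ^ e * \<Phi> \<alpha>)"
      by (simp add: sum_distrib_right mult.assoc)
  qed
  also have "\<dots> = of_int p ^ (m * (e - 1)) *
    (\<Sum>\<zeta>\<in>{0..<p ^ m}. av k Q (\<lambda>\<alpha>. cmod (F k Q (A \<inter> cls (a + m) (\<xi> + p ^ a * \<zeta>)) c \<alpha>) ^ e * \<Phi> \<alpha>))"
    by (simp only: av_cmult av_sum)
  finally show ?thesis .
qed

lemma dec_mono: "dec k m D \<Longrightarrow> D \<le> D' \<Longrightarrow> dec k m D'"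
  unfolding dec_def
  by (intro allI impI, erule allE, erule allE, erule (1) impE, erule order_trans)
     (intro mult_right_mono sum_nonneg av_nonneg, auto)

lemma dec_trivial:
  assumes "k \<ge> 1"
  shows "dec k m (of_int p ^ (m * (k * (k + 1) div 2)))"
  unfolding dec_def
proof (intro allI impI)
  fix A :: "int set" and c :: "int \<Rightarrow> complex" assume A: "finite A"
  let ?e = "k * (k + 1)"
  have e: "?e = 2 * (?e div 2)" by simp
  have h: "?e div 2 \<ge> 1" using assms by (cases k) auto
  have "?e - 1 = ?e div 2 + (?e div 2 - 1)" using e h by linarith
  hence "m * (?e - 1) = m * (?e div 2) + m * (?e div 2 - 1)" by (metis distrib_left)
  moreover have "A \<subseteq> cls 0 0" by (auto simp: cls_def)
  ultimately show "av k (p ^ (k * m)) (\<lambda>\<alpha>. cmod (F k (p ^ (k * m)) A c \<alpha>) ^ ?e)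
    \<le> of_int p ^ (m * (?e div 2)) * of_int p ^ (m * (?e div 2 - 1)) *
       (\<Sum>\<zeta>\<in>{0..<p ^ m}. av k (p ^ (k * m)) (\<lambda>\<alpha>. cmod (F k (p ^ (k * m)) (A \<inter> cls m \<zeta>) c \<alpha>) ^ ?e))"
    using trivial_split[of ?e "p ^ (k * m)" A 0 0 "\<lambda>_. 1" k c m] assms A
    by (simp add: power_add)
qed

text \<open>
  The right-hand side of the decoupling inequality for the single class of \<open>\<xi>\<close> modulo \<open>p ^ a\<close>,
  split at the finest scale \<open>p ^ m\<close>.
\<close>

definition Sb :: "nat \<Rightarrow> nat \<Rightarrow> nat \<Rightarrow> int \<Rightarrow> int set \<Rightarrow> (int \<Rightarrow> complex) \<Rightarrow> real" where
  "Sb k m a \<xi> A c = of_int p ^ ((m - a) * (k * (k + 1) div 2 - 1)) *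
     (\<Sum>\<zeta>\<in>{0..<p ^ (m - a)}. av k (p ^ (k * m)) (\<lambda>\<alpha>. cmod (F k (p ^ (k * m)) (A \<inter> cls m (\<xi> + p ^ a * \<zeta>)) c \<alpha>) ^ (k * (k + 1))))"

lemma Sb_nonneg: "Sb k m a \<xi> A c \<ge> 0"
  unfolding Sb_def by (intro mult_nonneg_nonneg sum_nonneg av_nonneg) auto

lemma sum_digits:
  "(\<Sum>\<zeta>\<in>{0..<p ^ s}. \<Sum>z\<in>{0..<p ^ t}. f (\<zeta> + p ^ s * z)) = (\<Sum>\<zeta>\<in>{0..<p ^ (s + t)}. f \<zeta>)"
proof -
  have "(\<Sum>\<zeta>\<in>{0..<p ^ s}. \<Sum>z\<in>{0..<p ^ t}. f (\<zeta> + p ^ s * z)) = (\<Sum>(\<zeta>, z)\<in>{0..<p ^ s} \<times> {0..<p ^ t}. f (\<zeta> + p ^ s * z))"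
    by (rule sum.cartesian_product)
  also have "\<dots> = (\<Sum>\<zeta>\<in>{0..<p ^ (s + t)}. f \<zeta>)"
  proof (rule sum.reindex_bij_witness[where i = "\<lambda>n. (n mod p ^ s, n div p ^ s)" and j = "\<lambda>(\<zeta>, z). \<zeta> + p ^ s * z"])
    fix x assume x: "x \<in> {0..<p ^ s} \<times> {0..<p ^ t}"
    then obtain \<zeta> z where [simp]: "x = (\<zeta>, z)" and b: "0 \<le> \<zeta>" "\<zeta> < p ^ s" "0 \<le> z" "z < p ^ t" by auto
    have "\<zeta> + p ^ s * z < p ^ s * (z + 1)" using b by (simp add: algebra_simps)
    also have "\<dots> \<le> p ^ s * p ^ t" using b by (intro mult_left_mono) auto
    finally show "(case x of (\<zeta>, z) \<Rightarrow> \<zeta> + p ^ s * z) \<in> {0..<p ^ (s + t)}" using b by (simp add: power_add)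
    show "((case x of (\<zeta>, z) \<Rightarrow> \<zeta> + p ^ s * z) mod p ^ s, (case x of (\<zeta>, z) \<Rightarrow> \<zeta> + p ^ s * z) div p ^ s) = x"
      using b by (simp add: div_add1_eq)
  next
    fix n assume "n \<in> {0..<p ^ (s + t)}"
    hence n: "0 \<le> n" "n < p ^ t * p ^ s" by (auto simp: power_add mult.commute)
    have "n div p ^ s < p ^ t"
    proof (rule ccontr)
      assume "\<not> n div p ^ s < p ^ t"
      hence "p ^ t * p ^ s \<le> (n div p ^ s) * p ^ s" by (intro mult_right_mono) auto
      also have "\<dots> \<le> n" using div_mult_mod_eq[of n "p ^ s"] pos_mod_sign[of "p ^ s" n, OF zero_less_power[OF p_pos(1)]] by linarith
      finally show False using n by simp
    qed
    thus "(n mod p ^ s, n div p ^ s) \<in> {0..<p ^ s} \<times> {0..<p ^ t}"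
      using n by (auto simp: pos_imp_zdiv_nonneg_iff)
  qed auto
  finally show ?thesis .
qed

lemma Sb_split:
  assumes "a + s \<le> m"
  shows "Sb k m a \<xi> A c = of_int p ^ (s * (k * (k + 1) div 2 - 1)) * (\<Sum>\<zeta>\<in>{0..<p ^ s}. Sb k m (a + s) (\<xi> + p ^ a * \<zeta>) A c)"
proof -
  have ms: "m - a = s + (m - (a + s))" using assms by simp
  define f where "f = (\<lambda>\<zeta>. av k (p ^ (k * m)) (\<lambda>\<alpha>. cmod (F k (p ^ (k * m)) (A \<inter> cls m (\<xi> + p ^ a * \<zeta>)) c \<alpha>) ^ (k * (k + 1))))"
  have "(\<Sum>\<zeta>\<in>{0..<p ^ (m - a)}. f \<zeta>) = (\<Sum>\<zeta>\<in>{0..<p ^ s}. \<Sum>z\<in>{0..<p ^ (m - (a + s))}. f (\<zeta> + p ^ s * z))"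
    by (subst ms, rule sum_digits[symmetric])
  moreover have "f (\<zeta> + p ^ s * z) = av k (p ^ (k * m)) (\<lambda>\<alpha>. cmod (F k (p ^ (k * m)) (A \<inter> cls m (\<xi> + p ^ a * \<zeta> + p ^ (a + s) * z)) c \<alpha>) ^ (k * (k + 1)))" for \<zeta> z
  proof -
    have "\<xi> + p ^ a * (\<zeta> + p ^ s * z) = \<xi> + p ^ a * \<zeta> + p ^ (a + s) * z" by (simp add: power_add algebra_simps)
    thus ?thesis by (simp only: f_def)
  qed
  moreover have "(m - a) * (k * (k + 1) div 2 - 1) = s * (k * (k + 1) div 2 - 1) + (m - (a + s)) * (k * (k + 1) div 2 - 1)"
    by (subst ms) (rule distrib_right)
  ultimately show ?thesis
    unfolding Sb_def sum_distrib_left[symmetric] f_def[symmetric] by (simp add: power_add mult.assoc)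
qed

lemma lin_coeff:
  assumes "degree q \<le> k"
  shows "lin k (coeff q) x = poly q x"
proof -
  have "(\<Sum>i\<le>k. coeff q i * x ^ i) = (\<Sum>i\<le>degree q. coeff q i * x ^ i)"
    by (rule sum.mono_neutral_right) (use assms in \<open>auto simp: coeff_eq_0\<close>)
  thus ?thesis by (simp add: lin_def poly_altdef)
qed

text \<open>The class of \<xi> modulo \<open>p ^ a\<close>, in the variable \<open>z\<close> of
  \<open>x = \<xi> + p ^ a z\<close>, is again the full problem at scale
  \<open>m - a\<close>.\<close>

lemma dec_rescale:
  assumes "dec k (m - a) D" "a \<le> m" "finite A"
  shows "av k (p ^ (k * m)) (\<lambda>\<alpha>. cmod (F k (p ^ (k * m)) (A \<inter> cls a \<xi>) c \<alpha>) ^ (k * (k + 1))) \<le> D * Sb k m a \<xi> A c"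
proof -
  define Q where "Q = p ^ (k * m)"
  define q where "q = (\<lambda>j. [:- \<xi>, 1:] ^ j)"
  \<comment> \<open>The factor \<open>p ^ (k a - j a)\<close> turns \<open>(x - \<xi>) ^ j\<close>
    into \<open>p ^ (k a) z ^ j\<close>, so that all monomials in \<open>z\<close> get the same
    modulus \<open>p ^ (k (m - a))\<close>.\<close>
  define \<tau> where "\<tau> = (\<lambda>u i. \<Sum>j\<le>k. u j * p ^ (k * a - j * a) * coeff (q j) i)"
  have dq: "degree (q j) \<le> k" if "j \<le> k" for j
    using that degree_power_le[of "[:- \<xi>, 1:]" j] by (simp add: q_def)
  have lin\<tau>: "lin k (\<tau> u) x = (\<Sum>j\<le>k. u j * p ^ (k * a - j * a) * (x - \<xi>) ^ j)" for u x
  proof -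
    have "lin k (\<tau> u) x = (\<Sum>j\<le>k. u j * p ^ (k * a - j * a) * lin k (coeff (q j)) x)"
      unfolding lin_def \<tau>_def sum_distrib_left sum_distrib_right by (subst sum.swap) (simp add: mult_ac)
    also have "\<dots> = (\<Sum>j\<le>k. u j * p ^ (k * a - j * a) * (x - \<xi>) ^ j)"
      by (intro sum.cong refl) (simp add: lin_coeff dq, simp add: q_def)
    finally show ?thesis .
  qed
  have 1: "k * m = k * (m - a) + k * a" using assms(2) by (simp flip: distrib_left)
  have "lin k (\<tau> u) (\<xi> + p ^ a * z) = p ^ (k * a) * lin k u z" for u z
  proof -
    have "p ^ (k * a - j * a) * (p ^ a * z) ^ j = p ^ (k * a) * z ^ j" if "j \<le> k" for j
    proof -
      have "k * a - j * a + a * j = k * a" using that by (simp add: mult.commute mult_le_mono)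
      hence "p ^ (k * a - j * a) * p ^ (a * j) = p ^ (k * a)" by (metis power_add)
      thus ?thesis by (simp add: power_mult_distrib mult.assoc flip: power_mult)
    qed
    thus ?thesis unfolding lin\<tau> unfolding lin_def sum_distrib_left
      by (intro sum.cong) (simp_all add: mult.assoc mult.left_commute)
  qed
  hence phase: "ee (of_int (lin k (\<tau> u) (\<xi> + p ^ a * z)) / of_int Q) = 1 * ee (of_int (lin k u z) / of_int (p ^ (k * (m - a))))" for u z
    by (simp add: Q_def 1 power_add)
  have Acls: "A \<inter> cls a \<xi> \<inter> cls (a + (m - a)) (\<xi> + p ^ a * \<zeta>) = A \<inter> cls m (\<xi> + p ^ a * \<zeta>)" for \<zeta>
    using cls_mono[of a m \<xi> \<zeta>] assms(2) by auto
  have "av k Q (\<lambda>\<alpha>. cmod (F k Q (A \<inter> cls a \<xi>) c \<alpha>) ^ (k * (k + 1)) * 1) \<le> D * of_int p ^ ((m - a) * (k * (k + 1) div 2 - 1)) *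
       (\<Sum>\<zeta>\<in>{0..<p ^ (m - a)}. av k Q (\<lambda>\<alpha>. cmod (F k Q (A \<inter> cls a \<xi> \<inter> cls (a + (m - a)) (\<xi> + p ^ a * \<zeta>)) c \<alpha>) ^ (k * (k + 1)) * 1))"
    by (rule transfer[OF assms(1), where \<tau> = \<tau> and g = "\<lambda>_. 1"]) (use assms(3) phase in \<open>auto simp: Q_def periodic_def\<close>)
  thus ?thesis unfolding Acls by (simp add: Sb_def Q_def)
qed

text \<open>
  The inequality is raised to the power \<open>k (k + 1)\<close>, so that only natural exponents occur.
\<close>

definition bil :: "nat \<Rightarrow> nat \<Rightarrow> nat \<Rightarrow> nat \<Rightarrow> nat \<Rightarrow> real \<Rightarrow> bool" where
  "bil k m r a b K \<longleftrightarrow> (\<forall>A c \<xi> \<eta>. finite A \<longrightarrow> \<not> p dvd (\<xi> - \<eta>) \<longrightarrow>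
    (av k (p ^ (k * m)) (\<lambda>\<alpha>. cmod (F k (p ^ (k * m)) (A \<inter> cls a \<xi>) c \<alpha>) ^ r *
       cmod (F k (p ^ (k * m)) (A \<inter> cls b \<eta>) c \<alpha>) ^ (k * (k + 1) - r))) ^ (k * (k + 1))
    \<le> K * Sb k m a \<xi> A c ^ r * Sb k m b \<eta> A c ^ (k * (k + 1) - r))"

lemma bilD:
  "bil k m r a b K \<Longrightarrow> finite A \<Longrightarrow> \<not> p dvd (\<xi> - \<eta>) \<Longrightarrow>
    (av k (p ^ (k * m)) (\<lambda>\<alpha>. cmod (F k (p ^ (k * m)) (A \<inter> cls a \<xi>) c \<alpha>) ^ r *
       cmod (F k (p ^ (k * m)) (A \<inter> cls b \<eta>) c \<alpha>) ^ (k * (k + 1) - r))) ^ (k * (k + 1))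
    \<le> K * Sb k m a \<xi> A c ^ r * Sb k m b \<eta> A c ^ (k * (k + 1) - r)"
  unfolding bil_def by blast

lemma bil_mono: "bil k m r a b K \<Longrightarrow> K \<le> K' \<Longrightarrow> bil k m r a b K'"
  unfolding bil_def
  by (intro allI impI, erule allE, erule allE, erule allE, erule allE, erule (1) impE, erule (1) impE, erule order_trans)
     (intro mult_right_mono zero_le_power Sb_nonneg, auto)

lemma bil_swap:
  assumes "bil k m r a b K" "r \<le> k * (k + 1)"
  shows "bil k m (k * (k + 1) - r) b a K"
  unfolding bil_def
proof (intro allI impI)
  fix A :: "int set" and c :: "int \<Rightarrow> complex" and \<xi> \<eta>
  assume A: "finite A" and n: "\<not> p dvd (\<xi> - \<eta>)"
  hence "\<not> p dvd (\<eta> - \<xi>)" by (simp add: dvd_diff_commute)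
  from bilD[OF assms(1) A this, of c]
  show "(av k (p ^ (k * m)) (\<lambda>\<alpha>. cmod (F k (p ^ (k * m)) (A \<inter> cls b \<xi>) c \<alpha>) ^ (k * (k + 1) - r) *
       cmod (F k (p ^ (k * m)) (A \<inter> cls a \<eta>) c \<alpha>) ^ (k * (k + 1) - (k * (k + 1) - r)))) ^ (k * (k + 1))
    \<le> K * Sb k m b \<xi> A c ^ (k * (k + 1) - r) * Sb k m a \<eta> A c ^ (k * (k + 1) - (k * (k + 1) - r))"
    unfolding diff_diff_cancel[OF assms(2)] by (simp only: mult_ac)
qed

text \<open>If the first factor can be split into finer classes with square root cancellation up to
  \<open>D\<close>, a bilinear bound at the finer scale passes to the coarser one. Hoelder's
  inequality over the subclasses loses nothing more, because the powers of \<open>p\<close> add up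
  exactly to those in \<open>Sb_split\<close>.\<close>

lemma bil_split:
  assumes r: "even r" "2 \<le> r" "r < k * (k + 1)" and a: "1 \<le> a" "a + s \<le> m"
    and D: "D \<ge> 0" "K \<ge> 0"
    and split: "\<And>A c \<xi> \<eta>. finite A \<Longrightarrow> \<not> p dvd (\<xi> - \<eta>) \<Longrightarrow>
      av k (p ^ (k * m)) (\<lambda>\<alpha>. cmod (F k (p ^ (k * m)) (A \<inter> cls a \<xi>) c \<alpha>) ^ r *
         cmod (F k (p ^ (k * m)) (A \<inter> cls b \<eta>) c \<alpha>) ^ (k * (k + 1) - r))
      \<le> D * of_int p ^ (s * (r div 2 - 1)) * (\<Sum>\<zeta>\<in>{0..<p ^ s}.
        av k (p ^ (k * m)) (\<lambda>\<alpha>. cmod (F k (p ^ (k * m)) (A \<inter> cls (a + s) (\<xi> + p ^ a * \<zeta>)) c \<alpha>) ^ r *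
         cmod (F k (p ^ (k * m)) (A \<inter> cls b \<eta>) c \<alpha>) ^ (k * (k + 1) - r)))"
    and bil: "bil k m r (a + s) b K"
  shows "bil k m r a b (D ^ (k * (k + 1)) * K)"
  unfolding bil_def
proof (intro allI impI)
  fix A :: "int set" and c :: "int \<Rightarrow> complex" and \<xi> \<eta>
  assume A: "finite A" and n: "\<not> p dvd (\<xi> - \<eta>)"
  define P where "P = k * (k + 1)"
  define h where "h = P div 2"
  define \<rho> where "\<rho> = r div 2"
  have Ph: "P = 2 * h" by (simp add: P_def h_def)
  have r\<rho>: "r = 2 * \<rho>" using r by (simp add: \<rho>_def)
  have \<rho>: "1 \<le> \<rho>" "\<rho> < h" using r(2,3) Ph r\<rho> unfolding P_def by linarith+
  define x where "x = (\<lambda>\<zeta>. av k (p ^ (k * m)) (\<lambda>\<alpha>. cmod (F k (p ^ (k * m)) (A \<inter> cls (a + s) (\<xi> + p ^ a * \<zeta>)) c \<alpha>) ^ r *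
         cmod (F k (p ^ (k * m)) (A \<inter> cls b \<eta>) c \<alpha>) ^ (P - r)))"
  define v where "v = (\<lambda>\<zeta>. Sb k m (a + s) (\<xi> + p ^ a * \<zeta>) A c)"
  define Y where "Y = Sb k m b \<eta> A c"
  \<comment> \<open>The second factor does not depend on \<zeta>; writing its bound as
    \<open>W ^ (P - r)\<close> lets it enter Hoelder's inequality as a constant function.\<close>
  define W where "W = root (P - r) (K * Y ^ (P - r))"
  have Y0: "Y \<ge> 0" by (simp add: Y_def Sb_nonneg)
  have v0: "v \<zeta> \<ge> 0" for \<zeta> by (simp add: v_def Sb_nonneg)
  have x0: "x \<zeta> \<ge> 0" for \<zeta> unfolding x_def by (intro av_nonneg) auto
  have rP: "r < P" using r by (simp add: P_def)
  have W0: "W \<ge> 0" using D Y0 rP by (simp add: W_def)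
  have WP: "W ^ (P - r) = K * Y ^ (P - r)" unfolding W_def using D Y0 rP by (intro real_root_pow_pos2) auto
  have xle: "x \<zeta> ^ P \<le> v \<zeta> ^ r * W ^ (P - r)" for \<zeta>
  proof -
    \<comment> \<open>Since \<open>a \<ge> 1\<close>, every subclass of \<xi> is still incongruent
      to \<eta> modulo \<open>p\<close>.\<close>
    have "p dvd p ^ a * \<zeta>" using a by (simp add: dvd_power)
    hence "\<not> p dvd (\<xi> + p ^ a * \<zeta> - \<eta>)" using n dvd_add_left_iff[of p "p ^ a * \<zeta>" "\<xi> - \<eta>"] by (simp add: algebra_simps)
    from bilD[OF bil A this, of c] show ?thesis
      unfolding WP by (simp only: x_def v_def Y_def P_def mult_ac)
  qed
  have "(\<Sum>\<zeta>\<in>{0..<p ^ s}. x \<zeta>) ^ P \<le> (\<Sum>\<zeta>\<in>{0..<p ^ s}. v \<zeta>) ^ r * (\<Sum>\<zeta>\<in>{0..<p ^ s}. W) ^ (P - r)"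
    by (rule holder_sum_power) (use x0 v0 W0 xle rP in auto)
  also have "(\<Sum>\<zeta>\<in>{0..<p ^ s}. W) = of_int p ^ s * W" by simp
  finally have sumx: "(\<Sum>\<zeta>\<in>{0..<p ^ s}. x \<zeta>) ^ P \<le> (\<Sum>\<zeta>\<in>{0..<p ^ s}. v \<zeta>) ^ r * (of_int p ^ s * W) ^ (P - r)" .
  let ?av = "av k (p ^ (k * m)) (\<lambda>\<alpha>. cmod (F k (p ^ (k * m)) (A \<inter> cls a \<xi>) c \<alpha>) ^ r *
         cmod (F k (p ^ (k * m)) (A \<inter> cls b \<eta>) c \<alpha>) ^ (P - r))"
  have "?av \<le> D * of_int p ^ (s * (\<rho> - 1)) * (\<Sum>\<zeta>\<in>{0..<p ^ s}. x \<zeta>)"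
    using split[OF A n, of c] by (simp only: x_def P_def \<rho>_def)
  hence "?av ^ P \<le> (D * of_int p ^ (s * (\<rho> - 1)) * (\<Sum>\<zeta>\<in>{0..<p ^ s}. x \<zeta>)) ^ P"
    by (intro power_mono av_nonneg) auto
  also have "\<dots> = D ^ P * of_int p ^ (s * (\<rho> - 1) * P) * (\<Sum>\<zeta>\<in>{0..<p ^ s}. x \<zeta>) ^ P"
    by (simp add: power_mult_distrib power_mult)
  also have "\<dots> \<le> D ^ P * of_int p ^ (s * (\<rho> - 1) * P) * ((\<Sum>\<zeta>\<in>{0..<p ^ s}. v \<zeta>) ^ r * (of_int p ^ s * W) ^ (P - r))"
    using sumx D by (intro mult_left_mono) auto
  also have "\<dots> = D ^ P * (K * Y ^ (P - r)) * (of_int p ^ (s * (\<rho> - 1) * P + s * (P - r)) * (\<Sum>\<zeta>\<in>{0..<p ^ s}. v \<zeta>) ^ r)"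
    by (simp add: power_mult_distrib WP power_add power_mult mult_ac)
  \<comment> \<open>The exact balance: with \<open>P = 2 h\<close> and \<open>r = 2 \<rho>\<close>,
    both sides equal \<open>2 s \<rho> (h - 1)\<close>.\<close>
  also have "s * (\<rho> - 1) * P + s * (P - r) = s * (h - 1) * r"
  proof -
    obtain \<rho>' where \<rho>': "\<rho> = Suc \<rho>'" using \<rho> by (cases \<rho>) auto
    obtain d where d: "h = Suc \<rho>' + d" using \<rho> \<rho>' by (metis less_imp_add_positive)
    show ?thesis unfolding Ph r\<rho> d \<rho>' by (simp add: algebra_simps)
  qed
  also have "of_int p ^ (s * (h - 1) * r) * (\<Sum>\<zeta>\<in>{0..<p ^ s}. v \<zeta>) ^ r = (Sb k m a \<xi> A c) ^ r"
    using Sb_split[OF a(2), of k \<xi> A c] by (simp add: v_def h_def P_def power_mult_distrib power_mult)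
  finally have "?av ^ P \<le> D ^ P * (K * Y ^ (P - r)) * Sb k m a \<xi> A c ^ r" .
  thus "av k (p ^ (k * m)) (\<lambda>\<alpha>. cmod (F k (p ^ (k * m)) (A \<inter> cls a \<xi>) c \<alpha>) ^ r *
         cmod (F k (p ^ (k * m)) (A \<inter> cls b \<eta>) c \<alpha>) ^ (k * (k + 1) - r)) ^ (k * (k + 1))
      \<le> D ^ (k * (k + 1)) * K * Sb k m a \<xi> A c ^ r * Sb k m b \<eta> A c ^ (k * (k + 1) - r)"
    by (simp only: P_def Y_def mult_ac)
qed

lemma Int_cls: "a \<le> a' \<Longrightarrow> A \<inter> cls a \<xi> \<inter> cls a' (\<xi> + p ^ a * \<zeta>) = A \<inter> cls a' (\<xi> + p ^ a * \<zeta>)"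
  using cls_mono by blast

text \<open>The price \<open>p ^ (s r / 2)\<close> is what the power mean inequality loses against
  square root cancellation on the \<open>r\<close>-th power of the first factor.\<close>

lemma bil_trivial_split:
  assumes r: "even r" "2 \<le> r" "r < k * (k + 1)" and a: "1 \<le> a" "a + s \<le> m" and "K \<ge> 0"
    and bil: "bil k m r (a + s) b K"
  shows "bil k m r a b ((of_int p ^ (s * (r div 2))) ^ (k * (k + 1)) * K)"
proof (rule bil_split[OF r a _ \<open>K \<ge> 0\<close> _ bil])
  fix A :: "int set" and c :: "int \<Rightarrow> complex" and \<xi> \<eta> assume A: "finite A"
  define \<Phi> where "\<Phi> = (\<lambda>\<alpha>. cmod (F k (p ^ (k * m)) (A \<inter> cls b \<eta>) c \<alpha>) ^ (k * (k + 1) - r))"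
  obtain \<rho> where \<rho>: "r = 2 * Suc \<rho>" using r by (metis One_nat_def Suc_le_D add_leD1 dvdE mult_is_0 not0_implies_Suc one_add_one plus_1_eq_Suc rel_simps(45) zero_neq_numeral nat.distinct(1) le_zero_eq)
  have e: "s * (r - 1) = s * (r div 2) + s * (r div 2 - 1)" by (simp add: \<rho> algebra_simps)
  have "av k (p ^ (k * m)) (\<lambda>\<alpha>. cmod (F k (p ^ (k * m)) (A \<inter> cls a \<xi>) c \<alpha>) ^ r * \<Phi> \<alpha>) \<le> of_int p ^ (s * (r - 1)) *
    (\<Sum>\<zeta>\<in>{0..<p ^ s}. av k (p ^ (k * m)) (\<lambda>\<alpha>. cmod (F k (p ^ (k * m)) (A \<inter> cls a \<xi> \<inter> cls (a + s) (\<xi> + p ^ a * \<zeta>)) c \<alpha>) ^ r * \<Phi> \<alpha>))"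
    by (rule trivial_split) (use A r in \<open>auto simp: \<Phi>_def\<close>)
  thus "av k (p ^ (k * m)) (\<lambda>\<alpha>. cmod (F k (p ^ (k * m)) (A \<inter> cls a \<xi>) c \<alpha>) ^ r *
         cmod (F k (p ^ (k * m)) (A \<inter> cls b \<eta>) c \<alpha>) ^ (k * (k + 1) - r))
      \<le> of_int p ^ (s * (r div 2)) * of_int p ^ (s * (r div 2 - 1)) * (\<Sum>\<zeta>\<in>{0..<p ^ s}.
        av k (p ^ (k * m)) (\<lambda>\<alpha>. cmod (F k (p ^ (k * m)) (A \<inter> cls (a + s) (\<xi> + p ^ a * \<zeta>)) c \<alpha>) ^ r *
         cmod (F k (p ^ (k * m)) (A \<inter> cls b \<eta>) c \<alpha>) ^ (k * (k + 1) - r)))"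
    unfolding Int_cls[OF le_add1] \<Phi>_def e power_add .
qed auto

text \<open>Hoelder's inequality separates the factors, and each class is then decoupled on its own
  at the full exponent.\<close>

lemma bil_init:
  assumes D1: "dec k (m - a) D1" "a \<le> m" "D1 \<ge> 0" and D2: "dec k (m - b) D2" "b \<le> m" "D2 \<ge> 0"
    and r: "r \<le> k * (k + 1)" and k: "k \<ge> 1"
  shows "bil k m r a b (D1 ^ r * D2 ^ (k * (k + 1) - r))"
  unfolding bil_def
proof (intro allI impI)
  fix A :: "int set" and c :: "int \<Rightarrow> complex" and \<xi> \<eta> assume A: "finite A"
  define f where "f = (\<lambda>\<alpha>. cmod (F k (p ^ (k * m)) (A \<inter> cls a \<xi>) c \<alpha>))"
  define g where "g = (\<lambda>\<alpha>. cmod (F k (p ^ (k * m)) (A \<inter> cls b \<eta>) c \<alpha>))"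
  define P where "P = k * (k + 1)"
  have "av k (p ^ (k * m)) (\<lambda>\<alpha>. f \<alpha> ^ r * g \<alpha> ^ (P - r)) ^ P
    \<le> av k (p ^ (k * m)) (\<lambda>\<alpha>. f \<alpha> ^ P) ^ r * av k (p ^ (k * m)) (\<lambda>\<alpha>. g \<alpha> ^ P) ^ (P - r)"
  proof (rule holder_av_power)
    fix \<alpha> show "(f \<alpha> ^ r * g \<alpha> ^ (P - r)) ^ P \<le> (f \<alpha> ^ P) ^ r * (g \<alpha> ^ P) ^ (P - r)"
      by (simp add: power_mult_distrib mult.commute flip: power_mult)
  qed (use r k in \<open>auto simp: f_def g_def P_def\<close>)
  also have "\<dots> \<le> (D1 * Sb k m a \<xi> A c) ^ r * (D2 * Sb k m b \<eta> A c) ^ (P - r)"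
    unfolding f_def g_def P_def
    by (intro mult_mono power_mono dec_rescale D1 D2 A av_nonneg zero_le_power mult_nonneg_nonneg Sb_nonneg) auto
  finally show "av k (p ^ (k * m)) (\<lambda>\<alpha>. cmod (F k (p ^ (k * m)) (A \<inter> cls a \<xi>) c \<alpha>) ^ r *
      cmod (F k (p ^ (k * m)) (A \<inter> cls b \<eta>) c \<alpha>) ^ (k * (k + 1) - r)) ^ (k * (k + 1))
    \<le> D1 ^ r * D2 ^ (k * (k + 1) - r) * Sb k m a \<xi> A c ^ r * Sb k m b \<eta> A c ^ (k * (k + 1) - r)"
    by (simp add: f_def g_def P_def power_mult_distrib mult_ac)
qed

text \<open>The exponents interpolate exactly: with \<open>t = k - l\<close>,
  \<open>l (l + 1) (t + 1) = (l - 1) l t + (k (k + 1) - t (t + 1))\<close>. So the moment of index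
  \<open>l\<close> on the first class lies between index \<open>l - 1\<close> on the same class and
  index \<open>k - l\<close> on the other one, which is how the two classes exchange roles.\<close>

lemma bil_holder:
  assumes l: "1 \<le> l" "l < k" and K: "K1 > 0" "K2 > 0"
    and 1: "bil k m ((l - 1) * l) a b K1" and 2: "bil k m ((k - l) * (k - l + 1)) b a K2"
  shows "bil k m (l * (l + 1)) a b (K1 powr (real (k - l) / real (k - l + 1)) * K2 powr (1 / real (k - l + 1)))"
  unfolding bil_def
proof (intro allI impI)
  fix A :: "int set" and c :: "int \<Rightarrow> complex" and \<xi> \<eta>
  assume A: "finite A" and n: "\<not> p dvd (\<xi> - \<eta>)"
  define f where "f = (\<lambda>\<alpha>. cmod (F k (p ^ (k * m)) (A \<inter> cls a \<xi>) c \<alpha>))"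
  define g where "g = (\<lambda>\<alpha>. cmod (F k (p ^ (k * m)) (A \<inter> cls b \<eta>) c \<alpha>))"
  define P where "P = k * (k + 1)"
  define t where "t = k - l"
  define r where "r = l * (l + 1)"
  define r1 where "r1 = (l - 1) * l"
  define r2 where "r2 = P - t * (t + 1)"
  define X where "X = Sb k m a \<xi> A c"
  define Y where "Y = Sb k m b \<eta> A c"
  have XY: "X \<ge> 0" "Y \<ge> 0" by (simp_all add: X_def Y_def Sb_nonneg)
  have t: "1 \<le> t" "k = l + t" using l by (auto simp: t_def)
  have tP: "t * (t + 1) \<le> P" unfolding P_def t(2) by (intro mult_le_mono) auto
  have rP: "r \<le> P" "r1 \<le> P" "r2 \<le> P" unfolding r_def r1_def r2_def P_def t(2) by (intro mult_le_mono; simp)+ simp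
  obtain l' where l': "l = Suc l'" using l by (cases l) auto
  have r2: "r2 = l * (2 * t + l + 1)" unfolding r2_def P_def t(2) by (simp add: algebra_simps)
  have e1: "r * (t + 1) = r1 * t + r2"
    unfolding r2 r_def r1_def l' by (simp add: algebra_simps)
  have e2: "(P - r) * (t + 1) = (P - r1) * t + (P - r2)"
  proof -
    have "(P - r) * (t + 1) = P * (t + 1) - r * (t + 1)" by (rule diff_mult_distrib)
    also have "\<dots> = P * t + P - (r1 * t + r2)" by (simp only: e1) simp
    also have "\<dots> = (P * t - r1 * t) + (P - r2)" using rP by (simp add: mult_le_mono1)
    finally show ?thesis by (simp add: diff_mult_distrib)
  qed
  define a0 where "a0 = av k (p ^ (k * m)) (\<lambda>\<alpha>. f \<alpha> ^ r * g \<alpha> ^ (P - r))"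
  define a1 where "a1 = av k (p ^ (k * m)) (\<lambda>\<alpha>. f \<alpha> ^ r1 * g \<alpha> ^ (P - r1))"
  define a2 where "a2 = av k (p ^ (k * m)) (\<lambda>\<alpha>. f \<alpha> ^ r2 * g \<alpha> ^ (P - r2))"
  have a0: "a0 \<ge> 0" "a1 \<ge> 0" "a2 \<ge> 0"
    unfolding a0_def a1_def a2_def by (intro av_nonneg; simp add: f_def g_def)+
  have "a0 ^ (t + 1) \<le> a1 ^ t * a2 ^ (t + 1 - t)"
    unfolding a0_def a1_def a2_def
  proof (rule holder_av_power)
    fix \<alpha>
    have "(f \<alpha> ^ r * g \<alpha> ^ (P - r)) ^ (t + 1) = f \<alpha> ^ (r * (t + 1)) * g \<alpha> ^ ((P - r) * (t + 1))"
      by (simp only: power_mult_distrib power_mult[symmetric])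
    also have "\<dots> = (f \<alpha> ^ r1 * g \<alpha> ^ (P - r1)) ^ t * (f \<alpha> ^ r2 * g \<alpha> ^ (P - r2))"
      unfolding e1 e2 by (simp only: power_mult_distrib power_mult[symmetric] power_add mult_ac)
    finally show "(f \<alpha> ^ r * g \<alpha> ^ (P - r)) ^ (t + 1) \<le> (f \<alpha> ^ r1 * g \<alpha> ^ (P - r1)) ^ t * (f \<alpha> ^ r2 * g \<alpha> ^ (P - r2)) ^ (t + 1 - t)"
      by simp
  qed (auto simp: f_def g_def)
  hence h: "a0 ^ (t + 1) \<le> a1 ^ t * a2" by simp
  have b1: "a1 ^ P \<le> K1 * X ^ r1 * Y ^ (P - r1)"
    using bilD[OF 1 A n, of c] by (simp add: a1_def f_def g_def r1_def P_def X_def Y_def)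
  \<comment> \<open>The second hypothesis is used with \<xi> and \<eta> exchanged, as its first
    class is the one at scale \<open>b\<close>.\<close>
  have "\<not> p dvd (\<eta> - \<xi>)" using n by (simp add: dvd_diff_commute)
  from bilD[OF 2 A this, of c] have b2: "a2 ^ P \<le> K2 * X ^ r2 * Y ^ (P - r2)"
    unfolding a2_def f_def g_def r2_def X_def Y_def diff_diff_cancel[OF tP] unfolding P_def t_def
    by (simp only: mult_ac)
  define K where "K = K1 powr (real t / real (t + 1)) * K2 powr (1 / real (t + 1))"
  have KP: "K ^ (t + 1) = K1 ^ t * K2" and K0: "K > 0"
  proof -
    have pw: "(x powr y) ^ n = x powr (y * real n)" if "x > 0" for x y :: real and n
      using that by (simp add: powr_powr flip: powr_realpow)
    have "real t / real (t + 1) * real (t + 1) = real t" "1 / real (t + 1) * real (t + 1) = 1" by simp_all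
    hence "(K1 powr (real t / real (t + 1))) ^ (t + 1) = K1 ^ t" "(K2 powr (1 / real (t + 1))) ^ (t + 1) = K2"
      using K by (simp_all only: pw powr_realpow powr_one)
    thus "K ^ (t + 1) = K1 ^ t * K2" by (simp only: K_def power_mult_distrib)
    show "K > 0" using K by (simp add: K_def)
  qed
  have "(a0 ^ P) ^ (t + 1) = (a0 ^ (t + 1)) ^ P" by (simp only: power_mult[symmetric] mult.commute)
  also have "\<dots> \<le> (a1 ^ t * a2) ^ P" by (intro power_mono h zero_le_power a0)
  also have "\<dots> = (a1 ^ P) ^ t * a2 ^ P" by (simp only: power_mult_distrib power_mult[symmetric] mult.commute)
  also have "\<dots> \<le> (K1 * X ^ r1 * Y ^ (P - r1)) ^ t * (K2 * X ^ r2 * Y ^ (P - r2))"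
    using b1 b2 a0 K XY by (intro mult_mono power_mono) auto
  also have "\<dots> = (K1 ^ t * K2) * X ^ (r1 * t + r2) * Y ^ ((P - r1) * t + (P - r2))"
    by (simp only: power_mult_distrib power_mult[symmetric] power_add mult_ac)
  also have "\<dots> = (K * X ^ r * Y ^ (P - r)) ^ (t + 1)"
    unfolding e1[symmetric] e2[symmetric] KP[symmetric] by (simp only: power_mult_distrib power_mult)
  finally have "a0 ^ P \<le> K * X ^ r * Y ^ (P - r)"
    by (rule pow_le_base) (use K0 XY in auto)
  thus "av k (p ^ (k * m)) (\<lambda>\<alpha>. cmod (F k (p ^ (k * m)) (A \<inter> cls a \<xi>) c \<alpha>) ^ (l * (l + 1)) *
      cmod (F k (p ^ (k * m)) (A \<inter> cls b \<eta>) c \<alpha>) ^ (k * (k + 1) - l * (l + 1))) ^ (k * (k + 1))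
    \<le> K1 powr (real (k - l) / real (k - l + 1)) * K2 powr (1 / real (k - l + 1)) * Sb k m a \<xi> A c ^ (l * (l + 1)) *
      Sb k m b \<eta> A c ^ (k * (k + 1) - l * (l + 1))"
    by (simp only: a0_def f_def g_def P_def r_def X_def Y_def K_def t_def)
qed

lemma not_dvd_fact: "int k < p \<Longrightarrow> \<not> p dvd fact k"
proof (induction k)
  case 0
  show ?case using prime_p by simp
next
  case (Suc k)
  hence "\<not> p dvd int (Suc k)" by (intro zdvd_not_zless) auto
  with Suc show ?case by (simp add: prime_dvd_mult_iff[OF prime_p])
qed

text \<open>
  The coefficients are translated by multiples of the polynomials of \<open>transverse_poly\<close>, centred at \<open>\<eta>\<close>.
  On the class of \<open>\<eta>\<close> they are integral because \<open>l (a + s) \<le> (k - l + 1) b\<close>; on the class of \<open>\<xi>\<close> they are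
  a generic polynomial of degree \<open>l\<close> modulo \<open>p ^ (l * s)\<close>, the error term being integral because \<open>l s \<le> a\<close>.
\<close>

lemma bil_lower:
  assumes dec: "dec l s D" "D \<ge> 0" and l: "1 \<le> l" "l < k" and k: "int k < p"
    and a: "1 \<le> a" "a + s \<le> m" "l * s \<le> a" "l * (a + s) \<le> (k - l + 1) * b"
    and "K \<ge> 0" and bil: "bil k m (l * (l + 1)) (a + s) b K"
  shows "bil k m (l * (l + 1)) a b (D ^ (k * (k + 1)) * K)"
proof (rule bil_split[OF _ _ _ a(1,2) dec(2) \<open>K \<ge> 0\<close> _ bil])
  show "even (l * (l + 1))" by simp
  show "2 \<le> l * (l + 1)" using l mult_le_mono[of 1 l 2 "l + 1"] by simp
  show "l * (l + 1) < k * (k + 1)" using l by (intro mult_strict_mono) auto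
next
  fix A :: "int set" and c :: "int \<Rightarrow> complex" and \<xi> \<eta>
  assume A: "finite A" and n: "\<not> p dvd (\<xi> - \<eta>)"
  define Q where "Q = p ^ (k * m)"
  define w where "w = \<xi> - \<eta>"
  define Dj where "Dj = (\<lambda>j. fact k div int j * w ^ (l * (k - l)))"
  \<comment> \<open>The exponent of the denominator of the \<open>j\<close>-th translate:
    \<open>p ^ (j a)\<close> is used up by \<open>y ^ j\<close> at \<open>y = p ^ a z\<close>, and
    the modulus \<open>p ^ (l s)\<close> of the problem of degree \<open>l\<close> remains.\<close>
  define e where "e = (\<lambda>j. l * s + j * a)"
  have "\<exists>(q :: int poly) R \<kappa>. j \<in> {1..l} \<longrightarrow> (degree q \<le> k \<and> monom 1 (k - l + 1) dvd q \<and>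
    (\<forall>y. poly q (w + y) = \<kappa> + Dj j * y ^ j + y ^ (l + 1) * poly R y))" for j
    using transverse_poly[of j l k w] l unfolding Dj_def by (cases "j \<in> {1..l}") fastforce+
  then obtain q :: "nat \<Rightarrow> int poly" and R \<kappa> where q: "\<And>j. j \<in> {1..l} \<Longrightarrow> degree (q j) \<le> k"
    "\<And>j. j \<in> {1..l} \<Longrightarrow> monom 1 (k - l + 1) dvd q j"
    "\<And>j y. j \<in> {1..l} \<Longrightarrow> poly (q j) (w + y) = \<kappa> j + Dj j * y ^ j + y ^ (l + 1) * poly (R j) y"
    by metis
  \<comment> \<open>The factor in front of \<open>y ^ j\<close> is a unit modulo \<open>p\<close>:
    \<open>k < p\<close> takes care of the factorial, the incongruence of \<xi> and \<eta> of the
    power of \<open>w\<close>.\<close>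
  have "\<exists>E. [Dj j * E = 1] (mod p ^ (l * s))" if "j \<in> {1..l}" for j
  proof (rule cong_solve_coprime_int)
    have "int j dvd int (fact k)" using that l by (intro of_nat_dvd_iff[THEN iffD2] dvd_fact) auto
    hence "fact k div int j dvd fact k" by (metis dvd_div_mult_self dvd_triv_left of_nat_fact)
    hence "\<not> p dvd fact k div int j" using not_dvd_fact[OF k] dvd_trans by blast
    moreover have "\<not> p dvd w ^ (l * (k - l))" using n prime_dvd_power[OF prime_p] by (auto simp: w_def)
    ultimately have "\<not> p dvd Dj j" unfolding Dj_def by (simp add: prime_dvd_mult_iff[OF prime_p])
    hence "coprime p (Dj j)" using prime_imp_coprime[OF prime_p] by blast
    thus "coprime (Dj j) (p ^ (l * s))" by (simp add: coprime_commute)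
  qed
  then obtain E where "\<And>j. j \<in> {1..l} \<Longrightarrow> [Dj j * E j = 1] (mod p ^ (l * s))" by metis
  hence "\<exists>t. Dj j * E j = 1 + p ^ (l * s) * t" if "j \<in> {1..l}" for j
    using that by (metis cong_iff_lin cong_sym)
  then obtain t where t: "\<And>j. j \<in> {1..l} \<Longrightarrow> Dj j * E j = 1 + p ^ (l * s) * t j" by metis
  have e_le: "e j \<le> l * (a + s)" "e j \<le> k * m" "e j \<le> a * (l + 1)" if "j \<in> {1..l}" for j
  proof -
    have "j * a \<le> l * a" using that by (intro mult_le_mono) auto
    thus 1: "e j \<le> l * (a + s)" by (simp add: e_def distrib_left)
    also have "\<dots> \<le> k * m" using l a by (intro mult_le_mono) auto
    finally show "e j \<le> k * m" .
    show "e j \<le> a * (l + 1)" using \<open>j * a \<le> l * a\<close> a(3) unfolding e_def by (simp only: mult.commute[of a] distrib_right mult_1)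
  qed
  \<comment> \<open>The sum starts at \<open>j = 1\<close>: \<open>u 0\<close> is not realised by a
    translation. It changes the phase only by a unimodular factor, which \<open>g\<close>
    compensates.\<close>
  define \<tau> where "\<tau> = (\<lambda>u i. \<Sum>j\<in>{1..l}. u j * E j * p ^ (k * m - e j) * coeff (pcompose (q j) [:- \<eta>, 1:]) i)"
  have lin\<tau>: "lin k (\<tau> u) x = (\<Sum>j\<in>{1..l}. u j * E j * p ^ (k * m - e j) * poly (q j) (x - \<eta>))" for u x
  proof -
    have "lin k (\<tau> u) x = (\<Sum>j\<in>{1..l}. u j * E j * p ^ (k * m - e j) * lin k (coeff (pcompose (q j) [:- \<eta>, 1:])) x)"
      unfolding lin_def \<tau>_def sum_distrib_left sum_distrib_right by (subst sum.swap) (simp add: mult_ac)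
    also have "\<dots> = (\<Sum>j\<in>{1..l}. u j * E j * p ^ (k * m - e j) * poly (q j) (x - \<eta>))"
      by (intro sum.cong refl, subst lin_coeff) (use q in \<open>auto simp: degree_pcompose poly_pcompose\<close>)
    finally show ?thesis .
  qed
  have lin\<tau>': "of_int (lin k (\<tau> u) x) / of_int Q = (\<Sum>j\<in>{1..l}. of_int (u j * E j * poly (q j) (x - \<eta>)) / of_int p ^ e j :: real)" for u x
  proof -
    have "of_int (u j * E j * p ^ (k * m - e j) * poly (q j) (x - \<eta>)) / of_int Q = (of_int (u j * E j * poly (q j) (x - \<eta>)) / of_int p ^ e j :: real)"
      if "j \<in> {1..l}" for j
    proof -
      have "Q = p ^ e j * p ^ (k * m - e j)" using e_le(2)[OF that] by (simp add: Q_def flip: power_add)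
      thus ?thesis by simp
    qed
    thus ?thesis unfolding lin\<tau> of_int_sum sum_divide_distrib by (intro sum.cong) auto
  qed
  define g where "g = (\<lambda>u :: nat \<Rightarrow> int. ee ((\<Sum>j\<in>{1..l}. of_int (u j * E j * \<kappa> j) / of_int p ^ e j) - of_int (u 0) / of_int (p ^ (l * s))))"
  have phase: "ee (of_int (lin k (\<tau> u) (\<xi> + p ^ a * z)) / of_int Q) = g u * ee (of_int (lin l u z) / of_int (p ^ (l * s)))" for u z
  proof -
    \<comment> \<open>The two integral leftovers: the multiple of \<open>p ^ (l s)\<close> from
      inverting the unit, and the error term of order \<open>l + 1\<close>.\<close>
    define N where "N = (\<lambda>j. u j * z ^ j * t j + u j * E j * p ^ (a * (l + 1) - e j) * z ^ (l + 1) * poly (R j) (p ^ a * z))"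
    have expand: "of_int (u j * E j * poly (q j) (\<xi> + p ^ a * z - \<eta>)) / of_int p ^ e j =
       (of_int (u j * E j * \<kappa> j) / of_int p ^ e j + of_int (u j * z ^ j) / of_int (p ^ (l * s)) + of_int (N j) :: real)"
      if j: "j \<in> {1..l}" for j
    proof -
      have x: "\<xi> + p ^ a * z - \<eta> = w + p ^ a * z" by (simp add: w_def)
      have pe: "p ^ e j = p ^ (l * s) * p ^ (a * j)" by (simp add: e_def power_add mult.commute)
      have "p ^ (a * (l + 1)) = p ^ e j * p ^ (a * (l + 1) - e j)"
        using e_le(3)[OF j] by (simp flip: power_add)
      hence pl: "(p ^ a) ^ (l + 1) = p ^ e j * p ^ (a * (l + 1) - e j)" by (simp only: power_mult)
      have "u j * E j * poly (q j) (w + p ^ a * z) = u j * E j * \<kappa> j + u j * (Dj j * E j) * (p ^ a * z) ^ j + u j * E j * (p ^ a * z) ^ (l + 1) * poly (R j) (p ^ a * z)"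
        unfolding q(3)[OF j] by (simp add: algebra_simps)
      also have "\<dots> = u j * E j * \<kappa> j + u j * z ^ j * p ^ (a * j) + p ^ e j * N j"
        unfolding t[OF j] power_mult_distrib pl N_def by (simp add: pe power_mult algebra_simps)
      finally have "of_int (u j * E j * poly (q j) (w + p ^ a * z)) = (of_int (u j * E j * \<kappa> j) + of_int (u j * z ^ j) * of_int (p ^ (a * j)) + of_int (p ^ e j) * of_int (N j) :: real)"
        by (simp only: of_int_add of_int_mult)
      thus ?thesis unfolding x by (simp add: add_divide_distrib e_def power_add mult.commute)
    qed
    have lin0: "lin l u z = u 0 + (\<Sum>j\<in>{1..l}. u j * z ^ j)"
      unfolding lin_def by (simp add: sum.atMost_shift atLeast1_atMost_eq_remove0 sum.remove[of _ 0] atMost_atLeast0)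
    have "of_int (lin k (\<tau> u) (\<xi> + p ^ a * z)) / of_int Q =
      (\<Sum>j\<in>{1..l}. of_int (u j * E j * \<kappa> j) / of_int p ^ e j + of_int (u j * z ^ j) / of_int (p ^ (l * s)) + of_int (N j) :: real)"
      unfolding lin\<tau>' by (intro sum.cong refl expand)
    also have "\<dots> = ((\<Sum>j\<in>{1..l}. of_int (u j * E j * \<kappa> j) / of_int p ^ e j) - of_int (u 0) / of_int (p ^ (l * s)))
        + of_int (lin l u z) / of_int (p ^ (l * s)) + of_int (\<Sum>j\<in>{1..l}. N j)"
      unfolding lin0 of_int_add of_int_sum add_divide_distrib sum_divide_distrib sum.distrib by simp
    finally show ?thesis by (simp only: ee_add g_def ee_of_int mult_1_right)
  qed
  define \<Phi> where "\<Phi> = (\<lambda>\<alpha>. cmod (F k Q (A \<inter> cls b \<eta>) c \<alpha>) ^ (k * (k + 1) - l * (l + 1)))"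
  have inv: "F k Q (A \<inter> cls b \<eta>) c (\<lambda>j. \<alpha> j + \<tau> u j) = F k Q (A \<inter> cls b \<eta>) c \<alpha>" for u \<alpha>
  proof -
    have "ee (of_int (lin k (\<tau> u) x) / of_int Q) = 1" if "x \<in> cls b \<eta>" for x
      unfolding lin\<tau>'
    proof (intro ee_Ints Ints_sum)
      fix j assume j: "j \<in> {1..l}"
      from that obtain z where z: "x = \<eta> + p ^ b * z" using mem_cls by blast
      from q(2)[OF j] obtain q' where q': "q j = monom 1 (k - l + 1) * q'" by (elim dvdE)
      have "e j \<le> b * (k - l + 1)" using e_le(1)[OF j] a(4) by (simp only: mult.commute)
      hence "p ^ e j dvd p ^ (b * (k - l + 1))" by (rule le_imp_power_dvd)
      also have "\<dots> dvd poly (q j) (x - \<eta>)"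
        unfolding q' z poly_mult poly_monom power_mult
        by (rule dvd_mult2) (simp only: mult_1_left, rule dvd_power_same, simp)
      finally have "p ^ e j dvd u j * E j * poly (q j) (x - \<eta>)" by simp
      then obtain M where "u j * E j * poly (q j) (x - \<eta>) = p ^ e j * M" by (elim dvdE)
      hence "of_int (u j * E j * poly (q j) (x - \<eta>)) / of_int p ^ e j = (of_int M :: real)" by simp
      thus "of_int (u j * E j * poly (q j) (x - \<eta>)) / of_int p ^ e j \<in> (\<int> :: real set)" by simp
    qed
    thus ?thesis unfolding F_translate F_def[of k Q "A \<inter> cls b \<eta>" c \<alpha>] by (intro sum.cong) auto
  qed
  have "av k Q (\<lambda>\<alpha>. cmod (F k Q (A \<inter> cls a \<xi>) c \<alpha>) ^ (l * (l + 1)) * \<Phi> \<alpha>)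
    \<le> D * of_int p ^ (s * (l * (l + 1) div 2 - 1)) *
       (\<Sum>\<zeta>\<in>{0..<p ^ s}. av k Q (\<lambda>\<alpha>. cmod (F k Q (A \<inter> cls a \<xi> \<inter> cls (a + s) (\<xi> + p ^ a * \<zeta>)) c \<alpha>) ^ (l * (l + 1)) * \<Phi> \<alpha>))"
  proof (rule transfer[OF dec(1), where \<tau> = \<tau> and g = g])
    show "periodic k Q \<Phi>" unfolding \<Phi>_def using periodic_F[of k Q "A \<inter> cls b \<eta>" c] unfolding periodic_def by metis
  qed (use A phase inv in \<open>auto simp: Q_def[symmetric] \<Phi>_def g_def\<close>, simp add: Q_def)
  thus "av k (p ^ (k * m)) (\<lambda>\<alpha>. cmod (F k (p ^ (k * m)) (A \<inter> cls a \<xi>) c \<alpha>) ^ (l * (l + 1)) *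
         cmod (F k (p ^ (k * m)) (A \<inter> cls b \<eta>) c \<alpha>) ^ (k * (k + 1) - l * (l + 1)))
      \<le> D * of_int p ^ (s * (l * (l + 1) div 2 - 1)) * (\<Sum>\<zeta>\<in>{0..<p ^ s}.
        av k (p ^ (k * m)) (\<lambda>\<alpha>. cmod (F k (p ^ (k * m)) (A \<inter> cls (a + s) (\<xi> + p ^ a * \<zeta>)) c \<alpha>) ^ (l * (l + 1)) *
         cmod (F k (p ^ (k * m)) (A \<inter> cls b \<eta>) c \<alpha>) ^ (k * (k + 1) - l * (l + 1))))"
    unfolding Int_cls[OF le_add1] \<Phi>_def Q_def .
qed

end

section \<open>Broad-narrow decomposition\<close>

lemma sum_ee_residues:
  assumes "Q > 0"
  shows "(\<Sum>x\<in>{0..<Q}. ee (of_int (x * \<nu>) / of_int Q)) = (if Q dvd \<nu> then of_int Q else 0)"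
proof (cases "Q dvd \<nu>")
  case True
  then obtain t where "\<nu> = Q * t" by (elim dvdE)
  hence "ee (of_int (x * \<nu>) / of_int Q) = 1" for x
    using assms by (intro ee_Ints) simp
  thus ?thesis using True assms by simp
next
  case False
  define z where "z = ee (of_int \<nu> / of_int Q)"
  have pw: "ee (of_int (int n * \<nu>) / of_int Q) = z ^ n" for n
  proof (induction n)
    case (Suc n)
    have "of_int (int (Suc n) * \<nu>) / of_int Q = of_int (int n * \<nu>) / of_int Q + (of_int \<nu> / of_int Q :: real)"
      by (simp add: algebra_simps add_divide_distrib)
    thus ?case using Suc by (simp add: ee_add z_def)
  qed simp
  have "z \<noteq> 1"
  proof
    assume "z = 1"
    hence "cos (2 * pi * (of_int \<nu> / of_int Q)) = 1" by (simp add: z_def ee_def complex_eq_iff)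
    then obtain t :: int where "2 * pi * (of_int \<nu> / of_int Q) = of_int t * 2 * pi"
      by (auto simp: cos_one_2pi_int)
    hence "2 * pi * (of_int \<nu> / of_int Q) = 2 * pi * of_int t" by (simp only: mult_ac)
    hence "of_int \<nu> / of_int Q = (of_int t :: real)"
      by (metis mult_cancel_left pi_neq_zero mult_eq_0_iff zero_neq_numeral)
    hence "of_int \<nu> = (of_int (Q * t) :: real)" using assms by (simp add: field_simps)
    hence "\<nu> = Q * t" by (simp only: of_int_eq_iff)
    thus False using False by simp
  qed
  have "(\<Sum>x\<in>{0..<Q}. ee (of_int (x * \<nu>) / of_int Q)) = (\<Sum>n\<in>{0..<nat Q}. ee (of_int (int n * \<nu>) / of_int Q))"
    using assms by (intro sum.reindex_bij_witness[of _ int nat]) auto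
  also have "\<dots> = (\<Sum>n<nat Q. z ^ n)" by (simp add: pw atLeast0LessThan del: of_int_mult)
  also have "\<dots> = 0"
  proof -
    have "z ^ nat Q = ee (of_int (int (nat Q) * \<nu>) / of_int Q)" by (rule pw[symmetric])
    also have "\<dots> = 1" using assms by (intro ee_Ints) simp
    finally show ?thesis using \<open>z \<noteq> 1\<close> by (simp add: geometric_sum)
  qed
  finally show ?thesis using False by simp
qed

lemma sum_ee_cube:
  assumes "Q > 0"
  shows "(\<Sum>\<alpha>\<in>cube k Q. ee (of_int (\<Sum>j\<le>k. \<alpha> j * \<nu> j) / of_int Q)) =
    (if \<forall>j\<le>k. Q dvd \<nu> j then of_int Q ^ (k + 1) else 0)"
proof -
  have "(\<Sum>\<alpha>\<in>cube k Q. ee (of_int (\<Sum>j\<le>k. \<alpha> j * \<nu> j) / of_int Q)) =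
    (\<Sum>\<alpha>\<in>cube k Q. \<Prod>j\<in>{..k}. ee (of_int (\<alpha> j * \<nu> j) / of_int Q))"
    by (simp add: sum_divide_distrib ee_sum)
  also have "\<dots> = (\<Prod>j\<in>{..k}. \<Sum>x\<in>{0..<Q}. ee (of_int (x * \<nu> j) / of_int Q))"
    unfolding cube_def by (subst prod_sum_PiE) auto
  also have "\<dots> = (\<Prod>j\<in>{..k}. if Q dvd \<nu> j then of_int Q else 0)"
    by (simp only: sum_ee_residues[OF assms])
  also have "\<dots> = (if \<forall>j\<le>k. Q dvd \<nu> j then of_int Q ^ (k + 1) else 0)"
  proof (cases "\<forall>j\<le>k. Q dvd \<nu> j")
    case False
    then obtain j where "j \<le> k" "\<not> Q dvd \<nu> j" by auto
    thus ?thesis using False by (auto intro!: prod_zero)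
  qed simp
  finally show ?thesis .
qed

text \<open>Arbitrary integer frequency vectors are allowed, since this serves both degree 1, with
  powers of a single integer, and the count of tuples, with power sums.\<close>

lemma av_norm_square:
  assumes "Q > 0" "finite U"
  shows "complex_of_real (av k Q (\<lambda>\<alpha>. (cmod (\<Sum>t\<in>U. w t * ee (of_int (\<Sum>j\<le>k. \<alpha> j * \<nu> t j) / of_int Q)))\<^sup>2)) =
    (\<Sum>t\<in>U. \<Sum>t'\<in>U. w t * cnj (w t') * (if \<forall>j\<le>k. Q dvd \<nu> t j - \<nu> t' j then 1 else 0))"
proof -
  have sq: "complex_of_real ((cmod (\<Sum>t\<in>U. w t * ee (of_int (\<Sum>j\<le>k. \<alpha> j * \<nu> t j) / of_int Q)))\<^sup>2) =
     (\<Sum>t\<in>U. \<Sum>t'\<in>U. w t * cnj (w t') * ee (of_int (\<Sum>j\<le>k. \<alpha> j * (\<nu> t j - \<nu> t' j)) / of_int Q))" for \<alpha>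
  proof -
    have "complex_of_real ((cmod (\<Sum>t\<in>U. w t * ee (of_int (\<Sum>j\<le>k. \<alpha> j * \<nu> t j) / of_int Q)))\<^sup>2) =
      (\<Sum>t\<in>U. \<Sum>t'\<in>U. (w t * ee (of_int (\<Sum>j\<le>k. \<alpha> j * \<nu> t j) / of_int Q)) * cnj (w t' * ee (of_int (\<Sum>j\<le>k. \<alpha> j * \<nu> t' j) / of_int Q)))"
      unfolding complex_norm_square cnj_sum sum_product ..
    also have "\<dots> = (\<Sum>t\<in>U. \<Sum>t'\<in>U. w t * cnj (w t') * ee (of_int (\<Sum>j\<le>k. \<alpha> j * (\<nu> t j - \<nu> t' j)) / of_int Q))"
      by (intro sum.cong refl) (simp add: right_diff_distrib sum_subtractf diff_divide_distrib ee_diff mult_ac del: of_int_sum)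
    finally show ?thesis .
  qed
  have "complex_of_real (av k Q (\<lambda>\<alpha>. (cmod (\<Sum>t\<in>U. w t * ee (of_int (\<Sum>j\<le>k. \<alpha> j * \<nu> t j) / of_int Q)))\<^sup>2)) =
     (\<Sum>\<alpha>\<in>cube k Q. \<Sum>t\<in>U. \<Sum>t'\<in>U. w t * cnj (w t') * ee (of_int (\<Sum>j\<le>k. \<alpha> j * (\<nu> t j - \<nu> t' j)) / of_int Q)) / of_int Q ^ (k + 1)"
    unfolding av_def of_real_divide of_real_sum sq by simp
  also have "(\<Sum>\<alpha>\<in>cube k Q. \<Sum>t\<in>U. \<Sum>t'\<in>U. w t * cnj (w t') * ee (of_int (\<Sum>j\<le>k. \<alpha> j * (\<nu> t j - \<nu> t' j)) / of_int Q)) =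
     (\<Sum>t\<in>U. \<Sum>t'\<in>U. \<Sum>\<alpha>\<in>cube k Q. w t * cnj (w t') * ee (of_int (\<Sum>j\<le>k. \<alpha> j * (\<nu> t j - \<nu> t' j)) / of_int Q))"
    by (subst sum.swap, intro sum.cong refl, rule sum.swap)
  also have "\<dots> = (\<Sum>t\<in>U. \<Sum>t'\<in>U. w t * cnj (w t') * (if \<forall>j\<le>k. Q dvd \<nu> t j - \<nu> t' j then of_int Q ^ (k + 1) else 0))"
    by (simp only: sum_distrib_left[symmetric] sum_ee_cube[OF assms(1)])
  also have "\<dots> / of_int Q ^ (k + 1) = (\<Sum>t\<in>U. \<Sum>t'\<in>U. w t * cnj (w t') * (if \<forall>j\<le>k. Q dvd \<nu> t j - \<nu> t' j then 1 else 0))"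
    unfolding sum_divide_distrib using assms(1) by (intro sum.cong refl) auto
  finally show ?thesis .
qed

text \<open>
  Either two summands are of the same size up to powers of \<open>n\<close>, or the largest one is at least half of the sum.
\<close>

lemma broad_narrow_pointwise:
  fixes f :: "'a \<Rightarrow> complex"
  assumes "finite I" "real (card I) \<le> n" "n \<ge> 1" "r \<le> P" "P > 0"
  shows "cmod (sum f I) ^ P \<le> 2 ^ P * (\<Sum>i\<in>I. cmod (f i) ^ P) +
    n ^ (2 * P) * (\<Sum>i\<in>I. \<Sum>i'\<in>I - {i}. cmod (f i) ^ r * cmod (f i') ^ (P - r))"
proof (cases "I = {}")
  case True
  thus ?thesis using assms by (simp add: power_0_left)
next
  case False
  define g where "g = (\<lambda>i. cmod (f i))"
  have "Max (g ` I) \<in> g ` I" using False assms by simp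
  then obtain i where i: "i \<in> I" "g i = Max (g ` I)" by auto
  have le: "g i' \<le> g i" if "i' \<in> I" for i' using that assms i by simp
  have g0: "g i \<ge> 0" for i by (simp add: g_def)
  have s: "cmod (sum f I) \<le> sum g I" by (simp add: g_def norm_sum)
  have nn: "(\<Sum>i\<in>I. \<Sum>i'\<in>I - {i}. g i ^ r * g i' ^ (P - r)) \<ge> 0" "(\<Sum>i\<in>I. g i ^ P) \<ge> 0"
    by (intro sum_nonneg mult_nonneg_nonneg zero_le_power g0)+
  show ?thesis
  proof (cases "\<exists>i'\<in>I - {i}. g i \<le> n * g i'")
    case True
    then obtain i' where i': "i' \<in> I - {i}" "g i \<le> n * g i'" by auto
    have "sum g I \<le> n * g i"
      using sum_bounded_above[of I g "g i"] le assms(2) g0[of i] by (meson mult_right_mono order_trans)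
    hence "cmod (sum f I) ^ P \<le> (n * g i) ^ P" using s by (intro power_mono) auto
    also have "\<dots> = n ^ P * (g i ^ r * g i ^ (P - r))"
      using assms(4) by (simp add: power_mult_distrib flip: power_add)
    also have "\<dots> \<le> n ^ P * (g i ^ r * (n * g i') ^ (P - r))"
      using i' assms g0 by (intro mult_left_mono power_mono) auto
    also have "\<dots> = n ^ (P + (P - r)) * (g i ^ r * g i' ^ (P - r))"
      by (simp add: power_mult_distrib power_add)
    also have "\<dots> \<le> n ^ (2 * P) * (g i ^ r * g i' ^ (P - r))"
      using assms g0 by (intro mult_right_mono power_increasing) auto
    also have "g i ^ r * g i' ^ (P - r) \<le> (\<Sum>i'\<in>I - {i}. g i ^ r * g i' ^ (P - r))"
      using i' assms g0 by (intro member_le_sum) auto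
    also have "\<dots> \<le> (\<Sum>i\<in>I. \<Sum>i'\<in>I - {i}. g i ^ r * g i' ^ (P - r))"
      using i assms g0 by (intro member_le_sum[of i I "\<lambda>i. \<Sum>i'\<in>I - {i}. g i ^ r * g i' ^ (P - r)"] sum_nonneg) auto
    finally have "cmod (sum f I) ^ P \<le> 2 ^ P * (\<Sum>i\<in>I. g i ^ P) + n ^ (2 * P) * (\<Sum>i\<in>I. \<Sum>i'\<in>I - {i}. g i ^ r * g i' ^ (P - r))"
      using nn assms(3) by (simp add: add_increasing)
    thus ?thesis by (simp only: g_def)
  next
    case False
    hence "g i' \<le> g i / n" if "i' \<in> I - {i}" for i' using that assms by (force simp: field_simps)
    hence "sum g (I - {i}) \<le> real (card (I - {i})) * (g i / n)" by (rule sum_bounded_above)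
    also have "\<dots> \<le> n * (g i / n)"
      using assms g0 by (intro mult_right_mono) (auto intro: order_trans[rotated] simp: card_Diff_subset card_Diff_singleton_if)
    finally have "sum g (I - {i}) \<le> g i" using assms by simp
    hence "sum g I \<le> 2 * g i" using i assms by (simp add: sum.remove)
    hence "cmod (sum f I) ^ P \<le> (2 * g i) ^ P" using s by (intro power_mono) auto
    also have "\<dots> = 2 ^ P * g i ^ P" by (simp add: power_mult_distrib)
    also have "\<dots> \<le> 2 ^ P * (\<Sum>i\<in>I. g i ^ P)"
      using i assms g0 by (intro mult_left_mono member_le_sum) auto
    finally have "cmod (sum f I) ^ P \<le> 2 ^ P * (\<Sum>i\<in>I. g i ^ P) + n ^ (2 * P) * (\<Sum>i\<in>I. \<Sum>i'\<in>I - {i}. g i ^ r * g i' ^ (P - r))"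
      using nn assms(3) by (simp add: add_increasing2)
    thus ?thesis by (simp only: g_def)
  qed
qed

context prime_base
begin

text \<open>Degree 1 at exponent 2 is Parseval's identity: the linear coefficient detects congruence
  modulo \<open>p ^ m\<close>, so the classes are orthogonal and equality holds.\<close>

lemma dec_1: "dec 1 m 1"
  unfolding dec_def
proof (intro allI impI)
  fix A :: "int set" and c :: "int \<Rightarrow> complex" assume A: "finite A"
  define Q where "Q = p ^ m"
  have Q: "Q > 0" by (simp add: Q_def)
  define d where "d = (\<lambda>x x'. if [x = x'] (mod Q) then 1 else 0 :: complex)"
  have key: "complex_of_real (av 1 Q (\<lambda>\<alpha>. (cmod (F 1 Q B c \<alpha>))\<^sup>2)) = (\<Sum>x\<in>B. \<Sum>x'\<in>B. c x * cnj (c x') * d x x')"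
    if "finite B" for B
  proof -
    have "(\<forall>j\<le>1. Q dvd x ^ j - x' ^ j) \<longleftrightarrow> [x = x'] (mod Q)" for x x'
      by (auto simp: cong_iff_dvd_diff le_Suc_eq)
    thus ?thesis unfolding F_def lin_def av_norm_square[OF Q that, where \<nu> = "\<lambda>x j. x ^ j"]
      by (simp only: d_def)
  qed
  have "(\<Sum>x\<in>A. \<Sum>x'\<in>A. c x * cnj (c x') * d x x') =
    (\<Sum>\<zeta>\<in>{0..<p ^ m}. \<Sum>x\<in>A \<inter> cls (0 + m) (0 + p ^ 0 * \<zeta>). \<Sum>x'\<in>A. c x * cnj (c x') * d x x')"
    by (rule sum_cls[symmetric]) (use A in \<open>auto simp: cls_def\<close>)
  also have "\<dots> = (\<Sum>\<zeta>\<in>{0..<p ^ m}. \<Sum>x\<in>A \<inter> cls m \<zeta>. \<Sum>x'\<in>A \<inter> cls m \<zeta>. c x * cnj (c x') * d x x')"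
  proof (rule sum.cong[OF refl], rule sum.cong)
    fix \<zeta> x assume "x \<in> A \<inter> cls m \<zeta>"
    hence "d x x' = 0" if "x' \<notin> cls m \<zeta>" for x'
      using that by (auto simp: d_def cls_def Q_def cong_def)
    thus "(\<Sum>x'\<in>A. c x * cnj (c x') * d x x') = (\<Sum>x'\<in>A \<inter> cls m \<zeta>. c x * cnj (c x') * d x x')"
      using A by (intro sum.mono_neutral_right) auto
  qed auto
  finally have "complex_of_real (av 1 Q (\<lambda>\<alpha>. (cmod (F 1 Q A c \<alpha>))\<^sup>2)) = complex_of_real (\<Sum>\<zeta>\<in>{0..<p ^ m}. av 1 Q (\<lambda>\<alpha>. (cmod (F 1 Q (A \<inter> cls m \<zeta>) c \<alpha>))\<^sup>2))"
    unfolding of_real_sum using A by (simp only: key finite_Int simp_thms)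
  hence "av 1 Q (\<lambda>\<alpha>. (cmod (F 1 Q A c \<alpha>))\<^sup>2) = (\<Sum>\<zeta>\<in>{0..<p ^ m}. av 1 Q (\<lambda>\<alpha>. (cmod (F 1 Q (A \<inter> cls m \<zeta>) c \<alpha>))\<^sup>2))"
    by (simp only: of_real_eq_iff)
  thus "av 1 (p ^ (1 * m)) (\<lambda>\<alpha>. cmod (F 1 (p ^ (1 * m)) A c \<alpha>) ^ (1 * (1 + 1)))
    \<le> 1 * of_int p ^ (m * (1 * (1 + 1) div 2 - 1)) *
       (\<Sum>\<zeta>\<in>{0..<p ^ m}. av 1 (p ^ (1 * m)) (\<lambda>\<alpha>. cmod (F 1 (p ^ (1 * m)) (A \<inter> cls m \<zeta>) c \<alpha>) ^ (1 * (1 + 1))))"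
    by (simp add: Q_def numeral_2_eq_2)
qed

text \<open>
  The narrow part costs no factor: \<open>p \<ge> 8\<close> and \<open>P = k (k + 1) \<ge> 6\<close> give \<open>2 ^ P \<le> p ^ (P div 2 - 1)\<close>.
\<close>

lemma broad_narrow:
  assumes dec: "dec k m D" "D \<ge> 0" and bil: "bil k (m + 1) r 1 1 K" "K \<ge> 0"
    and r: "r \<le> k * (k + 1)" and k: "k \<ge> 2"
  shows "dec k (m + 1) (D + of_int p ^ (2 * (k * (k + 1)) + 2) * root (k * (k + 1)) K)"
  unfolding dec_def
proof (intro allI impI)
  fix A :: "int set" and c :: "int \<Rightarrow> complex" assume A: "finite A"
  define Q where "Q = p ^ (k * (m + 1))"
  have Q: "Q > 0" by (simp add: Q_def)
  define P where "P = k * (k + 1)"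
  define h where "h = P div 2"
  have Ph: "P = 2 * h" by (simp add: P_def h_def)
  have "2 * 3 \<le> P" unfolding P_def using k by (intro mult_le_mono) auto
  hence P6: "P \<ge> 6" "h \<ge> 3" using Ph by auto
  define S where "S = Sb k (m + 1) 0 0 A c"
  define f where "f = (\<lambda>i \<alpha>. F k Q (A \<inter> cls 1 i) c \<alpha>)"
  define B where "B = (\<lambda>i. Sb k (m + 1) 1 i A c)"
  have B0: "B i \<ge> 0" for i by (simp add: B_def Sb_nonneg)
  have sumB: "S = of_int p ^ (h - 1) * (\<Sum>i\<in>{0..<p}. B i)"
    using Sb_split[of 0 1 "m + 1" k 0 A c] by (simp add: S_def B_def h_def P_def)
  have S0: "S \<ge> 0" by (simp add: S_def Sb_nonneg)
  have BS: "B i \<le> S" if "i \<in> {0..<p}" for i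
  proof -
    have "B i \<le> (\<Sum>i\<in>{0..<p}. B i)" using that B0 by (intro member_le_sum) auto
    also have "\<dots> \<le> of_int p ^ (h - 1) * (\<Sum>i\<in>{0..<p}. B i)"
      using mult_right_mono[of 1 "of_int p ^ (h - 1)" "\<Sum>i\<in>{0..<p}. B i"] B0 by (simp add: sum_nonneg)
    finally show ?thesis by (simp add: sumB)
  qed
  have narrow: "av k Q (\<lambda>\<alpha>. cmod (f i \<alpha>) ^ P) \<le> D * B i" for i
    using dec_rescale[of k "m + 1" 1 D A i c] dec(1) A by (simp add: f_def Q_def P_def B_def)
  have two: "2 ^ P \<le> (of_int p :: real) ^ (h - 1)"
  proof -
    have "(2::real) ^ P \<le> 2 ^ (3 * (h - 1))" using P6 Ph by (intro power_increasing) auto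
    also have "\<dots> = 8 ^ (h - 1)" by (simp add: power_mult)
    also have "\<dots> \<le> of_int p ^ (h - 1)" using p_ge by (intro power_mono) auto
    finally show ?thesis .
  qed
  define K' where "K' = root P K"
  have K': "K' \<ge> 0" "K' ^ P = K" using bil(2) P6 by (auto simp: K'_def real_root_pow_pos2)
  have broad: "av k Q (\<lambda>\<alpha>. cmod (f i \<alpha>) ^ r * cmod (f i' \<alpha>) ^ (P - r)) \<le> K' * S"
    if i: "i \<in> {0..<p}" "i' \<in> {0..<p} - {i}" for i i'
  proof -
    have "\<not> p dvd i - i'" using i zdvd_not_zless[of "i - i'" p] zdvd_not_zless[of "i' - i" p]
      by (auto simp: dvd_diff_commute[of p i i'] neq_iff)
    from bilD[OF bil(1) A this, of c]
    have "av k Q (\<lambda>\<alpha>. cmod (f i \<alpha>) ^ r * cmod (f i' \<alpha>) ^ (P - r)) ^ P \<le> K * B i ^ r * B i' ^ (P - r)"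
      by (simp only: f_def Q_def P_def B_def)
    also have "\<dots> \<le> K * S ^ r * S ^ (P - r)"
      using bil(2) B0 S0 BS i by (intro mult_mono power_mono mult_nonneg_nonneg zero_le_power) auto
    also have "\<dots> = (K' * S) ^ P"
    proof -
      have "S ^ r * S ^ (P - r) = S ^ P" using r by (simp add: P_def flip: power_add)
      thus ?thesis by (simp only: power_mult_distrib K'(2) mult.assoc)
    qed
    finally show ?thesis by (rule pow_le_base) (use K' S0 P6 in auto)
  qed
  have Fsum: "F k Q A c \<alpha> = (\<Sum>i\<in>{0..<p}. f i \<alpha>)" for \<alpha>
    using F_cls[of A 0 0 k Q c \<alpha> 1] A by (simp add: f_def cls_def)
  have "av k Q (\<lambda>\<alpha>. cmod (F k Q A c \<alpha>) ^ P) \<le> av k Q (\<lambda>\<alpha>. 2 ^ P * (\<Sum>i\<in>{0..<p}. cmod (f i \<alpha>) ^ P) +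
    of_int p ^ (2 * P) * (\<Sum>i\<in>{0..<p}. \<Sum>i'\<in>{0..<p} - {i}. cmod (f i \<alpha>) ^ r * cmod (f i' \<alpha>) ^ (P - r)))"
    unfolding Fsum using P6 r k by (intro av_mono[OF Q] broad_narrow_pointwise) (auto simp: P_def)
  also have "\<dots> = 2 ^ P * (\<Sum>i\<in>{0..<p}. av k Q (\<lambda>\<alpha>. cmod (f i \<alpha>) ^ P)) +
    of_int p ^ (2 * P) * (\<Sum>i\<in>{0..<p}. \<Sum>i'\<in>{0..<p} - {i}. av k Q (\<lambda>\<alpha>. cmod (f i \<alpha>) ^ r * cmod (f i' \<alpha>) ^ (P - r)))"
    by (simp only: av_add av_cmult av_sum)
  also have "\<dots> \<le> 2 ^ P * (\<Sum>i\<in>{0..<p}. D * B i) + of_int p ^ (2 * P) * (\<Sum>i\<in>{0..<p}. \<Sum>i'\<in>{0..<p} - {i}. K' * S)"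
    by (intro add_mono mult_left_mono sum_mono narrow broad) auto
  also have "(\<Sum>i\<in>{0..<p}. \<Sum>i'\<in>{0..<p} - {i}. K' * S) \<le> of_int p * (of_int p * (K' * S))"
  proof -
    have "(\<Sum>i'\<in>{0..<p} - {i}. K' * S) \<le> (\<Sum>i'\<in>{0..<p}. K' * S)" for i
      using K' S0 by (intro sum_mono2) auto
    hence "(\<Sum>i'\<in>{0..<p} - {i}. K' * S) \<le> of_int p * (K' * S)" for i by simp
    hence "(\<Sum>i\<in>{0..<p}. \<Sum>i'\<in>{0..<p} - {i}. K' * S) \<le> (\<Sum>i\<in>{0..<p}. of_int p * (K' * S))"
      by (rule sum_mono)
    thus ?thesis by simp
  qed
  also have "2 ^ P * (\<Sum>i\<in>{0..<p}. D * B i) \<le> D * S"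
  proof -
    have "2 ^ P * (\<Sum>i\<in>{0..<p}. D * B i) = D * (2 ^ P * (\<Sum>i\<in>{0..<p}. B i))"
      unfolding sum_distrib_left by (simp only: mult_ac)
    also have "\<dots> \<le> D * (of_int p ^ (h - 1) * (\<Sum>i\<in>{0..<p}. B i))"
      using dec(2) two B0 by (intro mult_left_mono mult_right_mono sum_nonneg) auto
    finally show ?thesis by (simp only: sumB)
  qed
  finally have "av k Q (\<lambda>\<alpha>. cmod (F k Q A c \<alpha>) ^ P) \<le> (D + of_int p ^ (2 * P + 2) * K') * S"
    by (simp add: mult_left_mono algebra_simps power_add power2_eq_square)
  thus "av k (p ^ (k * (m + 1))) (\<lambda>\<alpha>. cmod (F k (p ^ (k * (m + 1))) A c \<alpha>) ^ (k * (k + 1)))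
    \<le> (D + of_int p ^ (2 * (k * (k + 1)) + 2) * root (k * (k + 1)) K) * of_int p ^ ((m + 1) * (k * (k + 1) div 2 - 1)) *
       (\<Sum>\<zeta>\<in>{0..<p ^ (m + 1)}. av k (p ^ (k * (m + 1))) (\<lambda>\<alpha>. cmod (F k (p ^ (k * (m + 1))) (A \<inter> cls (m + 1) \<zeta>) c \<alpha>) ^ (k * (k + 1))))"
    unfolding S_def Sb_def Q_def P_def K'_def by (simp only: diff_zero add_0_left power_0 mult_1_left mult.assoc)
qed

text \<open>A single use of \<open>bil_lower\<close> refines \<open>a\<close> only by some
  \<open>s\<close> with \<open>l s \<le> a\<close>. Chaining \<open>n\<close> steps of size at most
  \<open>s0\<close> goes further: the step size stays admissible because the scale only grows, and
  the losses \<open>p ^ (\<epsilon> s)\<close> multiply to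
  \<open>p ^ (\<epsilon> t)\<close>.\<close>

lemma bil_lower_multi:
  assumes C: "C \<ge> 1" and \<epsilon>: "\<epsilon> \<ge> 0" and dec: "\<And>s. dec l s (C * of_int p powr (\<epsilon> * real s))"
    and l: "1 \<le> l" "l < k" "int k < p" and "K \<ge> 0"
  shows "1 \<le> a \<Longrightarrow> l * s0 \<le> a \<Longrightarrow> t \<le> n * s0 \<Longrightarrow> a + t \<le> m \<Longrightarrow> l * (a + t) \<le> (k - l + 1) * b \<Longrightarrow>
    bil k m (l * (l + 1)) (a + t) b K \<Longrightarrow>
    bil k m (l * (l + 1)) a b ((C ^ n * of_int p powr (\<epsilon> * real t)) ^ (k * (k + 1)) * K)"
proof (induction n arbitrary: a t)
  case 0
  thus ?case by simp
next
  case (Suc n)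
  define s where "s = min t s0"
  have s: "s \<le> t" "s \<le> s0" "t - s \<le> n * s0" using Suc.prems by (auto simp: s_def)
  have ls: "l * s \<le> a" using s(2) Suc.prems(2) by (meson mult_le_mono2 order_trans)
  have IH: "bil k m (l * (l + 1)) (a + s) b ((C ^ n * of_int p powr (\<epsilon> * real (t - s))) ^ (k * (k + 1)) * K)"
    by (rule Suc.IH) (use Suc.prems s in \<open>auto intro: le_trans\<close>)
  have "bil k m (l * (l + 1)) a b ((C * of_int p powr (\<epsilon> * real s)) ^ (k * (k + 1)) *
     ((C ^ n * of_int p powr (\<epsilon> * real (t - s))) ^ (k * (k + 1)) * K))"
  proof (rule bil_lower[OF dec _ l _ _ ls _ _ IH])
    show "l * (a + s) \<le> (k - l + 1) * b"
      using Suc.prems(5) s(1) by (meson add_left_mono mult_le_mono2 order_trans)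
  qed (use Suc.prems s C \<open>K \<ge> 0\<close> in auto)
  also have "(C * of_int p powr (\<epsilon> * real s)) ^ (k * (k + 1)) *
     ((C ^ n * of_int p powr (\<epsilon> * real (t - s))) ^ (k * (k + 1)) * K) =
     ((C * of_int p powr (\<epsilon> * real s)) * (C ^ n * of_int p powr (\<epsilon> * real (t - s)))) ^ (k * (k + 1)) * K"
    by (simp only: power_mult_distrib mult.assoc)
  also have "(C * of_int p powr (\<epsilon> * real s)) * (C ^ n * of_int p powr (\<epsilon> * real (t - s))) =
      C ^ Suc n * (of_int p powr (\<epsilon> * real s) * of_int p powr (\<epsilon> * real (t - s)))" by simp
  also have "of_int p powr (\<epsilon> * real s) * of_int p powr (\<epsilon> * real (t - s)) = (of_int p powr (\<epsilon> * real t) :: real)"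
    using s(1) by (simp add: of_nat_diff algebra_simps flip: powr_add)
  finally show ?case .
qed

text \<open>Here \<open>a'\<close> is the last scale to which degree \<open>l\<close> can refine
  against a class at scale \<open>b\<close>.\<close>

lemma bil_reach:
  assumes C: "C \<ge> 1" and \<epsilon>: "\<epsilon> \<ge> 0" and dec: "\<And>s. dec l s (C * of_int p powr (\<epsilon> * real s))"
    and l: "1 \<le> l" "l < k" "int k < p" and K: "K \<ge> 0"
    and a: "1 \<le> a" "l * s0 \<le> a" "l * a' = (k - l + 1) * b" "a \<le> a'" "a' \<le> m" "a' \<le> n * s0"
    and bil: "bil k m (l * (l + 1)) a' b K"
  shows "bil k m (l * (l + 1)) a b ((C ^ n * of_int p powr (\<epsilon> * real a')) ^ (k * (k + 1)) * K)"
proof (rule bil_mono)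
  show "bil k m (l * (l + 1)) a b ((C ^ n * of_int p powr (\<epsilon> * real (a' - a))) ^ (k * (k + 1)) * K)"
    by (rule bil_lower_multi[OF C \<epsilon> dec l K, of a s0 "a' - a" n]) (use a bil in auto)
  have "(of_int p :: real) powr (\<epsilon> * real (a' - a)) \<le> of_int p powr (\<epsilon> * real a')"
    using \<epsilon> by (intro powr_mono mult_left_mono) auto
  thus "(C ^ n * of_int p powr (\<epsilon> * real (a' - a))) ^ (k * (k + 1)) * K \<le> (C ^ n * of_int p powr (\<epsilon> * real a')) ^ (k * (k + 1)) * K"
    using C K by (intro mult_right_mono power_mono mult_left_mono) auto
qed

end

section \<open>Iteration\<close>

text \<open>
  The two summands come from the two hypotheses of \<open>bil_holder\<close>, of index \<open>l - 1\<close> at the scale \<open>b\<close>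
  and of index \<open>k - l\<close> at the scale \<open>a = (k - l + 1) b / l\<close>. By \<open>sum_gain\<close> one step raises the total gain by \<open>(k - 1) / k\<close>,
  so some gain is unbounded.
\<close>

primrec gain :: "nat \<Rightarrow> nat \<Rightarrow> nat \<Rightarrow> real" where
  "gain k 0 = (\<lambda>l. if l = 0 then 1 else 0)"
| "gain k (Suc n) = (\<lambda>l. if l = 0 then 1 else real (k - l) / real (k - l + 1) * gain k n (l - 1) + gain k n (k - l) / real l)"

lemma gain_zero [simp]: "gain k n 0 = 1"
  by (cases n) auto

lemma gain_nonneg: "gain k n l \<ge> 0"
  by (induction n arbitrary: l) auto

text \<open>The old gain of index \<open>j\<close> enters the new gain of index \<open>j + 1\<close>
  with weight \<open>(k - j - 1) / (k - j)\<close> and that of index \<open>k - j\<close> with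
  weight \<open>1 / (k - j)\<close>, so mass is preserved. The increment comes from index 0, whose
  gain is held at 1.\<close>

lemma sum_gain:
  assumes "k \<ge> 1"
  shows "(\<Sum>l\<in>{1..k - 1}. gain k n l) = real n * (real (k - 1) / real k)"
proof (induction n)
  case (Suc n)
  define g where "g = gain k n"
  define \<phi> where "\<phi> = (\<lambda>j. real (k - j - 1) / real (k - j) * g j)"
  have "(\<Sum>l\<in>{1..k - 1}. gain k (Suc n) l) =
      (\<Sum>l\<in>{1..k - 1}. real (k - l) / real (k - l + 1) * g (l - 1)) + (\<Sum>l\<in>{1..k - 1}. g (k - l) / real l)"
    by (simp add: sum.distrib g_def)
  also have "(\<Sum>l\<in>{1..k - 1}. g (k - l) / real l) = (\<Sum>j\<in>{1..k - 1}. g j / real (k - j))"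
    by (rule sum.reindex_bij_witness[of _ "\<lambda>j. k - j" "\<lambda>j. k - j"]) auto
  also have "(\<Sum>l\<in>{1..k - 1}. real (k - l) / real (k - l + 1) * g (l - 1)) = (\<Sum>j\<in>{0..<k - 1}. \<phi> j)"
    by (rule sum.reindex_bij_witness[of _ "\<lambda>j. j + 1" "\<lambda>j. j - 1"]) (auto simp: \<phi>_def Suc_diff_Suc)
  \<comment> \<open>The added term \<open>j = k - 1\<close> has numerator 0.\<close>
  also have "\<dots> = (\<Sum>j\<in>{0..k - 1}. \<phi> j)"
  proof -
    have "{0..k - 1} = insert (k - 1) {0..<k - 1}" by auto
    thus ?thesis using assms by (simp add: \<phi>_def)
  qed
  also have "\<dots> = \<phi> 0 + (\<Sum>j\<in>{1..k - 1}. \<phi> j)"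
    by (simp add: sum.atLeast_Suc_atMost)
  also have "\<phi> 0 + (\<Sum>j\<in>{1..k - 1}. \<phi> j) + (\<Sum>j\<in>{1..k - 1}. g j / real (k - j)) = \<phi> 0 + (\<Sum>j\<in>{1..k - 1}. g j)"
  proof -
    have "\<phi> j + g j / real (k - j) = g j" if "j \<in> {1..k - 1}" for j
    proof -
      have "real (k - j - 1) = real (k - j) - 1" "real (k - j) > 0" using that by (auto simp: of_nat_diff)
      moreover have "(d - 1) / d * x + x / d = x" if "d > 0" for d x :: real using that by (simp add: field_simps)
      ultimately show ?thesis unfolding \<phi>_def by (simp only:)
    qed
    hence "(\<Sum>j\<in>{1..k - 1}. \<phi> j + g j / real (k - j)) = (\<Sum>j\<in>{1..k - 1}. g j)" by (intro sum.cong) auto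
    thus ?thesis by (simp add: sum.distrib)
  qed
  also have "\<phi> 0 = real (k - 1) / real k" by (simp add: \<phi>_def g_def)
  finally show ?case using Suc.IH by (simp add: g_def algebra_simps add_divide_distrib)
qed simp

context prime_base
begin

abbreviation rp :: real where "rp \<equiv> of_int p"

definition good :: "nat \<Rightarrow> real \<Rightarrow> bool" where
  "good k \<eta> \<longleftrightarrow> (\<exists>C\<ge>1. \<forall>m. dec k m (C * rp powr (\<eta> * real m)))"

text \<open>
  The divisibility of \<open>b\<close> by a power of \<open>(fact k)\<^sup>2\<close> keeps all scales \<open>(k - l + 1) b / l\<close> met in \<open>n\<close> steps integral.
\<close>

definition iter_bound :: "nat \<Rightarrow> nat \<Rightarrow> nat \<Rightarrow> real \<Rightarrow> bool" where
  "iter_bound k n R E \<longleftrightarrow> (\<forall>\<eta> \<epsilon> C. \<eta> \<ge> 0 \<longrightarrow> \<epsilon> \<ge> 0 \<longrightarrow> C \<ge> 1 \<longrightarrow>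
     (\<forall>m. dec k m (C * rp powr (\<eta> * real m))) \<longrightarrow>
     (\<forall>l\<in>{1..<k}. \<forall>s. dec l s (C * rp powr (\<epsilon> * real s))) \<longrightarrow>
     (\<exists>K\<ge>1. \<forall>l\<in>{1..<k}. \<forall>b m. 1 \<le> b \<longrightarrow> ((fact k)\<^sup>2) ^ (n + 1) dvd b \<longrightarrow> R * b \<le> m \<longrightarrow>
        bil k m (l * (l + 1)) ((k - l + 1) * b div l) b
          (K * rp powr (real (k * (k + 1)) * (\<eta> * (real m - gain k n l * real b) + \<epsilon> * E * real b)))))"

lemma powr_pow: "x > 0 \<Longrightarrow> (x powr y) ^ n = x powr (real n * y)" for x y :: real
  by (simp add: powr_powr mult.commute flip: powr_realpow)

text \<open>The division by \<open>l\<close> spends one factor \<open>M\<close> of the divisibility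
  of \<open>b\<close>. The quotient \<open>b div M\<close> will be the step size of the refinements;
  it is small against both scales because \<open>k * k \<le> M\<close>.\<close>

lemma div_scale_props:
  fixes k l b M n :: nat
  assumes l: "1 \<le> l" "l < k" and M: "M = (fact k)\<^sup>2" and dvd: "M ^ (n + 1) dvd b" and b: "1 \<le> b"
  defines "a \<equiv> (k - l + 1) * b div l"
  shows "l * a = (k - l + 1) * b" "M ^ n dvd a" "b \<le> l * a" "1 \<le> a" "a \<le> k * b" "M * (b div M) = b"
    "k * k \<le> M" "k * (b div M) \<le> a"
proof -
  have "l dvd fact k" using l by (intro dvd_fact) auto
  hence "l dvd M" by (simp add: M power2_eq_square)
  then obtain M' where M': "M = l * M'" by (elim dvdE)
  from dvd obtain y where y: "b = M ^ (n + 1) * y" by (elim dvdE)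
  have b': "b = l * (M ^ n * M' * y)" by (simp add: y M' power_mult_distrib mult_ac)
  have a: "a = (k - l + 1) * (M ^ n * M' * y)"
    using l unfolding a_def b' by (metis nonzero_mult_div_cancel_left mult.left_commute less_eq_Suc_le One_nat_def not_less_zero zero_less_iff_neq_zero)
  show la: "l * a = (k - l + 1) * b" unfolding a b' by (simp add: mult_ac)
  show "M ^ n dvd a" unfolding a by (simp add: mult_ac)
  show bla: "b \<le> l * a" unfolding la by simp
  show "1 \<le> a" using bla b by (cases a) auto
  have "a \<le> l * a" using l by simp
  also have "\<dots> \<le> k * b" unfolding la using l by (intro mult_le_mono1) auto
  finally show "a \<le> k * b" .
  have "M dvd b" unfolding y by simp
  thus Ms: "M * (b div M) = b" by simp
  show kM: "k * k \<le> M" unfolding M power2_eq_square by (intro mult_le_mono fact_ge_self)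
  have "k * (k * (b div M)) \<le> M * (b div M)" using kM by (simp add: mult.assoc[symmetric])
  also have "\<dots> \<le> k * a" unfolding Ms using bla l by (meson le_trans less_imp_le mult_le_mono1)
  finally show "k * (b div M) \<le> a" using l by simp
qed

lemma const_combine:
  "(C ^ N * rp powr x) ^ P * (K * rp powr (real P * y)) = (C ^ N) ^ P * K * rp powr (real P * (x + y))"
  by (simp add: power_mult_distrib powr_pow powr_add distrib_left)

text \<open>No gain yet: this is \<open>bil_init\<close>, with the depths \<open>m - a\<close> and
  \<open>m - b\<close> both replaced by \<open>m\<close>. The value \<open>R = k\<close> ensures
  \<open>a \<le> m\<close>.\<close>

lemma iter_bound_0:
  assumes k: "k \<ge> 2"
  shows "iter_bound k 0 k 0"
  unfolding iter_bound_def
proof (intro allI impI)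
  fix \<eta> \<epsilon> C :: real
  assume \<eta>: "\<eta> \<ge> 0" and C: "C \<ge> 1" and dec: "\<forall>m. dec k m (C * rp powr (\<eta> * real m))"
  define P where "P = k * (k + 1)"
  have "bil k m (l * (l + 1)) ((k - l + 1) * b div l) b
          (C ^ P * rp powr (real P * (\<eta> * (real m - gain k 0 l * real b) + \<epsilon> * 0 * real b)))"
    if l: "l \<in> {1..<k}" and b: "1 \<le> b" "((fact k)\<^sup>2) ^ (0 + 1) dvd b" "k * b \<le> m" for l b m
  proof (rule bil_mono)
    let ?a = "(k - l + 1) * b div l"
    define D where "D = (\<lambda>a. C * rp powr (\<eta> * real (m - a)))"
    have "?a \<le> k * b" using div_scale_props(5)[OF _ _ refl b(2,1), of l] l by simp
    moreover have "b \<le> k * b" using k by simp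
    ultimately have a: "?a \<le> m" "b \<le> m" using b(3) by linarith+
    have r: "l * (l + 1) \<le> P" unfolding P_def using l by (intro mult_le_mono) auto
    have D: "0 \<le> D a" "D a \<le> D 0" for a
      using C \<eta> unfolding D_def by (auto intro!: mult_left_mono powr_mono)
    show "bil k m (l * (l + 1)) ?a b (D ?a ^ (l * (l + 1)) * D b ^ (k * (k + 1) - l * (l + 1)))"
    proof (rule bil_init)
      show "dec k (m - ?a) (D ?a)" "dec k (m - b) (D b)" using dec unfolding D_def by blast+
      show "?a \<le> m" "b \<le> m" by (rule a)+
      show "0 \<le> D ?a" "0 \<le> D b" by (rule D)+
      show "l * (l + 1) \<le> k * (k + 1)" using r by (simp only: P_def)
      show "1 \<le> k" using k by simp
    qed
    have "D ?a ^ (l * (l + 1)) * D b ^ (P - l * (l + 1)) \<le> D 0 ^ (l * (l + 1)) * D 0 ^ (P - l * (l + 1))"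
      by (intro mult_mono power_mono D zero_le_power)
    also have "\<dots> = D 0 ^ P" using r by (simp flip: power_add)
    also have "\<dots> = C ^ P * rp powr (real P * (\<eta> * (real m - gain k 0 l * real b) + \<epsilon> * 0 * real b))"
      using l by (simp add: D_def power_mult_distrib powr_pow)
    finally show "D ?a ^ (l * (l + 1)) * D b ^ (k * (k + 1) - l * (l + 1)) \<le> C ^ P * rp powr (real P * (\<eta> * (real m - gain k 0 l * real b) + \<epsilon> * 0 * real b))"
      by (simp only: P_def)
  qed
  thus "\<exists>K\<ge>1. \<forall>l\<in>{1..<k}. \<forall>b m. 1 \<le> b \<longrightarrow> ((fact k)\<^sup>2) ^ (0 + 1) dvd b \<longrightarrow> k * b \<le> m \<longrightarrow>
        bil k m (l * (l + 1)) ((k - l + 1) * b div l) b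
          (K * rp powr (real (k * (k + 1)) * (\<eta> * (real m - gain k 0 l * real b) + \<epsilon> * 0 * real b)))"
    using C unfolding P_def by (intro exI[of _ "C ^ (k * (k + 1))"]) (auto simp: one_le_power)
qed

text \<open>Both inputs of \<open>bil_holder\<close> at the scales
  \<open>a = (k - l + 1) b / l\<close> and \<open>b\<close> come from the induction hypothesis. That
  speaks of finer first classes, and \<open>reach\<close> brings these back to the required scales
  by lower-degree decoupling. The second input has \<open>a\<close> in the place of
  \<open>b\<close>, whence the factor \<open>k\<close> on \<open>R\<close> and
  \<open>E\<close>.\<close>

lemma iter_bound_Suc:
  assumes k: "k \<ge> 2" "int k < p" and R: "R \<ge> k" and E: "E \<ge> 0" and IH: "iter_bound k n R E"
  shows "iter_bound k (Suc n) (k * R) (real k * E + real (k * k))"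
  unfolding iter_bound_def
proof (intro allI impI)
  fix \<eta> \<epsilon> C :: real
  assume \<eta>: "\<eta> \<ge> 0" and \<epsilon>: "\<epsilon> \<ge> 0" and C: "C \<ge> 1" and dec: "\<forall>m. dec k m (C * rp powr (\<eta> * real m))"
    and lower: "\<forall>l\<in>{1..<k}. \<forall>s. dec l s (C * rp powr (\<epsilon> * real s))"
  define P where "P = k * (k + 1)"
  define M :: nat where "M = (fact k)\<^sup>2"
  \<comment> \<open>The number of steps of size \<open>b div M\<close> that cover all scales up to
    \<open>k * k * b\<close>. It depends on neither \<open>b\<close> nor \<open>m\<close>, so
    \<open>C ^ N\<close> is a constant.\<close>
  define N where "N = k * k * M"
  from IH[unfolded iter_bound_def, rule_format, OF \<eta> \<epsilon> C] dec lower
  obtain K where K: "K \<ge> 1" and bil: "\<And>l b m. l \<in> {1..<k} \<Longrightarrow> 1 \<le> b \<Longrightarrow> M ^ (n + 1) dvd b \<Longrightarrow> R * b \<le> m \<Longrightarrow>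
        bil k m (l * (l + 1)) ((k - l + 1) * b div l) b
          (K * rp powr (real P * (\<eta> * (real m - gain k n l * real b) + \<epsilon> * E * real b)))"
    unfolding M_def P_def by blast
  define X where "X = (C ^ (N + 1)) ^ P * K"
  have CN: "1 \<le> (C ^ N) ^ P" "1 \<le> C ^ P" using C by (simp_all add: one_le_power)
  have X_eq: "X = (C ^ N) ^ P * C ^ P * K" by (simp add: X_def power_add power_mult_distrib mult_ac)
  have X1: "X \<ge> 1" "C ^ P \<le> X" "(C ^ N) ^ P * K \<le> X"
  proof -
    have "1 * 1 * 1 \<le> (C ^ N) ^ P * C ^ P * K" using CN K by (intro mult_mono) auto
    thus "X \<ge> 1" by (simp add: X_eq)
    have "1 * C ^ P * 1 \<le> (C ^ N) ^ P * C ^ P * K" using CN K by (intro mult_mono) auto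
    thus "C ^ P \<le> X" by (simp add: X_eq)
    have "(C ^ N) ^ P * 1 * K \<le> (C ^ N) ^ P * C ^ P * K" using CN K by (intro mult_mono) auto
    thus "(C ^ N) ^ P * K \<le> X" by (simp add: X_eq)
  qed
  have main: "bil k m (l * (l + 1)) ((k - l + 1) * b div l) b
          (X * rp powr (real P * (\<eta> * (real m - gain k (Suc n) l * real b) + \<epsilon> * (real k * E + real (k * k)) * real b)))"
    if l: "l \<in> {1..<k}" and b: "1 \<le> b" "M ^ (Suc n + 1) dvd b" "k * R * b \<le> m" for l b m
  proof -
    define a where "a = (k - l + 1) * b div l"
    define s0 where "s0 = b div M"
    have l': "1 \<le> l" "l < k" using l by auto
    note A = div_scale_props[OF l' M_def b(2) b(1), folded a_def s0_def]
    have bn: "M ^ (n + 1) dvd b" using b(2) by (metis Suc_eq_plus1 dvd_trans le_imp_power_dvd lessI less_imp_le add_Suc)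
    have Mn: "M ^ (n + 1) dvd a" using A(2) by simp
    have Ns0: "N * s0 = k * k * b" using A(6) by (simp add: N_def mult.assoc)
    have kb: "k * b \<le> m" "k * (k * b) \<le> m" "R * b \<le> m" "b \<le> m" "R * a \<le> m"
    proof -
      have "k * (k * b) \<le> k * (R * b)" using R by (intro mult_le_mono2 mult_le_mono1)
      also have "\<dots> = k * R * b" by (simp only: mult.assoc)
      finally show 1: "k * (k * b) \<le> m" using b(3) by (rule le_trans)
      have "k * b \<le> k * (k * b)" "b \<le> k * b" using k by auto
      thus "k * b \<le> m" "b \<le> m" using 1 by (meson le_trans)+
      have "R * b \<le> k * R * b" using k by auto
      thus "R * b \<le> m" using b(3) by (rule le_trans)
      have "R * a \<le> R * (k * b)" using A(5) by (rule mult_le_mono2)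
      also have "R * (k * b) = k * R * b" by (simp only: mult_ac)
      finally show "R * a \<le> m" using b(3) by (rule le_trans)
    qed
    have am: "a \<le> m" using A(5) kb(1) by simp
    have reach: "bil k m (l1 * (l1 + 1)) a0 b0 (X * rp powr (real P * (\<eta> * (real m - gain k n l1 * real b0) + \<epsilon> * (E * real b0 + real (k * k) * real b))))"
      if l1: "l1 \<in> {1..<k}" and b0: "1 \<le> b0" "M ^ (n + 1) dvd b0" "R * b0 \<le> m" "b0 \<le> k * b" and a0: "1 \<le> a0" "l1 * s0 \<le> a0" "a0 * l1 \<le> (k - l1 + 1) * b0"
      for l1 a0 b0
    proof (rule bil_mono)
      define a1 where "a1 = (k - l1 + 1) * b0 div l1"
      have l1': "1 \<le> l1" "l1 < k" using l1 by auto
      have "M ^ (n + 1) dvd b0" by fact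
      note A1 = div_scale_props[OF l1' M_def this b0(1), folded a1_def]
      have a01: "a0 \<le> a1"
      proof -
        have "l1 * a0 \<le> l1 * a1" unfolding A1(1) using a0(3) by (simp add: mult.commute)
        thus ?thesis using l1' by simp
      qed
      have a1b: "a1 \<le> k * (k * b)" using A1(5) b0(4) by (meson le_trans mult_le_mono2)
      define Kb where "Kb = K * rp powr (real P * (\<eta> * (real m - gain k n l1 * real b0) + \<epsilon> * E * real b0))"
      have "bil k m (l1 * (l1 + 1)) a1 b0 Kb"
        unfolding a1_def Kb_def by (rule bil) (use l1 b0 in auto)
      moreover have "Kb \<ge> 0" using K by (simp add: Kb_def)
      ultimately show "bil k m (l1 * (l1 + 1)) a0 b0 ((C ^ N * rp powr (\<epsilon> * real a1)) ^ (k * (k + 1)) * Kb)"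
        using lower l1 a1b kb A1(1) by (intro bil_reach[OF C \<epsilon> _ l1' k(2) _ a0(1,2) _ a01]) (auto simp: Ns0 mult.assoc)
      have "(C ^ N * rp powr (\<epsilon> * real a1)) ^ P * Kb =
        (C ^ N) ^ P * K * rp powr (real P * (\<epsilon> * real a1 + (\<eta> * (real m - gain k n l1 * real b0) + \<epsilon> * E * real b0)))"
        unfolding Kb_def by (rule const_combine)
      also have "\<dots> \<le> X * rp powr (real P * (\<eta> * (real m - gain k n l1 * real b0) + \<epsilon> * (E * real b0 + real (k * k) * real b)))"
      proof (rule mult_mono[OF X1(3) powr_mono])
        have "real a1 \<le> real (k * (k * b))" using a1b by (simp only: of_nat_le_iff)
        hence "\<epsilon> * real a1 \<le> \<epsilon> * (real (k * k) * real b)" using \<epsilon> by (intro mult_left_mono) auto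
        hence "\<epsilon> * real a1 + (\<eta> * (real m - gain k n l1 * real b0) + \<epsilon> * E * real b0) \<le>
          \<eta> * (real m - gain k n l1 * real b0) + \<epsilon> * (E * real b0 + real (k * k) * real b)"
          by (simp add: algebra_simps)
        thus "real P * (\<epsilon> * real a1 + (\<eta> * (real m - gain k n l1 * real b0) + \<epsilon> * E * real b0)) \<le>
          real P * (\<eta> * (real m - gain k n l1 * real b0) + \<epsilon> * (E * real b0 + real (k * k) * real b))"
          by (intro mult_left_mono) auto
      qed (use X1 K in auto)
      finally show "(C ^ N * rp powr (\<epsilon> * real a1)) ^ (k * (k + 1)) * Kb \<le>
         X * rp powr (real P * (\<eta> * (real m - gain k n l1 * real b0) + \<epsilon> * (E * real b0 + real (k * k) * real b)))"
        by (simp only: P_def)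
    qed
    define u1 where "u1 = \<eta> * (real m - gain k n (l - 1) * real b) + \<epsilon> * (E * real b + real (k * k) * real b)"
    define u2 where "u2 = \<eta> * (real m - gain k n (k - l) * real a) + \<epsilon> * (E * real a + real (k * k) * real b)"
    \<comment> \<open>For \<open>l = 1\<close> the first factor has exponent 0. Decoupling the other
      class, which lives at scale \<open>b\<close>, saves \<open>\<eta> b\<close>: this is the gain
      1 at index 0.\<close>
    have 1: "bil k m ((l - 1) * l) a b (X * rp powr (real P * u1))"
    proof (cases "l = 1")
      case True
      show ?thesis
      proof (rule bil_mono)
        define D where "D = (\<lambda>a. C * rp powr (\<eta> * real (m - a)))"
        show "bil k m ((l - 1) * l) a b (D a ^ ((l - 1) * l) * D b ^ (k * (k + 1) - (l - 1) * l))"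
        proof (rule bil_init)
          show "dec k (m - a) (D a)" "dec k (m - b) (D b)" using dec unfolding D_def by blast+
          show "D a \<ge> 0" "D b \<ge> 0" using C by (simp_all add: D_def)
        qed (use am kb(4) k True in auto)
        have "(l - 1) * l = 0" using True by simp
        hence "D a ^ ((l - 1) * l) * D b ^ (k * (k + 1) - (l - 1) * l) = D b ^ P"
          by (simp only: P_def power_0 mult_1_left diff_zero)
        also have "\<dots> = C ^ P * rp powr (real P * (\<eta> * (real m - real b)))"
          using kb(4) by (simp add: D_def power_mult_distrib powr_pow of_nat_diff)
        also have "\<dots> \<le> X * rp powr (real P * u1)"
          using X1 E \<epsilon> True by (intro mult_mono[OF X1(2)] powr_mono mult_left_mono) (auto simp: u1_def)
        finally show "D a ^ ((l - 1) * l) * D b ^ (k * (k + 1) - (l - 1) * l) \<le> X * rp powr (real P * u1)" .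
      qed
    next
      case False
      define l1 where "l1 = l - 1"
      have l1: "l = l1 + 1" "1 \<le> l1" "l1 < k" using False l' by (auto simp: l1_def)
      have "bil k m (l1 * (l1 + 1)) a b (X * rp powr (real P * (\<eta> * (real m - gain k n l1 * real b) + \<epsilon> * (E * real b + real (k * k) * real b))))"
      proof (rule reach)
        have "l1 * s0 \<le> k * s0" using l1 by (intro mult_le_mono1) auto
        thus "l1 * s0 \<le> a" using A(8) by (rule le_trans)
        have "a * l1 \<le> l * a" using l1 by simp
        also have "\<dots> \<le> (k - l1 + 1) * b" unfolding A(1) using l1 by (intro mult_le_mono1) auto
        finally show "a * l1 \<le> (k - l1 + 1) * b" .
      qed (use l1 b bn kb A k in auto)
      thus ?thesis using l1 by (simp add: u1_def)
    qed
    have 2: "bil k m ((k - l) * (k - l + 1)) b a (X * rp powr (real P * u2))"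
      unfolding u2_def
    proof (rule reach)
      have "(k - l) * s0 \<le> k * k * s0" using k by (intro mult_le_mono1) (metis diff_le_self le_square le_trans)
      also have "\<dots> \<le> M * s0" using A(7) by (rule mult_le_mono1)
      finally show "(k - l) * s0 \<le> b" unfolding A(6) .
      have "l * (b * (k - l)) \<le> (l + 1) * ((k - l + 1) * b)" by (simp add: algebra_simps)
      also have "\<dots> = l * ((l + 1) * a)" unfolding A(1)[symmetric] by (simp only: mult_ac)
      finally have "b * (k - l) \<le> (l + 1) * a" using l' by (simp only: mult_le_cancel1)
      moreover have "k - (k - l) = l" using l' by simp
      ultimately show "b * (k - l) \<le> (k - (k - l) + 1) * a" by (simp only:)
    qed (use l' Mn kb A b in auto)
    have "bil k m (l * (l + 1)) a b ((X * rp powr (real P * u1)) powr (real (k - l) / real (k - l + 1)) * (X * rp powr (real P * u2)) powr (1 / real (k - l + 1)))"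
      by (rule bil_holder[OF l' _ _ 1 2]) (use X1 in auto)
    moreover have "(X * rp powr (real P * u1)) powr (real (k - l) / real (k - l + 1)) * (X * rp powr (real P * u2)) powr (1 / real (k - l + 1))
      \<le> X * rp powr (real P * (\<eta> * (real m - gain k (Suc n) l * real b) + \<epsilon> * (real k * E + real (k * k)) * real b))"
    proof -
      define t where "t = real (k - l)"
      have t: "t \<ge> 1" "real (k - l + 1) = t + 1" using l' by (auto simp: t_def of_nat_diff)
      define v where "v = t / (t + 1) * u1 + 1 / (t + 1) * u2"
      have "(X * rp powr (real P * u1)) powr (t / (t + 1)) * (X * rp powr (real P * u2)) powr (1 / (t + 1)) =
         X powr (t / (t + 1) + 1 / (t + 1)) * rp powr (real P * v)"
        using X1 by (simp add: powr_mult powr_powr powr_add v_def distrib_left mult_ac)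
      also have "t / (t + 1) + 1 / (t + 1) = 1" using t by (simp add: field_simps)
      also have "X powr 1 = X" using X1 by simp
      also have "X * rp powr (real P * v) \<le> X * rp powr (real P * (\<eta> * (real m - gain k (Suc n) l * real b) + \<epsilon> * (real k * E + real (k * k)) * real b))"
      proof (intro mult_left_mono powr_mono)
        have la: "real l * real a = (t + 1) * real b"
          using A(1) t(2) by (metis of_nat_mult)
        have l0: "real l > 0" using l' by simp
        have g: "gain k (Suc n) l = t / (t + 1) * gain k n (l - 1) + gain k n (k - l) / real l"
          using l' t(2) by (simp add: t_def)
        \<comment> \<open>The weight \<open>1 / (k - l + 1)\<close> of the input at scale
          \<open>a\<close> turns \<open>a\<close> into \<open>b / l\<close>; this is the division by
          \<open>l\<close> in \<open>gain\<close>.\<close>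
        have ab: "real a / (t + 1) = real b / real l"
          using la l0 t by (simp add: field_simps)
        define g1 where "g1 = gain k n (l - 1)"
        define g2 where "g2 = gain k n (k - l)"
        define T where "T = t / (t + 1)"
        have T1: "1 / (t + 1) = 1 - T" using t by (simp add: T_def field_simps)
        have Tab: "(1 - T) * real a = real b / real l" using ab by (simp add: T1[symmetric])
        have T01: "0 \<le> T" "T \<le> 1" using t by (auto simp: T_def)
        have "v = \<eta> * (real m - (T * (g1 * real b) + g2 * ((1 - T) * real a))) + \<epsilon> * (E * (T * real b + (1 - T) * real a) + real (k * k) * real b)"
          unfolding v_def u1_def u2_def T1 T_def[symmetric] g1_def[symmetric] g2_def[symmetric] by (simp add: algebra_simps)
        also have "T * (g1 * real b) + g2 * ((1 - T) * real a) = gain k (Suc n) l * real b"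
          unfolding Tab g g1_def[symmetric] g2_def[symmetric] T_def[symmetric] by (simp add: algebra_simps)
        also have "\<eta> * (real m - gain k (Suc n) l * real b) + \<epsilon> * (E * (T * real b + (1 - T) * real a) + real (k * k) * real b)
          \<le> \<eta> * (real m - gain k (Suc n) l * real b) + \<epsilon> * (E * (real k * real b) + real (k * k) * real b)"
        proof (intro add_left_mono mult_left_mono add_right_mono)
          have "b \<le> k * b" using k(1) by simp
          hence "real b \<le> real k * real b" by (metis of_nat_le_iff of_nat_mult)
          moreover have "real a \<le> real k * real b" using A(5) by (metis of_nat_le_iff of_nat_mult)
          ultimately have "T * real b + (1 - T) * real a \<le> T * (real k * real b) + (1 - T) * (real k * real b)"
            using T01 by (intro add_mono mult_left_mono) auto
          thus "T * real b + (1 - T) * real a \<le> real k * real b" by (simp add: algebra_simps)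
        qed (use E \<epsilon> in auto)
        finally show "v \<le> \<eta> * (real m - gain k (Suc n) l * real b) + \<epsilon> * (real k * E + real (k * k)) * real b"
          by (simp add: algebra_simps)
      qed (use X1 in auto)
      finally show ?thesis unfolding t(2) t_def[symmetric] .
    qed
    ultimately show ?thesis unfolding a_def[symmetric] by (rule bil_mono)
  qed
  show "\<exists>K\<ge>1. \<forall>l\<in>{1..<k}. \<forall>b m. 1 \<le> b \<longrightarrow> ((fact k)\<^sup>2) ^ (Suc n + 1) dvd b \<longrightarrow> k * R * b \<le> m \<longrightarrow>
        bil k m (l * (l + 1)) ((k - l + 1) * b div l) b
          (K * rp powr (real (k * (k + 1)) * (\<eta> * (real m - gain k (Suc n) l * real b) + \<epsilon> * (real k * E + real (k * k)) * real b)))"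
    using main X1(1) unfolding M_def P_def by (intro exI[of _ X]) blast
qed

lemma iter_bound_exists:
  assumes "k \<ge> 2" "int k < p"
  shows "\<exists>R E. R \<ge> k \<and> E \<ge> 0 \<and> iter_bound k n R E"
proof (induction n)
  case 0
  show ?case using iter_bound_0[OF assms(1)] by (intro exI[of _ k] exI[of _ 0]) auto
next
  case (Suc n)
  then obtain R E where "R \<ge> k" "E \<ge> 0" "iter_bound k n R E" by blast
  moreover from this have "k \<le> k * R" using assms by (cases R) auto
  ultimately show ?case using iter_bound_Suc[OF assms]
    by (intro exI[of _ "k * R"] exI[of _ "real k * E + real (k * k)"]) auto
qed

section \<open>Vanishing of the decoupling exponent\<close>

lemma good_mono: "good k \<eta> \<Longrightarrow> \<eta> \<le> \<eta>' \<Longrightarrow> good k \<eta>'"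
proof -
  assume g: "good k \<eta>" and le: "\<eta> \<le> \<eta>'"
  from g obtain C where C: "C \<ge> 1" "\<And>m. dec k m (C * rp powr (\<eta> * real m))" unfolding good_def by blast
  have "C * rp powr (\<eta> * real m) \<le> C * rp powr (\<eta>' * real m)" for m
    using C(1) le by (intro mult_left_mono powr_mono mult_right_mono) auto
  thus ?thesis unfolding good_def using C dec_mono by blast
qed

lemma good_trivial: "k \<ge> 1 \<Longrightarrow> good k (real (k * (k + 1) div 2))"
  unfolding good_def
proof (intro exI[of _ 1] conjI allI)
  fix m assume "k \<ge> 1"
  have "rp ^ (m * (k * (k + 1) div 2)) = 1 * rp powr (real (k * (k + 1) div 2) * real m)"
    by (simp add: mult.commute flip: powr_realpow)
  thus "dec k m (1 * rp powr (real (k * (k + 1) div 2) * real m))"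
    using dec_trivial[OF \<open>k \<ge> 1\<close>, of m] by (simp only:)
qed auto

lemma good_1: "\<eta> \<ge> 0 \<Longrightarrow> good 1 \<eta>"
  unfolding good_def
  by (intro exI[of _ 1] conjI allI dec_mono[OF dec_1]) (auto simp: ge_one_powr_ge_zero)

text \<open>The broad term grows like \<open>p ^ (\<eta> m)\<close> with positive \<eta>, so the
  recursion of \<open>broad_narrow\<close> from \<open>m\<close> to \<open>m + 1\<close> sums like a
  geometric series and costs only a constant.\<close>

lemma dec_of_bil:
  assumes k: "k \<ge> 2" and r: "r \<le> k * (k + 1)" and \<eta>: "\<eta> > 0" and K: "K \<ge> 0"
    and bil: "\<And>m. m \<ge> 1 \<Longrightarrow> bil k m r 1 1 (K * rp powr (real (k * (k + 1)) * (\<eta> * real m)))"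
  shows "good k \<eta>"
proof -
  define P where "P = k * (k + 1)"
  have P: "P > 0" using k by (simp add: P_def)
  define J where "J = rp ^ (2 * P + 2) * root P K"
  have J: "J \<ge> 0" using K P by (simp add: J_def)
  have lt: "rp powr (- \<eta>) < 1" using \<eta> powr_less_mono[of "- \<eta>" 0 rp] by simp
  \<comment> \<open>Chosen for \<open>C p ^ (- \<eta>) + J \<le> C\<close>, the inequality that
    closes the induction on \<open>m\<close>.\<close>
  define C where "C = 1 + J / (1 - rp powr (- \<eta>))"
  have C1: "C \<ge> 1" using J lt by (simp add: C_def)
  have CJ: "C * rp powr (- \<eta>) + J \<le> C"
  proof -
    have "C * (1 - rp powr (- \<eta>)) = (1 - rp powr (- \<eta>)) + J" using lt \<eta> unfolding C_def distrib_right by simp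
    thus ?thesis using lt by (simp add: algebra_simps)
  qed
  have "dec k m (C * rp powr (\<eta> * real m))" for m
  proof (induction m)
    case 0
    show ?case by (rule dec_mono[OF dec_trivial[of k 0]]) (use k C1 in auto)
  next
    case (Suc m)
    have rt: "root P (K * rp powr (real P * (\<eta> * real (m + 1)))) = root P K * rp powr (\<eta> * real (m + 1))"
      using P by (simp add: real_root_mult powr_pow[symmetric] real_root_power_cancel del: of_nat_add of_nat_Suc)
    have "dec k (m + 1) (C * rp powr (\<eta> * real m) + rp ^ (2 * P + 2) * root P (K * rp powr (real P * (\<eta> * real (m + 1)))))"
      unfolding P_def by (rule broad_narrow[OF Suc.IH _ bil _ r k]) (use C1 K in auto)
    hence "dec k (m + 1) (C * rp powr (\<eta> * real m) + J * rp powr (\<eta> * real (m + 1)))"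
      unfolding rt J_def by (simp only: mult.assoc)
    moreover have "C * rp powr (\<eta> * real m) + J * rp powr (\<eta> * real (m + 1)) \<le> C * rp powr (\<eta> * real (m + 1))"
    proof -
      have "rp powr (\<eta> * real m) = rp powr (- \<eta>) * rp powr (\<eta> * real (m + 1))"
        by (simp add: algebra_simps flip: powr_add)
      hence "C * rp powr (\<eta> * real m) + J * rp powr (\<eta> * real (m + 1)) = (C * rp powr (- \<eta>) + J) * rp powr (\<eta> * real (m + 1))"
        by (simp only: distrib_right mult.assoc)
      also have "\<dots> \<le> C * rp powr (\<eta> * real (m + 1))" by (intro mult_right_mono CJ) auto
      finally show ?thesis .
    qed
    ultimately show ?case using dec_mono by simp
  qed
  thus ?thesis unfolding good_def using C1 by blast
qed

text \<open>
  After enough steps the gain \<open>\<eta> gain k n l b\<close> exceeds the cost \<open>k P b\<close> of reaching the scales \<open>a\<close> and \<open>b\<close> from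
  the scale \<open>1\<close> by the trivial decoupling. Choosing \<open>b\<close> proportional to \<open>m\<close> then lowers \<open>\<eta>\<close> by an
  amount that depends on \<open>\<eta>\<close> only through the lower bound \<open>\<eta>0\<close>.
\<close>

lemma improve_exponent:
  assumes k: "k \<ge> 2" "int k < p" and lower: "\<And>l \<epsilon>. l \<in> {1..<k} \<Longrightarrow> \<epsilon> > 0 \<Longrightarrow> good l \<epsilon>" and \<eta>0: "\<eta>0 > 0"
  shows "\<exists>\<kappa>>0. \<forall>\<eta>\<ge>\<eta>0. good k \<eta> \<longrightarrow> good k (\<eta> - \<kappa>)"
proof -
  define P where "P = k * (k + 1)"
  \<comment> \<open>The gain must pay \<open>k P b\<close> for the trivial descent and
    \<open>b\<close> for the lower-degree losses, and leave \<open>b\<close> as saving: hence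
    \<open>k P + 2\<close>.\<close>
  define n where "n = nat \<lceil>real k * (real (k * P) + 2) / \<eta>0\<rceil>"
  have n: "real n / real k * \<eta>0 \<ge> real (k * P) + 2"
  proof -
    have "real n \<ge> real k * (real (k * P) + 2) / \<eta>0" unfolding n_def by linarith
    thus ?thesis using k \<eta>0 by (simp add: field_simps)
  qed
  \<comment> \<open>Pigeonhole: the gains sum to \<open>n (k - 1) / k\<close> over
    \<open>k - 1\<close> indices.\<close>
  have "\<exists>l\<in>{1..k - 1}. gain k n l \<ge> real n / real k"
  proof (rule ccontr)
    assume "\<not> ?thesis"
    hence "(\<Sum>l\<in>{1..k - 1}. gain k n l) < (\<Sum>l\<in>{1..k - 1}. real n / real k)"
      using k by (intro sum_strict_mono) (auto simp: not_le)
    thus False using sum_gain[of k n] k by (simp add: mult.commute)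
  qed
  then obtain l where l: "l \<in> {1..<k}" and gl: "gain k n l \<ge> real n / real k" using k by force
  obtain R E where R: "R \<ge> k" and E: "E \<ge> 0" and it: "iter_bound k n R E"
    using iter_bound_exists[OF k] by blast
  define \<epsilon> where "\<epsilon> = 1 / (E + 1)"
  have \<epsilon>: "\<epsilon> > 0" "\<epsilon> * E \<le> 1" using E by (auto simp: \<epsilon>_def field_simps)
  have "\<forall>l\<in>{1..<k}. \<exists>C\<ge>1. \<forall>s. dec l s (C * rp powr (\<epsilon> * real s))"
    using lower \<epsilon>(1) unfolding good_def by blast
  then obtain Cl where Cl: "\<And>l. l \<in> {1..<k} \<Longrightarrow> Cl l \<ge> 1"
    "\<And>l s. l \<in> {1..<k} \<Longrightarrow> dec l s (Cl l * rp powr (\<epsilon> * real s))" by metis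
  define C0 where "C0 = (\<Sum>l\<in>{1..<k}. Cl l)"
  have C0: "Cl l \<le> C0" if "l \<in> {1..<k}" for l
    unfolding C0_def using that Cl(1) by (intro member_le_sum) (auto intro: order_trans[OF zero_le_one])
  have C00: "C0 \<ge> 0" using C0[OF l] Cl(1)[OF l] by linarith
  define M :: nat where "M = (fact k)\<^sup>2"
  define B where "B = M ^ (n + 1)"
  have B: "B \<ge> 1" by (simp add: B_def M_def)
  \<comment> \<open>The saving is \<open>b\<close>, which can be taken as large as about
    \<open>m / R\<close>; the bound \<open>\<eta>0 / 2\<close> keeps
    \<open>\<eta> - \<kappa>\<close> positive.\<close>
  define \<kappa> where "\<kappa> = min (1 / real R) (\<eta>0 / 2)"
  have R0: "real R > 0" using R k by simp
  have \<kappa>: "\<kappa> > 0" "\<kappa> \<le> 1 / real R" "\<kappa> \<le> \<eta>0 / 2" using \<eta>0 R0 by (auto simp: \<kappa>_def)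
  define r where "r = l * (l + 1)"
  have l': "1 \<le> l" "l < k" using l by auto
  have r: "even r" "2 \<le> r" "r < P"
  proof -
    show "even r" by (simp add: r_def)
    have "1 * 2 \<le> r" unfolding r_def using l' by (intro mult_le_mono) auto
    thus "2 \<le> r" by simp
    show "r < P" unfolding r_def P_def using l' by (intro mult_strict_mono) auto
  qed
  have "even P" by (simp add: P_def)
  have r': "even (P - r)" "2 \<le> P - r" "P - r < P"
  proof -
    show 1: "even (P - r)" using \<open>even P\<close> r by simp
    have "P - r \<noteq> 0" using r by simp
    moreover have "P - r \<noteq> 1" using 1 by (metis odd_one)
    ultimately show "2 \<le> P - r" by linarith
    show "P - r < P" using r by linarith
  qed
  show ?thesis
  proof (intro exI[of _ \<kappa>] conjI allI impI \<kappa>(1))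
    fix \<eta> assume \<eta>: "\<eta> \<ge> \<eta>0" and g: "good k \<eta>"
    from g obtain C1 where C1: "C1 \<ge> 1" "\<And>m. dec k m (C1 * rp powr (\<eta> * real m))" unfolding good_def by blast
    define C where "C = C0 + C1"
    have C: "C \<ge> 1" using C00 C1 by (simp add: C_def)
    have dec: "dec k m (C * rp powr (\<eta> * real m))" for m
      by (rule dec_mono[OF C1(2)]) (use C00 in \<open>auto simp: C_def intro!: mult_right_mono\<close>)
    have low: "dec l s (C * rp powr (\<epsilon> * real s))" if "l \<in> {1..<k}" for l s
      by (rule dec_mono[OF Cl(2)[OF that]]) (use C0[OF that] C1 in \<open>auto simp: C_def intro!: mult_right_mono\<close>)
    have "\<eta> \<ge> 0" "\<epsilon> \<ge> 0" using \<eta> \<eta>0 \<epsilon> by auto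
    from it[unfolded iter_bound_def, rule_format, OF this C] dec low
    obtain K where K: "K \<ge> 1" and bil: "\<And>l b m. l \<in> {1..<k} \<Longrightarrow> 1 \<le> b \<Longrightarrow> B dvd b \<Longrightarrow> R * b \<le> m \<Longrightarrow>
        bil k m (l * (l + 1)) ((k - l + 1) * b div l) b
          (K * rp powr (real P * (\<eta> * (real m - gain k n l * real b) + \<epsilon> * E * real b)))"
      unfolding B_def M_def P_def by blast
    define K2 where "K2 = C ^ P * rp powr (real P * (\<kappa> * real (R * B))) + K * rp powr (real P * real B)"
    have K2: "C ^ P * rp powr (real P * (\<kappa> * real (R * B))) \<le> K2" "K * rp powr (real P * real B) \<le> K2"
      using C K by (auto simp: K2_def)
    show "good k (\<eta> - \<kappa>)"
    proof (rule dec_of_bil[OF k(1), where r = "P - r" and K = K2])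
      show "P - r \<le> k * (k + 1)" by (simp add: P_def)
      show "\<eta> - \<kappa> > 0" using \<eta> \<kappa> \<eta>0 by simp
      show "K2 \<ge> 0" using C K by (simp add: K2_def)
      fix m :: nat assume m: "m \<ge> 1"
      define y where "y = m div (R * B)"
      show "bil k m (P - r) 1 1 (K2 * rp powr (real (k * (k + 1)) * ((\<eta> - \<kappa>) * real m)))"
      proof (cases "y = 0")
        \<comment> \<open>No admissible \<open>b\<close> exists for such \<open>m\<close>; these
          finitely many depths are absorbed into \<open>K2\<close>.\<close>
        case True
        hence mW: "m \<le> R * B" using B R k by (auto simp: y_def div_eq_0_iff)
        define D where "D = C * rp powr (\<eta> * real m)"
        have "dec k (m - 1) D" unfolding D_def
          by (rule dec_mono[OF dec]) (use C \<open>\<eta> \<ge> 0\<close> in \<open>auto intro!: mult_left_mono powr_mono\<close>)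
        hence "bil k m (P - r) 1 1 (D ^ (P - r) * D ^ (k * (k + 1) - (P - r)))"
          by (intro bil_init) (use m k C in \<open>auto simp: D_def P_def\<close>)
        also have "D ^ (P - r) * D ^ (k * (k + 1) - (P - r)) = D ^ P"
          unfolding P_def[symmetric] by (simp flip: power_add)
        finally have 1: "bil k m (P - r) 1 1 (D ^ P)" .
        have "D ^ P = C ^ P * rp powr (real P * (\<kappa> * real m)) * rp powr (real P * ((\<eta> - \<kappa>) * real m))"
          by (simp add: D_def power_mult_distrib powr_pow algebra_simps flip: powr_add)
        also have "\<dots> \<le> C ^ P * rp powr (real P * (\<kappa> * real (R * B))) * rp powr (real P * ((\<eta> - \<kappa>) * real m))"
          using mW C \<kappa> by (intro mult_right_mono mult_left_mono powr_mono) (auto simp del: of_nat_mult)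
        also have "\<dots> \<le> K2 * rp powr (real P * ((\<eta> - \<kappa>) * real m))"
          by (intro mult_right_mono K2) auto
        finally show ?thesis using bil_mono[OF 1] by (simp add: P_def)
      next
        case False
        define b where "b = B * y"
        have b1: "1 \<le> b" "B dvd b" using False B by (auto simp: b_def)
        have "R * B * y \<le> m" unfolding y_def by simp
        hence Rb: "R * b \<le> m" by (simp add: b_def mult.assoc)
        have b_ge: "real m / real R - real B \<le> real b"
        proof -
          have "m < R * B * (y + 1)" unfolding y_def using B R k by (simp add: dividend_less_times_div)
          also have "R * B * (y + 1) = R * (b + B)" by (simp add: b_def algebra_simps)
          finally have "real m \<le> real R * (real b + real B)" by (metis less_imp_le of_nat_add of_nat_le_iff of_nat_mult)
          thus ?thesis using R0 by (simp add: field_simps)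
        qed
        define a where "a = (k - l + 1) * b div l"
        define Kb where "Kb = K * rp powr (real P * (\<eta> * (real m - gain k n l * real b) + \<epsilon> * E * real b))"
        have Kb0: "Kb \<ge> 0" using K by (simp add: Kb_def)
        have "M ^ (n + 1) dvd b" using b1 by (simp add: B_def)
        note A = div_scale_props[OF l' M_def this b1(1), folded a_def]
        have "k * b \<le> m" using Rb R by (meson le_trans mult_le_mono1)
        hence am: "a \<le> m" "b \<le> m" using A(5) k by (auto intro: le_trans[of b "k * b"])
        define X where "X = rp ^ ((a - 1) * (r div 2))"
        define Y where "Y = rp ^ ((b - 1) * ((P - r) div 2))"
        have "bil k m r a b Kb"
          using bil[OF l b1 Rb] by (simp only: a_def Kb_def r_def)
        hence "bil k m r (1 + (a - 1)) b Kb" using A(4) by simp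
        hence "bil k m r 1 b (X ^ (k * (k + 1)) * Kb)" unfolding X_def
          by (intro bil_trivial_split) (use r am A(4) Kb0 in \<open>auto simp: P_def\<close>)
        hence "bil k m (P - r) b 1 (X ^ (k * (k + 1)) * Kb)" unfolding P_def
          by (rule bil_swap) (use r in \<open>simp add: P_def\<close>)
        hence "bil k m (P - r) (1 + (b - 1)) 1 (X ^ (k * (k + 1)) * Kb)" using b1 by simp
        hence 1: "bil k m (P - r) 1 1 (Y ^ (k * (k + 1)) * (X ^ (k * (k + 1)) * Kb))" unfolding Y_def
          by (intro bil_trivial_split) (use r' am b1 Kb0 in \<open>auto simp: P_def X_def\<close>)
        \<comment> \<open>The price for descending from \<open>a\<close> and \<open>b\<close> to
          scale 1 in both factors.\<close>
        have XY: "Y * X \<le> rp powr (real (k * P) * real b)"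
        proof -
          have "b \<le> k * b" using k by simp
          hence "(b - 1) * ((P - r) div 2) + (a - 1) * (r div 2) \<le> (k * b) * ((P - r) div 2) + (k * b) * (r div 2)"
            using A(5) by (intro add_mono mult_le_mono1) linarith+
          also have "\<dots> = k * b * ((P - r) div 2 + r div 2)" by (simp add: distrib_left)
          also have "\<dots> \<le> k * b * P" using r by (intro mult_le_mono2) linarith
          finally have "rp ^ ((b - 1) * ((P - r) div 2) + (a - 1) * (r div 2)) \<le> rp ^ (k * b * P)"
            by (intro power_increasing) auto
          thus ?thesis by (simp add: X_def Y_def power_add mult_ac flip: powr_realpow)
        qed
        have "Y ^ P * (X ^ P * Kb) = (Y * X) ^ P * Kb" by (simp add: power_mult_distrib mult.assoc)
        also have "\<dots> \<le> (rp powr (real (k * P) * real b)) ^ P * Kb"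
          using XY Kb0 by (intro mult_right_mono power_mono) (auto simp: X_def Y_def)
        also have "\<dots> = K * rp powr (real P * (real (k * P) * real b + (\<eta> * (real m - gain k n l * real b) + \<epsilon> * E * real b)))"
          by (simp add: Kb_def powr_pow powr_add distrib_left mult_ac)
        also have "\<dots> \<le> K * rp powr (real P * real B + real P * ((\<eta> - \<kappa>) * real m))"
        proof (intro mult_left_mono powr_mono)
          have "real n / real k * \<eta>0 \<le> gain k n l * \<eta>"
            using gl \<eta> \<eta>0 gain_nonneg[of k n l] by (intro mult_mono) auto
          hence "real (k * P) + 2 \<le> gain k n l * \<eta>" using n by linarith
          hence "(real (k * P) + 2) * real b \<le> gain k n l * \<eta> * real b" by (intro mult_right_mono) auto
          moreover have "\<epsilon> * E * real b \<le> 1 * real b" using \<epsilon> by (intro mult_right_mono) auto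
          moreover have "\<kappa> * real m \<le> real m / real R" using \<kappa>(2) mult_right_mono[of \<kappa> "1 / real R" "real m"] by simp
          ultimately have "real (k * P) * real b + (\<eta> * (real m - gain k n l * real b) + \<epsilon> * E * real b) \<le> real B + (\<eta> - \<kappa>) * real m"
            using b_ge by (simp add: algebra_simps)
          thus "real P * (real (k * P) * real b + (\<eta> * (real m - gain k n l * real b) + \<epsilon> * E * real b)) \<le> real P * real B + real P * ((\<eta> - \<kappa>) * real m)"
            unfolding distrib_left[symmetric] by (intro mult_left_mono) auto
        qed (use K in auto)
        also have "\<dots> = K * rp powr (real P * real B) * rp powr (real P * ((\<eta> - \<kappa>) * real m))"
          by (simp add: powr_add)
        also have "\<dots> \<le> K2 * rp powr (real P * ((\<eta> - \<kappa>) * real m))"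
          by (intro mult_right_mono K2) auto
        finally show ?thesis using bil_mono[OF 1] by (simp only: P_def)
      qed
    qed
  qed
qed

text \<open>The step \<kappa> is uniform for exponents at least \<eta>, so finitely many steps lead
  from the trivial exponent down to \<eta>; the maximum with \<eta> keeps the step
  applicable.\<close>

theorem good_all:
  assumes "k \<ge> 1" "int k < p" "\<eta> > 0"
  shows "good k \<eta>"
  using assms
proof (induction k arbitrary: \<eta> rule: less_induct)
  case (less k)
  show ?case
  proof (cases "k = 1")
    case True
    thus ?thesis using good_1[of \<eta>] less.prems by simp
  next
    case False
    hence k: "k \<ge> 2" "int k < p" using less.prems by auto
    have "\<And>l \<epsilon>. l \<in> {1..<k} \<Longrightarrow> \<epsilon> > 0 \<Longrightarrow> good l \<epsilon>"
      by (rule less.IH) (use k in auto)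
    from improve_exponent[OF k this \<open>\<eta> > 0\<close>] obtain \<kappa> where \<kappa>: "\<kappa> > 0" "\<And>\<eta>'. \<eta>' \<ge> \<eta> \<Longrightarrow> good k \<eta>' \<Longrightarrow> good k (\<eta>' - \<kappa>)"
      by blast
    define h where "h = real (k * (k + 1) div 2)"
    have "good k (max \<eta> (h - real n * \<kappa>))" for n
    proof (induction n)
      case 0
      show ?case by (rule good_mono[OF good_trivial]) (use k in \<open>auto simp: h_def\<close>)
    next
      case (Suc n)
      have "good k (max \<eta> (h - real n * \<kappa>) - \<kappa>)" by (rule \<kappa>(2)) (use Suc in auto)
      thus ?case
      proof (rule good_mono)
        show "max \<eta> (h - real n * \<kappa>) - \<kappa> \<le> max \<eta> (h - real (Suc n) * \<kappa>)"
          using \<kappa>(1) by (auto simp: algebra_simps max_def)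
      qed
    qed
    moreover obtain n where "h / \<kappa> \<le> real n" using real_arch_simple by blast
    hence "h - real n * \<kappa> \<le> 0" using \<kappa> by (simp add: field_simps)
    hence "max \<eta> (h - real n * \<kappa>) = \<eta>" using less.prems by simp
    ultimately show ?thesis by metis
  qed
qed

text \<open>At scale \<open>p ^ m\<close> every class holds at most one point, so each average on
  the right of \<open>dec\<close> is at most 1 and only the number of classes is left.\<close>

theorem mean_value_estimate:
  assumes "k \<ge> 1" "int k < p" "\<epsilon> > 0"
  shows "\<exists>C\<ge>1. \<forall>m A c. finite A \<longrightarrow> (\<forall>x\<in>A. \<forall>y\<in>A. [x = y] (mod p ^ m) \<longrightarrow> x = y) \<longrightarrow> (\<forall>x. cmod (c x) \<le> 1) \<longrightarrow>
    av k (p ^ (k * m)) (\<lambda>\<alpha>. cmod (F k (p ^ (k * m)) A c \<alpha>) ^ (k * (k + 1))) \<le> C * rp powr (real m * (real (k * (k + 1) div 2) + \<epsilon>))"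
proof -
  from good_all[OF assms] obtain C where C: "C \<ge> 1" "\<And>m. dec k m (C * rp powr (\<epsilon> * real m))"
    unfolding good_def by blast
  show ?thesis
  proof (intro exI[of _ C] conjI allI impI C(1))
    fix m A and c :: "int \<Rightarrow> complex"
    assume A: "finite A" and inj: "\<forall>x\<in>A. \<forall>y\<in>A. [x = y] (mod p ^ m) \<longrightarrow> x = y" and c: "\<forall>x. cmod (c x) \<le> 1"
    define Q where "Q = p ^ (k * m)"
    define h where "h = k * (k + 1) div 2"
    have h1: "h \<ge> 1" using assms(1) by (cases k) (auto simp: h_def)
    have "cmod (F k Q (A \<inter> cls m \<zeta>) c \<alpha>) ^ (k * (k + 1)) \<le> 1" for \<zeta> \<alpha>
    proof -
      have "x = y" if "x \<in> A \<inter> cls m \<zeta>" "y \<in> A \<inter> cls m \<zeta>" for x y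
        using that inj by (auto simp: cls_def cong_def)
      hence card: "card (A \<inter> cls m \<zeta>) \<le> 1" using A by (subst card_le_Suc0_iff_eq[unfolded One_nat_def[symmetric]]) auto
      have "cmod (F k Q (A \<inter> cls m \<zeta>) c \<alpha>) \<le> (\<Sum>x\<in>A \<inter> cls m \<zeta>. cmod (c x * ee (of_int (lin k \<alpha> x) / of_int Q)))"
        unfolding F_def by (rule norm_sum)
      also have "\<dots> \<le> (\<Sum>x\<in>A \<inter> cls m \<zeta>. 1)" by (intro sum_mono) (use c in \<open>auto simp: norm_mult\<close>)
      also have "\<dots> \<le> 1" using card by simp
      finally show ?thesis by (rule power_le_one[OF norm_ge_zero])
    qed
    hence "av k Q (\<lambda>\<alpha>. cmod (F k Q (A \<inter> cls m \<zeta>) c \<alpha>) ^ (k * (k + 1))) \<le> av k Q (\<lambda>_. 1)" for \<zeta>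
      by (intro av_mono) (auto simp: Q_def)
    hence le1: "av k Q (\<lambda>\<alpha>. cmod (F k Q (A \<inter> cls m \<zeta>) c \<alpha>) ^ (k * (k + 1))) \<le> 1" for \<zeta>
      by (simp add: av_const Q_def)
    have "av k Q (\<lambda>\<alpha>. cmod (F k Q A c \<alpha>) ^ (k * (k + 1))) \<le> C * rp powr (\<epsilon> * real m) * rp ^ (m * (h - 1)) *
       (\<Sum>\<zeta>\<in>{0..<p ^ m}. av k Q (\<lambda>\<alpha>. cmod (F k Q (A \<inter> cls m \<zeta>) c \<alpha>) ^ (k * (k + 1))))"
      using C(2)[of m, unfolded dec_def, rule_format, OF A, of c] by (simp only: Q_def h_def)
    also have "\<dots> \<le> C * rp powr (\<epsilon> * real m) * rp ^ (m * (h - 1)) * (\<Sum>\<zeta>\<in>{0..<p ^ m}. 1)"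
      using C(1) by (intro mult_left_mono sum_mono le1) auto
    also have "\<dots> = C * (rp powr (\<epsilon> * real m) * rp ^ (m * (h - 1) + m))"
      by (simp add: power_add mult_ac)
    also have "m * (h - 1) + m = m * h" using h1 by (cases h) auto
    also have "rp powr (\<epsilon> * real m) * rp ^ (m * h) = rp powr (real m * (real h + \<epsilon>))"
      by (simp add: algebra_simps powr_add flip: powr_realpow)
    finally show "av k (p ^ (k * m)) (\<lambda>\<alpha>. cmod (F k (p ^ (k * m)) A c \<alpha>) ^ (k * (k + 1))) \<le> C * rp powr (real m * (real (k * (k + 1) div 2) + \<epsilon>))"
      by (simp only: Q_def h_def)
  qed
qed

end

section \<open>Weyl's bound\<close>

lemma sin_ge_linear:
  assumes "0 \<le> t" "t \<le> 1 / 2"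
  shows "sin (pi * t) \<ge> 2 * t"
proof -
  have "concave_on {0..pi} sin"
    by (rule f''_le0_imp_concave[where f' = cos and f'' = "\<lambda>x. - sin x"])
       (auto intro!: derivative_eq_intros sin_ge_zero)
  from concave_onD[OF this, of "2 * t" 0 "pi / 2"] assms
  show ?thesis by (simp add: mult_ac)
qed

text \<open>The distance to the nearest integer.\<close>

definition nd :: "real \<Rightarrow> real" where
  "nd x = min (frac x) (1 - frac x)"

lemma nd_le: "nd x \<le> \<bar>x - of_int z\<bar>"
proof (cases "z \<le> \<lfloor>x\<rfloor>")
  case True
  hence "of_int z \<le> (of_int \<lfloor>x\<rfloor> :: real)" by simp
  thus ?thesis by (simp add: nd_def frac_def)
next
  case False
  hence "z \<ge> \<lfloor>x\<rfloor> + 1" by simp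
  hence "of_int z \<ge> (of_int (\<lfloor>x\<rfloor> + 1) :: real)" by (simp only: of_int_le_iff)
  thus ?thesis by (simp add: nd_def frac_def)
qed

lemma nd_ge:
  assumes "\<And>z :: int. \<bar>x - of_int z\<bar> \<ge> e"
  shows "nd x \<ge> e"
proof -
  have "\<bar>x - of_int \<lfloor>x\<rfloor>\<bar> = frac x" by (simp add: frac_def)
  moreover have "\<bar>x - of_int (\<lfloor>x\<rfloor> + 1)\<bar> = 1 - frac x" using frac_lt_1[of x] by (simp add: frac_def)
  ultimately show ?thesis using assms[of "\<lfloor>x\<rfloor>"] assms[of "\<lfloor>x\<rfloor> + 1"] by (simp add: nd_def)
qed

lemma norm_one_minus_ee: "cmod (1 - ee \<theta>) \<ge> 4 * nd \<theta>"
proof -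
  define t where "t = frac \<theta>"
  have t: "0 \<le> t" "t < 1" by (simp_all add: t_def frac_lt_1)
  have "ee \<theta> = ee (of_int \<lfloor>\<theta>\<rfloor> + t)" by (simp add: t_def frac_def)
  hence e: "ee \<theta> = ee t" by (simp only: ee_add ee_of_int mult_1_left)
  have s0: "sin (pi * t) \<ge> 0" by (rule sin_ge_zero) (use t in auto)
  have "(cmod (1 - ee t))\<^sup>2 = (1 - cos (2 * pi * t))\<^sup>2 + (sin (2 * pi * t))\<^sup>2"
    by (simp add: cmod_power2 ee_def)
  also have "\<dots> = 2 - 2 * cos (2 * pi * t)"
    using sin_cos_squared_add[of "2 * pi * t"] by (simp add: power2_diff)
  also have "cos (2 * pi * t) = 1 - 2 * (sin (pi * t))\<^sup>2"
    using cos_double_sin[of "pi * t"] by (simp add: mult.assoc)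
  finally have "(cmod (1 - ee t))\<^sup>2 = (2 * sin (pi * t))\<^sup>2" by (simp add: power_mult_distrib)
  hence "cmod (1 - ee t) = 2 * sin (pi * t)" by (rule power2_eq_imp_eq) (use s0 in auto)
  moreover have "sin (pi * t) \<ge> 2 * nd \<theta>"
  proof (cases "t \<le> 1 / 2")
    case True
    thus ?thesis using sin_ge_linear[of t] t by (simp add: nd_def t_def[symmetric])
  next
    case False
    have "sin (pi * t) = sin (pi * (1 - t))" by (simp add: right_diff_distrib)
    moreover have "sin (pi * (1 - t)) \<ge> 2 * (1 - t)" by (rule sin_ge_linear) (use t False in auto)
    ultimately show ?thesis using False by (simp add: nd_def t_def[symmetric])
  qed
  ultimately show ?thesis using e by simp
qed

lemma ee_power: "ee x ^ n = ee (of_nat n * x)"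
  by (induction n) (simp_all add: distrib_right ee_add)

text \<open>Multiplied out instead of divided, so that integral \<theta> is no exception.\<close>

lemma geometric_kernel_bound:
  "cmod (\<Sum>v\<in>{a..<a + int n}. ee (\<theta> * of_int v)) * (2 * nd \<theta>) \<le> 1"
proof -
  define S where "S = (\<Sum>v\<in>{a..<a + int n}. ee (\<theta> * of_int v))"
  have "S = (\<Sum>i<n. ee (\<theta> * of_int (a + int i)))" unfolding S_def
    by (rule sum.reindex_bij_witness[of _ "\<lambda>i. a + int i" "\<lambda>v. nat (v - a)"]) auto
  also have "\<dots> = ee (\<theta> * of_int a) * (\<Sum>i<n. ee \<theta> ^ i)"
    unfolding sum_distrib_left by (intro sum.cong refl) (simp add: ee_power distrib_left ee_add mult.commute)
  finally have "(1 - ee \<theta>) * S = ee (\<theta> * of_int a) * (1 - ee \<theta> ^ n)"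
    by (simp add: one_diff_power_eq mult_ac)
  hence "cmod (1 - ee \<theta>) * cmod S = cmod (1 - ee \<theta> ^ n)" by (metis norm_mult norm_ee mult_1_left)
  also have "\<dots> \<le> cmod 1 + cmod (ee \<theta> ^ n)" by (rule norm_triangle_ineq4)
  also have "\<dots> = 2" by (simp add: norm_power)
  finally have "cmod (1 - ee \<theta>) * cmod S \<le> 2" .
  moreover have "4 * nd \<theta> * cmod S \<le> cmod (1 - ee \<theta>) * cmod S"
    by (intro mult_right_mono norm_one_minus_ee) auto
  ultimately have "4 * (nd \<theta> * cmod S) \<le> 2" unfolding mult.assoc by linarith
  thus ?thesis unfolding S_def[symmetric] by (simp add: mult_ac)
qed

text \<open>Cut the circle into \<open>2 r\<close> arcs. The spacing allows one point per arc; the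
  two arcs next to 0 take the trivial bound \<open>M\<close>, and the others form a harmonic sum
  from each side.\<close>

lemma spaced_sum:
  fixes f :: "'a \<Rightarrow> real"
  assumes I: "finite I" and r: "r \<ge> 1" and M: "M \<ge> 0"
    and spaced: "\<And>i j. i \<in> I \<Longrightarrow> j \<in> I \<Longrightarrow> i \<noteq> j \<Longrightarrow> nd (f i - f j) \<ge> 1 / (2 * real r)"
    and g: "\<And>i. i \<in> I \<Longrightarrow> g i \<le> M" "\<And>i. i \<in> I \<Longrightarrow> g i * (2 * nd (f i)) \<le> 1"
  shows "sum g I \<le> 2 * M + 2 * real r * harm (2 * r)"
proof -
  define R where "R = 2 * r"
  define b where "b = (\<lambda>i. nat \<lfloor>real R * frac (f i)\<rfloor>)"
  \<comment> \<open>The two reciprocals together dominate the reciprocal of the smaller distance,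
    and \<open>inverse 0 = 0\<close> keeps the formula harmless in the end arcs.\<close>
  define h where "h = (\<lambda>b. (if b = 0 \<or> b = R - 1 then M else 0) + real r * inverse (real b) + real r * inverse (real (R - 1 - b)))"
  have R: "R \<ge> 2" using r by (simp add: R_def)
  have b_bounds: "real (b i) \<le> real R * frac (f i)" "real R * frac (f i) < real (b i) + 1" for i
  proof -
    have "real R * frac (f i) \<ge> 0" by simp
    thus "real (b i) \<le> real R * frac (f i)" "real R * frac (f i) < real (b i) + 1"
      unfolding b_def by linarith+
  qed
  have b_lt: "b i < R" for i
  proof -
    have "real R * frac (f i) < real R" using frac_lt_1[of "f i"] R by simp
    thus ?thesis using b_bounds(1)[of i] by linarith
  qed
  have inj: "inj_on b I"
  proof
    fix i j assume ij: "i \<in> I" "j \<in> I" "b i = b j"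
    show "i = j"
    proof (rule ccontr)
      assume "i \<noteq> j"
      have "\<bar>real R * frac (f i) - real R * frac (f j)\<bar> < 1"
        using b_bounds[of i] b_bounds[of j] ij(3) by linarith
      hence "real R * \<bar>frac (f i) - frac (f j)\<bar> < 1"
        by (metis abs_mult abs_of_nat right_diff_distrib)
      hence "\<bar>frac (f i) - frac (f j)\<bar> < 1 / real R" using R by (simp add: field_simps)
      moreover have "frac (f i) - frac (f j) = (f i - f j) - of_int (\<lfloor>f i\<rfloor> - \<lfloor>f j\<rfloor>)" by (simp add: frac_def)
      ultimately have "nd (f i - f j) < 1 / real R" using nd_le by (metis order_le_less_trans)
      thus False using spaced[OF ij(1,2) \<open>i \<noteq> j\<close>] by (simp add: R_def)
    qed
  qed
  have gh: "g i \<le> h (b i)" if i: "i \<in> I" for i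
  proof (cases "b i = 0 \<or> b i = R - 1")
    case True
    hence "M \<le> h (b i)" by (simp add: h_def)
    thus ?thesis using g(1)[OF i] by linarith
  next
    case False
    hence B: "b i \<ge> 1" "R - 1 - b i \<ge> 1" using b_lt[of i] by linarith+
    define x where "x = real (b i)"
    define y where "y = real (R - 1 - b i)"
    have xy: "x \<ge> 1" "y \<ge> 1" using B unfolding x_def y_def by simp_all
    have Rr: "real R > 0" "real R = 2 * real r" using R by (auto simp: R_def)
    have fx: "x / real R \<le> frac (f i)" using b_bounds(1)[of i] Rr by (simp add: x_def field_simps)
    have yR: "y = real R - 1 - x" using b_lt[of i] B by (simp add: x_def y_def of_nat_diff)
    have fy: "y / real R \<le> 1 - frac (f i)"
      using b_bounds(2)[of i] Rr(1) unfolding yR by (simp add: x_def field_simps)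
    have nd: "min (x / real R) (y / real R) \<le> nd (f i)" unfolding nd_def using fx fy by linarith
    define z where "z = min x y"
    have z: "z \<ge> 1" "z / real R \<le> nd (f i)"
      using xy nd Rr(1) unfolding z_def min_divide_distrib_right by simp_all
    have "g i \<le> real r / z"
    proof (cases "g i \<le> 0")
      case True
      have "0 \<le> real r / z" using z by simp
      thus ?thesis using True by linarith
    next
      case False
      have "g i * (2 * (z / real R)) \<le> g i * (2 * nd (f i))" using False z by (intro mult_left_mono) auto
      hence "g i * (2 * (z / real R)) \<le> 1" using g(2)[OF i] by linarith
      thus ?thesis using z Rr by (simp add: field_simps)
    qed
    also have "real r / z \<le> real r * inverse x + real r * inverse y"
      using xy by (auto simp: z_def min_def divide_inverse)
    finally show ?thesis using M by (simp add: h_def x_def y_def)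
  qed
  have h0: "h c \<ge> 0" for c using M by (auto simp: h_def)
  have "sum g I \<le> sum (\<lambda>i. h (b i)) I" by (intro sum_mono gh)
  also have "\<dots> = sum h (b ` I)" using inj by (simp add: sum.reindex)
  also have "\<dots> \<le> sum h {..<R}" using h0 b_lt by (intro sum_mono2) auto
  also have "\<dots> = (\<Sum>c<R. if c = 0 \<or> c = R - 1 then M else 0) + real r * (\<Sum>c<R. inverse (real c)) + real r * (\<Sum>c<R. inverse (real (R - 1 - c)))"
    by (simp only: h_def sum.distrib sum_distrib_left)
  finally have le: "sum g I \<le> (\<Sum>c<R. if c = 0 \<or> c = R - 1 then M else 0) + real r * (\<Sum>c<R. inverse (real c)) + real r * (\<Sum>c<R. inverse (real (R - 1 - c)))" .
  have 1: "(\<Sum>c<R. if c = 0 \<or> c = R - 1 then M else 0) = 2 * M"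
  proof -
    have "(\<Sum>c<R. if c = 0 \<or> c = R - 1 then M else 0) = (\<Sum>c\<in>{0, R - 1}. M)"
      by (rule sum.mono_neutral_cong_right) (use R in auto)
    also have "\<dots> = 2 * M" using R by simp
    finally show ?thesis .
  qed
  have 2: "(\<Sum>c<R. inverse (real (R - 1 - c))) = (\<Sum>c<R. inverse (real c))"
    by (rule sum.reindex_bij_witness[of _ "\<lambda>c. R - 1 - c" "\<lambda>c. R - 1 - c"]) auto
  have "(\<Sum>c<R. inverse (real c)) = (\<Sum>c\<in>{1..<R}. inverse (real c))"
    by (rule sum.mono_neutral_right) (auto simp: not_less_eq_eq)
  also have "\<dots> \<le> harm R" unfolding harm_def by (intro sum_mono2) auto
  finally have "real r * (\<Sum>c<R. inverse (real c)) \<le> real r * harm R" by (rule mult_left_mono) simp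
  thus ?thesis using le unfolding 1 2 by (simp add: R_def)
qed

text \<open>As \<open>r\<close> does not divide \<open>b n\<close>, the fraction
  \<open>b n / r\<close> is at least \<open>1 / r\<close> away from every integer, and replacing it
  by \<open>\<beta> n\<close> moves it by at most half of that.\<close>

lemma nd_multiple_ge:
  assumes "coprime b r" "r \<ge> (1::int)" "\<bar>\<beta> - of_int b / of_int r\<bar> \<le> 1 / (of_int r)\<^sup>2"
    and n: "0 < \<bar>n\<bar>" "2 * \<bar>n\<bar> \<le> r"
  shows "nd (\<beta> * of_int n) \<ge> 1 / (2 * of_int r)"
proof (rule nd_ge)
  fix z :: int
  have "\<not> r dvd b * n"
  proof
    assume "r dvd b * n"
    hence "r dvd n" using assms(1) by (metis coprime_commute coprime_dvd_mult_right_iff)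
    hence "r \<le> \<bar>n\<bar>" using n(1) by (metis dvd_imp_le_int abs_of_nonneg assms(2) zero_less_abs_iff order.trans zero_le_one)
    thus False using n assms(2) by linarith
  qed
  hence "b * n - z * r \<noteq> 0" by (metis dvd_triv_right eq_iff_diff_eq_0)
  hence "\<bar>b * n - z * r\<bar> \<ge> 1" by linarith
  hence "1 \<le> \<bar>of_int (b * n - z * r) :: real\<bar>" by (metis of_int_1_le_iff of_int_abs)
  hence 1: "1 / of_int r \<le> \<bar>of_int b / of_int r * of_int n - (of_int z :: real)\<bar>"
    using assms(2) by (simp add: field_simps abs_div)
  have "\<bar>(\<beta> - of_int b / of_int r) * of_int n\<bar> \<le> 1 / (of_int r)\<^sup>2 * (of_int r / 2)"
    unfolding abs_mult using assms(3) n(2) by (intro mult_mono) auto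
  also have "\<dots> = 1 / (2 * of_int r)" using assms(2) by (simp add: power2_eq_square)
  finally have 2: "\<bar>\<beta> * of_int n - of_int b / of_int r * of_int n\<bar> \<le> 1 / (2 * of_int r)"
    by (simp add: left_diff_distrib)
  have "1 / of_int r = 1 / (2 * of_int r) + 1 / (2 * of_int r :: real)" using assms(2) by (simp add: field_simps)
  thus "1 / (2 * of_int r) \<le> \<bar>\<beta> * of_int n - of_int z\<bar>" using 1 2 by linarith
qed

text \<open>Within a block of about \<open>r / (2 D)\<close> consecutive \<open>y\<close> the points
  are spaced by \<open>nd_multiple_ge\<close>, so each block costs one
  \<open>spaced_sum\<close>.\<close>

lemma reciprocal_distance_sum:
  fixes g :: "nat \<Rightarrow> real"
  assumes "coprime b (int r)" "r \<ge> 1" "\<bar>\<beta> - of_int b / real r\<bar> \<le> 1 / (real r)\<^sup>2" "D \<ge> 1" "M \<ge> 0"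
    and g: "\<And>y. y < N \<Longrightarrow> g y \<le> M" "\<And>y. y < N \<Longrightarrow> g y * (2 * nd (\<beta> * real D * real y + c)) \<le> 1"
  shows "(\<Sum>y<N. g y) \<le> (4 * real D * real N / real r + 1) * (2 * M + 2 * real r * harm (2 * r))"
proof -
  \<comment> \<open>The maximum covers \<open>r < 2 D\<close>, where the blocks are single points
    and there is nothing to space.\<close>
  define L where "L = max 1 (r div (2 * D))"
  have L: "L \<ge> 1" by (simp add: L_def)
  have L2: "real r \<le> 4 * real D * real L"
  proof (cases "r < 2 * D")
    case True
    hence "real r \<le> 4 * real D" by linarith
    moreover have "4 * real D * 1 \<le> 4 * real D * real L" using L by (intro mult_left_mono) auto
    ultimately show ?thesis by linarith
  next
    case False
    have "r < 2 * D * (r div (2 * D) + 1)" using assms(4) by (simp add: dividend_less_times_div)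
    moreover have "1 \<le> r div (2 * D)" using False assms(4) by (simp add: div_greater_zero_iff Suc_le_eq)
    hence "2 * D * (r div (2 * D) + 1) \<le> 2 * D * (2 * (r div (2 * D)))" by (intro mult_le_mono2) linarith
    ultimately have "r \<le> 2 * D * (2 * (r div (2 * D)))" by (rule less_imp_le[OF less_le_trans])
    also have "\<dots> = 4 * D * (r div (2 * D))" by simp
    also have "\<dots> \<le> 4 * D * L" by (intro mult_le_mono2) (simp add: L_def)
    finally show ?thesis by (metis of_nat_le_iff of_nat_mult of_nat_numeral)
  qed
  define K where "K = 2 * M + 2 * real r * harm (2 * r)"
  have K0: "K \<ge> 0" using assms(5) by (simp add: K_def harm_nonneg)
  have block: "sum g {y \<in> {..<N}. y div L = q} \<le> K" for q
    unfolding K_def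
  proof (rule spaced_sum[where f = "\<lambda>y. \<beta> * real D * real y + c"])
    fix i j assume i: "i \<in> {y \<in> {..<N}. y div L = q}" and j: "j \<in> {y \<in> {..<N}. y div L = q}" and ne: "i \<noteq> j"
    have lt: "\<bar>int i - int j\<bar> < int L"
    proof -
      have "i = q * L + i mod L" "j = q * L + j mod L"
        using i j div_mult_mod_eq[of i L] div_mult_mod_eq[of j L] by auto
      moreover have "i mod L < L" "j mod L < L" using L by auto
      ultimately show ?thesis by linarith
    qed
    hence "L \<noteq> 1" using ne by auto
    hence Ld: "L = r div (2 * D)" by (auto simp: L_def max_def split: if_splits)
    define n where "n = int D * (int i - int j)"
    have "2 * \<bar>n\<bar> = 2 * int D * \<bar>int i - int j\<bar>" by (simp add: n_def abs_mult)
    also have "\<dots> \<le> 2 * int D * int L" using lt by (intro mult_left_mono) auto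
    also have "\<dots> = int (2 * D * (r div (2 * D)))" by (simp add: Ld)
    also have "\<dots> \<le> int r" by (simp only: of_nat_le_iff times_div_less_eq_dividend)
    finally have "nd (\<beta> * of_int n) \<ge> 1 / (2 * of_int (int r))"
      using assms ne by (intro nd_multiple_ge[where b = b]) (auto simp: n_def)
    moreover have "\<beta> * of_int n = (\<beta> * real D * real i + c) - (\<beta> * real D * real j + c)"
      by (simp add: n_def algebra_simps)
    ultimately show "nd ((\<beta> * real D * real i + c) - (\<beta> * real D * real j + c)) \<ge> 1 / (2 * real r)" by simp
  qed (use assms g in auto)
  have "(\<Sum>y<N. g y) = (\<Sum>q<N div L + 1. sum g {y \<in> {..<N}. y div L = q})"
    using div_le_mono[OF less_imp_le] by (intro sum.group[symmetric]) (auto simp: less_Suc_eq_le)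
  also have "\<dots> \<le> (\<Sum>q<N div L + 1. K)" by (intro sum_mono block)
  also have "\<dots> = (real (N div L) + 1) * K" by simp
  also have "\<dots> \<le> (4 * real D * real N / real r + 1) * K"
  proof (intro mult_right_mono add_right_mono K0)
    have "real (N div L) \<le> real N / real L" by (rule of_nat_div_le_of_nat)
    also have "\<dots> \<le> 4 * real D * real N / real r"
    proof -
      have "real N * real r \<le> real N * (4 * real D * real L)" by (intro mult_left_mono L2) auto
      thus ?thesis using L assms(2) by (simp add: field_simps)
    qed
    finally show "real (N div L) \<le> 4 * real D * real N / real r" .
  qed
  finally show ?thesis by (simp add: K_def)
qed

lemma harm_le: "n \<ge> 1 \<Longrightarrow> harm n \<le> 1 + ln (real n)"
proof -
  assume "n \<ge> 1"
  then obtain m where m: "n = Suc m" by (cases n) auto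
  have "harm (Suc m) - ln (real (Suc m)) \<le> harm (Suc 0) - ln (real (Suc 0))"
    using decseqD[OF decseq_harm_diff_ln, of 0 m] by simp
  moreover have "harm (Suc 0) = (1 :: real)" by (simp add: harm_def)
  ultimately show ?thesis unfolding m by simp
qed

text \<open>Duality and Schur's test: the left-hand side \<open>S\<close> is a linear form in
  \<open>r\<close> whose dual vector \<open>H\<close> has square norm at most \<open>S B\<close>,
  because the kernel is symmetric in modulus with row sums at most \<open>B\<close>. Cauchy-Schwarz
  then bounds the square of \<open>S\<close>, and one factor \<open>S\<close> cancels.\<close>

lemma large_sieve:
  fixes e :: "'y \<Rightarrow> 'v \<Rightarrow> complex" and r :: "'v \<Rightarrow> complex"
  assumes "finite Y" "finite V" "B \<ge> 0"
    and B: "\<And>y. y \<in> Y \<Longrightarrow> (\<Sum>y'\<in>Y. cmod (\<Sum>v\<in>V. e y v * cnj (e y' v))) \<le> B"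
  shows "(\<Sum>y\<in>Y. (cmod (\<Sum>v\<in>V. r v * e y v))\<^sup>2) \<le> (\<Sum>v\<in>V. (cmod (r v))\<^sup>2) * B"
proof -
  define G where "G = (\<lambda>y. \<Sum>v\<in>V. r v * e y v)"
  define S where "S = (\<Sum>y\<in>Y. (cmod (G y))\<^sup>2)"
  define H where "H = (\<lambda>v. \<Sum>y\<in>Y. cnj (G y) * e y v)"
  have S0: "S \<ge> 0" unfolding S_def by (intro sum_nonneg) auto
  have norm_eq: "s = cmod z" if "complex_of_real s = z" "s \<ge> 0" for s z
    using that by (metis norm_of_real abs_of_nonneg)
  have "complex_of_real S = (\<Sum>y\<in>Y. G y * cnj (G y))"
    by (simp only: S_def of_real_sum complex_norm_square)
  also have "\<dots> = (\<Sum>y\<in>Y. \<Sum>v\<in>V. r v * (cnj (G y) * e y v))"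
  proof (rule sum.cong[OF refl])
    fix y
    have "G y * cnj (G y) = (\<Sum>v\<in>V. r v * e y v) * cnj (G y)" by (simp only: G_def)
    also have "\<dots> = (\<Sum>v\<in>V. (r v * e y v) * cnj (G y))" by (rule sum_distrib_right)
    finally show "G y * cnj (G y) = (\<Sum>v\<in>V. r v * (cnj (G y) * e y v))"
      by (simp only: mult_ac)
  qed
  also have "\<dots> = (\<Sum>v\<in>V. r v * H v)"
    by (subst sum.swap) (simp add: H_def sum_distrib_left)
  finally have "S = cmod (\<Sum>v\<in>V. r v * H v)" using S0 by (rule norm_eq)
  also have "\<dots> \<le> (\<Sum>v\<in>V. cmod (r v) * cmod (H v))"
    by (rule order_trans[OF norm_sum]) (simp add: norm_mult)
  finally have "S\<^sup>2 \<le> (\<Sum>v\<in>V. cmod (r v) * cmod (H v))\<^sup>2" using S0 by (intro power_mono) auto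
  also have "\<dots> \<le> (\<Sum>v\<in>V. (cmod (r v))\<^sup>2) * (\<Sum>v\<in>V. (cmod (H v))\<^sup>2)"
    by (rule Cauchy_Schwarz_ineq_sum)
  finally have S2: "S\<^sup>2 \<le> (\<Sum>v\<in>V. (cmod (r v))\<^sup>2) * (\<Sum>v\<in>V. (cmod (H v))\<^sup>2)" .
  define k where "k = (\<lambda>y y'. cmod (\<Sum>v\<in>V. e y v * cnj (e y' v)))"
  have ksym: "k y y' = k y' y" for y y'
  proof -
    have "(\<Sum>v\<in>V. e y' v * cnj (e y v)) = cnj (\<Sum>v\<in>V. e y v * cnj (e y' v))"
      by (simp add: mult.commute)
    thus ?thesis unfolding k_def by (metis complex_mod_cnj)
  qed
  have "complex_of_real (\<Sum>v\<in>V. (cmod (H v))\<^sup>2) = (\<Sum>v\<in>V. H v * cnj (H v))"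
    by (simp only: of_real_sum complex_norm_square)
  also have "\<dots> = (\<Sum>v\<in>V. \<Sum>y\<in>Y. \<Sum>y'\<in>Y. cnj (G y) * G y' * (e y v * cnj (e y' v)))"
    unfolding H_def cnj_sum sum_product by (intro sum.cong refl) (simp add: mult_ac)
  also have "\<dots> = (\<Sum>y\<in>Y. \<Sum>y'\<in>Y. cnj (G y) * G y' * (\<Sum>v\<in>V. e y v * cnj (e y' v)))"
    by (subst sum.swap, intro sum.cong refl, subst sum.swap) (simp add: sum_distrib_left)
  finally have "(\<Sum>v\<in>V. (cmod (H v))\<^sup>2) = cmod (\<Sum>y\<in>Y. \<Sum>y'\<in>Y. cnj (G y) * G y' * (\<Sum>v\<in>V. e y v * cnj (e y' v)))"
    by (rule norm_eq) (intro sum_nonneg, simp)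
  also have "\<dots> \<le> (\<Sum>y\<in>Y. \<Sum>y'\<in>Y. cmod (G y) * cmod (G y') * k y y')"
    by (rule order_trans[OF norm_sum], rule sum_mono, rule order_trans[OF norm_sum], rule sum_mono) (simp add: norm_mult k_def)
  also have "\<dots> \<le> (\<Sum>y\<in>Y. \<Sum>y'\<in>Y. ((cmod (G y))\<^sup>2 / 2 + (cmod (G y'))\<^sup>2 / 2) * k y y')"
  proof (intro sum_mono mult_right_mono)
    fix y y'
    show "cmod (G y) * cmod (G y') \<le> (cmod (G y))\<^sup>2 / 2 + (cmod (G y'))\<^sup>2 / 2"
      using sum_squares_bound[of "cmod (G y)" "cmod (G y')"] by simp
  qed (simp add: k_def)
  also have "\<dots> = (\<Sum>y\<in>Y. \<Sum>y'\<in>Y. (cmod (G y))\<^sup>2 / 2 * k y y') + (\<Sum>y\<in>Y. \<Sum>y'\<in>Y. (cmod (G y'))\<^sup>2 / 2 * k y y')"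
    by (simp add: distrib_right sum.distrib)
  also have "(\<Sum>y\<in>Y. \<Sum>y'\<in>Y. (cmod (G y'))\<^sup>2 / 2 * k y y') = (\<Sum>y\<in>Y. \<Sum>y'\<in>Y. (cmod (G y))\<^sup>2 / 2 * k y y')"
    by (subst sum.swap) (simp add: ksym)
  also have "(\<Sum>y\<in>Y. \<Sum>y'\<in>Y. (cmod (G y))\<^sup>2 / 2 * k y y') + (\<Sum>y\<in>Y. \<Sum>y'\<in>Y. (cmod (G y))\<^sup>2 / 2 * k y y') =
      (\<Sum>y\<in>Y. (cmod (G y))\<^sup>2 * (\<Sum>y'\<in>Y. k y y'))"
    unfolding sum.distrib[symmetric] sum_distrib_left by (intro sum.cong refl) simp
  also have "\<dots> \<le> (\<Sum>y\<in>Y. (cmod (G y))\<^sup>2 * B)"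
    using B by (intro sum_mono mult_left_mono) (auto simp: k_def)
  also have "\<dots> = S * B" by (simp add: S_def sum_distrib_right)
  finally have "S\<^sup>2 \<le> (\<Sum>v\<in>V. (cmod (r v))\<^sup>2) * (S * B)"
    using S2 by (meson mult_left_mono order_trans sum_nonneg zero_le_power2)
  hence *: "S * S \<le> ((\<Sum>v\<in>V. (cmod (r v))\<^sup>2) * B) * S" by (simp add: power2_eq_square mult_ac)
  have "S \<le> (\<Sum>v\<in>V. (cmod (r v))\<^sup>2) * B"
  proof (cases "S = 0")
    case True
    thus ?thesis using assms(3) by (auto intro!: mult_nonneg_nonneg sum_nonneg)
  next
    case False
    thus ?thesis using * S0 by (simp add: mult_le_cancel_right)
  qed
  thus ?thesis by (simp add: S_def G_def)
qed

lemma dvd_abs_less: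
  fixes x Q :: int
  assumes "Q dvd x" "\<bar>x\<bar> < Q"
  shows "x = 0"
  using dvd_imp_le_int[of x Q] assms by linarith

section \<open>Power sums and Vinogradov's system\<close>

definition pows :: "nat \<Rightarrow> (nat \<Rightarrow> int) \<Rightarrow> nat \<Rightarrow> int" where
  "pows s t j = (\<Sum>i<s. t i ^ j)"

definition tups :: "nat \<Rightarrow> nat \<Rightarrow> (nat \<Rightarrow> int) set" where
  "tups s N = PiE {..<s} (\<lambda>_. {- int N..int N})"

text \<open>The number of solutions of Vinogradov's system in \<open>2 s\<close> variables, over a
  symmetric interval that contains all shifted ranges of summation.\<close>

definition energy :: "nat \<Rightarrow> nat \<Rightarrow> nat \<Rightarrow> nat" where
  "energy k s N = card {(t, t'). t \<in> tups s N \<and> t' \<in> tups s N \<and> (\<forall>j\<in>{1..k}. pows s t j = pows s t' j)}"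

lemma finite_tups [simp]: "finite (tups s N)"
  by (simp add: tups_def finite_PiE)

lemma energy_eq: "real (energy k s N) =
  (\<Sum>t\<in>tups s N. \<Sum>t'\<in>tups s N. if \<forall>j\<in>{1..k}. pows s t j = pows s t' j then 1 else 0)"
proof -
  have "{(t, t'). t \<in> tups s N \<and> t' \<in> tups s N \<and> (\<forall>j\<in>{1..k}. pows s t j = pows s t' j)} =
    (SIGMA t:tups s N. {t' \<in> tups s N. \<forall>j\<in>{1..k}. pows s t j = pows s t' j})" by auto
  hence "energy k s N = (\<Sum>t\<in>tups s N. card {t' \<in> tups s N. \<forall>j\<in>{1..k}. pows s t j = pows s t' j})"
    by (simp add: energy_def)
  thus ?thesis by (simp add: sum.If_cases Int_def)
qed

lemma exp_sum_power:
  assumes "finite A"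
  shows "(\<Sum>x\<in>A. w x * ee (\<Sum>j\<in>J. \<gamma> j * of_int (x ^ j))) ^ s =
    (\<Sum>t\<in>PiE {..<s} (\<lambda>_. A). (\<Prod>i<s. w (t i)) * ee (\<Sum>j\<in>J. \<gamma> j * of_int (pows s t j)))"
proof -
  have "(\<Sum>x\<in>A. w x * ee (\<Sum>j\<in>J. \<gamma> j * of_int (x ^ j))) ^ s =
    (\<Prod>i\<in>{..<s}. \<Sum>x\<in>A. w x * ee (\<Sum>j\<in>J. \<gamma> j * of_int (x ^ j)))" by simp
  also have "\<dots> = (\<Sum>t\<in>PiE {..<s} (\<lambda>_. A). \<Prod>i<s. w (t i) * ee (\<Sum>j\<in>J. \<gamma> j * of_int (t i ^ j)))"
    by (rule prod_sum_PiE) (use assms in auto)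
  also have "\<dots> = (\<Sum>t\<in>PiE {..<s} (\<lambda>_. A). (\<Prod>i<s. w (t i)) * ee (\<Sum>j\<in>J. \<gamma> j * of_int (pows s t j)))"
  proof (rule sum.cong[OF refl])
    fix t
    have "(\<Sum>i<s. \<Sum>j\<in>J. \<gamma> j * of_int (t i ^ j)) = (\<Sum>j\<in>J. \<gamma> j * of_int (pows s t j))"
      by (subst sum.swap) (simp add: pows_def sum_distrib_left)
    hence "(\<Prod>i<s. ee (\<Sum>j\<in>J. \<gamma> j * of_int (t i ^ j))) = ee (\<Sum>j\<in>J. \<gamma> j * of_int (pows s t j))"
      by (simp only: ee_sum[symmetric])
    thus "(\<Prod>i<s. w (t i) * ee (\<Sum>j\<in>J. \<gamma> j * of_int (t i ^ j))) = (\<Prod>i<s. w (t i)) * ee (\<Sum>j\<in>J. \<gamma> j * of_int (pows s t j))"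
      by (simp only: prod.distrib)
  qed
  finally show ?thesis .
qed

text \<open>By orthogonality the average counts the solutions of the system modulo \<open>Q\<close>,
  and the true solutions are among them; the equation of the constant coefficient reads
  \<open>s = s\<close>.\<close>

lemma energy_le_av:
  assumes "Q > 0" "k * (k + 1) = 2 * s"
  shows "real (energy k s N) \<le> av k Q (\<lambda>\<alpha>. cmod (F k Q {- int N..int N} (\<lambda>_. 1) \<alpha>) ^ (k * (k + 1)))"
proof -
  have "F k Q {- int N..int N} (\<lambda>_. 1) \<alpha> ^ s = (\<Sum>t\<in>tups s N. 1 * ee (of_int (\<Sum>j\<le>k. \<alpha> j * pows s t j) / of_int Q))" for \<alpha>
  proof -
    have "F k Q {- int N..int N} (\<lambda>_. 1) \<alpha> = (\<Sum>x\<in>{- int N..int N}. 1 * ee (\<Sum>j\<in>{..k}. of_int (\<alpha> j) / of_int Q * of_int (x ^ j)))"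
      by (simp add: F_def lin_def sum_divide_distrib)
    also have "\<dots> ^ s = (\<Sum>t\<in>tups s N. (\<Prod>i<s. 1) * ee (\<Sum>j\<in>{..k}. of_int (\<alpha> j) / of_int Q * of_int (pows s t j)))"
      unfolding tups_def by (rule exp_sum_power) simp
    finally show ?thesis by (simp add: sum_divide_distrib)
  qed
  hence sq: "cmod (F k Q {- int N..int N} (\<lambda>_. 1) \<alpha>) ^ (k * (k + 1)) =
     (cmod (\<Sum>t\<in>tups s N. 1 * ee (of_int (\<Sum>j\<le>k. \<alpha> j * pows s t j) / of_int Q)))\<^sup>2" for \<alpha>
    unfolding assms(2) mult.commute[of 2] power_mult norm_power[symmetric] by metis
  have "complex_of_real (av k Q (\<lambda>\<alpha>. cmod (F k Q {- int N..int N} (\<lambda>_. 1) \<alpha>) ^ (k * (k + 1)))) =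
     (\<Sum>t\<in>tups s N. \<Sum>t'\<in>tups s N. 1 * cnj 1 * (if \<forall>j\<le>k. Q dvd pows s t j - pows s t' j then 1 else 0))"
    unfolding sq by (rule av_norm_square) (use assms in auto)
  also have "\<dots> = complex_of_real (\<Sum>t\<in>tups s N. \<Sum>t'\<in>tups s N. (if \<forall>j\<le>k. Q dvd pows s t j - pows s t' j then 1 else 0))"
    unfolding of_real_sum by (intro sum.cong refl) auto
  finally have "av k Q (\<lambda>\<alpha>. cmod (F k Q {- int N..int N} (\<lambda>_. 1) \<alpha>) ^ (k * (k + 1))) =
     (\<Sum>t\<in>tups s N. \<Sum>t'\<in>tups s N. (if \<forall>j\<le>k. Q dvd pows s t j - pows s t' j then 1 else 0))"
    by (simp only: of_real_eq_iff)
  moreover have "\<forall>j\<le>k. Q dvd pows s t j - pows s t' j" if "\<forall>j\<in>{1..k}. pows s t j = pows s t' j" for t t'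
  proof (intro allI impI)
    fix j assume "j \<le> k"
    thus "Q dvd pows s t j - pows s t' j" using that by (cases "j = 0") (auto simp: pows_def)
  qed
  ultimately show ?thesis unfolding energy_eq by (auto intro!: sum_mono)
qed

text \<open>Take the least \<open>m\<close> with \<open>p ^ m \<ge> 2 N + 1\<close>: the points are
  then distinct modulo \<open>p ^ m\<close>, and \<open>p ^ m\<close> exceeds \<open>N\<close> by at
  most the constant factor \<open>3 p\<close>.\<close>

theorem energy_bound:
  assumes k: "k \<ge> 1" and \<epsilon>: "\<epsilon> > 0" and s: "k * (k + 1) = 2 * s"
  shows "\<exists>C\<ge>1. \<forall>N\<ge>1. real (energy k s N) \<le> C * real N powr (real s + \<epsilon>)"
proof -
  \<comment> \<open>The prime depends on \<open>k\<close> alone, so the powers of it in the constant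
    depend on \<open>k\<close> and \<epsilon> only.\<close>
  obtain q :: nat where q: "prime q" "q > max 8 k" using bigger_prime by blast
  define p where "p = int q"
  interpret prime_base p
    by unfold_locales (use q in \<open>auto simp: p_def\<close>)
  have kp: "int k < p" using q by (simp add: p_def)
  obtain C where C: "C \<ge> 1" and mv: "\<And>m A c. finite A \<Longrightarrow> (\<forall>x\<in>A. \<forall>y\<in>A. [x = y] (mod p ^ m) \<longrightarrow> x = y) \<Longrightarrow> (\<forall>x. cmod (c x) \<le> 1) \<Longrightarrow>
    av k (p ^ (k * m)) (\<lambda>\<alpha>. cmod (F k (p ^ (k * m)) A c \<alpha>) ^ (k * (k + 1))) \<le> C * rp powr (real m * (real (k * (k + 1) div 2) + \<epsilon>))"
    using mean_value_estimate[OF k kp \<epsilon>] by blast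
  have s2: "k * (k + 1) div 2 = s" using s by simp
  define D where "D = (3 * rp) powr (real s + \<epsilon>)"
  have D: "D \<ge> 1" unfolding D_def using p_ge \<epsilon> by (intro ge_one_powr_ge_zero) auto
  show ?thesis
  proof (intro exI[of _ "C * D"] conjI allI impI)
    show "C * D \<ge> 1" using C D mult_mono[of 1 C 1 D] by simp
    fix N :: nat assume N: "N \<ge> 1"
    define m where "m = (LEAST m. 2 * int N + 1 \<le> p ^ m)"
    have ex: "2 * int N + 1 \<le> p ^ (2 * N + 1)"
    proof -
      have "2 * N + 1 < 2 ^ (2 * N + 1)" by (rule less_exp)
      hence "int (2 * N + 1) < int (2 ^ (2 * N + 1))" by (simp only: of_nat_less_iff)
      hence "2 * int N + 1 \<le> 2 ^ (2 * N + 1)" by simp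
      also have "\<dots> \<le> p ^ (2 * N + 1)" using p_ge by (intro power_mono) auto
      finally show ?thesis .
    qed
    have m1: "2 * int N + 1 \<le> p ^ m" unfolding m_def by (rule LeastI[of _ "2 * N + 1"]) (rule ex)
    have "m \<noteq> 0" using m1 N by (intro notI) simp
    then obtain m' where m': "m = Suc m'" by (cases m) auto
    have "\<not> 2 * int N + 1 \<le> p ^ m'" by (rule not_less_Least) (simp add: m_def[symmetric] m')
    hence m2: "p ^ m \<le> p * (3 * int N)" unfolding m' using N by (simp add: mult_left_mono)
    have inj: "\<forall>x\<in>{- int N..int N}. \<forall>y\<in>{- int N..int N}. [x = y] (mod p ^ m) \<longrightarrow> x = y"
    proof (intro ballI impI)
      fix x y assume xy: "x \<in> {- int N..int N}" "y \<in> {- int N..int N}" "[x = y] (mod p ^ m)"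
      hence "p ^ m dvd x - y" by (simp add: cong_iff_dvd_diff)
      moreover have "\<bar>x - y\<bar> < p ^ m" using xy m1 by auto
      ultimately show "x = y" using dvd_abs_less[of "p ^ m" "x - y"] by simp
    qed
    have "real (energy k s N) \<le> av k (p ^ (k * m)) (\<lambda>\<alpha>. cmod (F k (p ^ (k * m)) {- int N..int N} (\<lambda>_. 1) \<alpha>) ^ (k * (k + 1)))"
      by (rule energy_le_av) (use s in auto)
    also have "\<dots> \<le> C * rp powr (real m * (real s + \<epsilon>))"
      using mv[OF _ inj, of "\<lambda>_. 1"] unfolding s2 by simp
    also have "rp powr (real m * (real s + \<epsilon>)) = (rp ^ m) powr (real s + \<epsilon>)"
      by (simp add: powr_powr flip: powr_realpow)
    also have "\<dots> \<le> (3 * rp * real N) powr (real s + \<epsilon>)"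
    proof (intro powr_mono2)
      have "real_of_int (p ^ m) \<le> real_of_int (p * (3 * int N))" using m2 by (simp only: of_int_le_iff)
      thus "rp ^ m \<le> 3 * rp * real N" by (simp add: mult_ac)
    qed (use \<epsilon> in auto)
    also have "\<dots> = D * real N powr (real s + \<epsilon>)"
      by (simp add: D_def powr_mult)
    finally show "real (energy k s N) \<le> C * D * real N powr (real s + \<epsilon>)"
      using C by (simp add: mult.assoc)
  qed
qed

text \<open>
  Large sieve in the coefficient of degree \<open>k\<close> only: \<open>2 s N ^ j + 1\<close> values of the \<open>j\<close>-th power sum
  enter trivially for \<open>j < k\<close>.
\<close>

lemma shifted_moment:
  fixes \<gamma> :: "nat \<Rightarrow> nat \<Rightarrow> real" and w :: "int \<Rightarrow> complex"
  assumes k: "k \<ge> 1" and N: "N \<ge> 1" and w: "\<And>n. cmod (w n) \<le> 1" and B: "B \<ge> 0"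
    and kernel: "\<And>y. y < N \<Longrightarrow> (\<Sum>y'<N. cmod (\<Sum>v\<in>{- int (s * N ^ k)..int (s * N ^ k)}. ee ((\<gamma> y k - \<gamma> y' k) * of_int v))) \<le> B"
  shows "(\<Sum>y<N. cmod (\<Sum>n\<in>{- int N..int N}. w n * ee (\<Sum>j\<in>{1..k}. \<gamma> y j * of_int (n ^ j))) ^ (2 * s))
    \<le> real (energy k s N) * ((\<Prod>j\<in>{1..<k}. 2 * real s * real N ^ j + 1) * B)"
proof -
  define X where "X = (\<lambda>j. int (s * N ^ j))"
  define V where "V = PiE {1..k} (\<lambda>j. {- X j..X j})"
  define vec where "vec = (\<lambda>t. restrict (pows s t) {1..k})"
  define W where "W = (\<lambda>t. \<Prod>i<s. w (t i))"
  \<comment> \<open>Grouping the tuples by their vectors of power sums writes the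
    \<open>s\<close>-th power of the sum as a linear form in the characters \<open>e y\<close>, with
    coefficients of square norm at most the energy.\<close>
  define r where "r = (\<lambda>v. \<Sum>t\<in>{t \<in> tups s N. vec t = v}. W t)"
  define e where "e = (\<lambda>y v. ee (\<Sum>j\<in>{1..k}. \<gamma> y j * of_int (v j)))"
  define G where "G = (\<lambda>y. \<Sum>n\<in>{- int N..int N}. w n * ee (\<Sum>j\<in>{1..k}. \<gamma> y j * of_int (n ^ j)))"
  have finV: "finite V" unfolding V_def by (intro finite_PiE) auto
  have vecV: "vec ` tups s N \<subseteq> V"
  proof
    fix v assume "v \<in> vec ` tups s N"
    then obtain t where t: "t \<in> tups s N" "v = vec t" by auto
    have "\<bar>pows s t j\<bar> \<le> X j" for j
    proof -
      have "\<bar>pows s t j\<bar> \<le> (\<Sum>i<s. \<bar>t i ^ j\<bar>)" unfolding pows_def by (rule sum_abs)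
      also have "\<dots> \<le> (\<Sum>i<s. int N ^ j)"
      proof (rule sum_mono)
        fix i assume "i \<in> {..<s}"
        hence "\<bar>t i\<bar> \<le> int N" using t(1) by (auto simp: tups_def PiE_def Pi_def abs_le_iff)
        thus "\<bar>t i ^ j\<bar> \<le> int N ^ j" by (simp add: power_abs power_mono)
      qed
      finally show ?thesis by (simp add: X_def)
    qed
    thus "v \<in> V" by (auto simp: t(2) V_def vec_def abs_le_iff) (metis minus_le_iff)+
  qed
  have Gs: "G y ^ s = (\<Sum>v\<in>V. r v * e y v)" for y
  proof -
    have "G y ^ s = (\<Sum>t\<in>tups s N. W t * ee (\<Sum>j\<in>{1..k}. \<gamma> y j * of_int (pows s t j)))"
      unfolding G_def W_def tups_def by (rule exp_sum_power) simp
    also have "\<dots> = (\<Sum>t\<in>tups s N. W t * e y (vec t))"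
      by (intro sum.cong refl) (simp add: e_def vec_def)
    also have "\<dots> = (\<Sum>v\<in>V. \<Sum>t\<in>{t \<in> tups s N. vec t = v}. W t * e y (vec t))"
      by (rule sum.group[symmetric]) (use finV vecV in auto)
    also have "\<dots> = (\<Sum>v\<in>V. r v * e y v)"
      unfolding r_def sum_distrib_right by (intro sum.cong refl) auto
    finally show ?thesis .
  qed
  have Wle: "cmod (W t) \<le> 1" for t
    unfolding W_def prod_norm[symmetric] by (intro prod_le_1) (use w in auto)
  have rE: "(\<Sum>v\<in>V. (cmod (r v))\<^sup>2) \<le> real (energy k s N)"
  proof -
    define c where "c = (\<lambda>v. real (card {t \<in> tups s N. vec t = v}))"
    have "cmod (r v) \<le> c v" for v
    proof -
      have "cmod (r v) \<le> (\<Sum>t\<in>{t \<in> tups s N. vec t = v}. cmod (W t))" unfolding r_def by (rule norm_sum)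
      also have "\<dots> \<le> (\<Sum>t\<in>{t \<in> tups s N. vec t = v}. 1)" by (intro sum_mono Wle)
      finally show ?thesis by (simp add: c_def)
    qed
    hence "(\<Sum>v\<in>V. (cmod (r v))\<^sup>2) \<le> (\<Sum>v\<in>V. c v * c v)"
      unfolding power2_eq_square by (intro sum_mono mult_mono) (auto simp: c_def)
    also have "\<dots> = (\<Sum>v\<in>V. \<Sum>t\<in>{t \<in> tups s N. vec t = v}. c (vec t))"
      by (intro sum.cong refl) (simp add: c_def)
    also have "\<dots> = (\<Sum>t\<in>tups s N. c (vec t))"
      by (rule sum.group) (use finV vecV in auto)
    also have "\<dots> = real (energy k s N)"
      unfolding energy_eq
    proof (rule sum.cong[OF refl])
      fix t
      have "vec t' = vec t \<longleftrightarrow> (\<forall>j\<in>{1..k}. pows s t j = pows s t' j)" for t'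
        by (auto simp: vec_def fun_eq_iff restrict_def)
      thus "c (vec t) = (\<Sum>t'\<in>tups s N. if \<forall>j\<in>{1..k}. pows s t j = pows s t' j then 1 else 0)"
        by (simp add: c_def sum.If_cases Int_def)
    qed
    finally show ?thesis .
  qed
  define Pr where "Pr = (\<Prod>j\<in>{1..<k}. 2 * real s * real N ^ j + 1)"
  have Pr: "Pr \<ge> 0" unfolding Pr_def by (intro prod_nonneg) auto
  have ker: "(\<Sum>y'<N. cmod (\<Sum>v\<in>V. e y v * cnj (e y' v))) \<le> Pr * B" if y: "y < N" for y
  proof -
    have "cmod (\<Sum>v\<in>V. e y v * cnj (e y' v)) \<le> Pr * cmod (\<Sum>v\<in>{- int (s * N ^ k)..int (s * N ^ k)}. ee ((\<gamma> y k - \<gamma> y' k) * of_int v))" for y'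
    proof -
      define K where "K = (\<lambda>j. \<Sum>v\<in>{- X j..X j}. ee ((\<gamma> y j - \<gamma> y' j) * of_int v))"
      have "(\<Sum>v\<in>V. e y v * cnj (e y' v)) = (\<Sum>v\<in>V. \<Prod>j\<in>{1..k}. ee ((\<gamma> y j - \<gamma> y' j) * of_int (v j)))"
        by (intro sum.cong refl) (simp add: e_def sum_subtractf left_diff_distrib flip: ee_diff ee_sum)
      also have "\<dots> = (\<Prod>j\<in>{1..k}. K j)"
        unfolding V_def K_def by (rule prod_sum_PiE[symmetric]) auto
      finally have "cmod (\<Sum>v\<in>V. e y v * cnj (e y' v)) = (\<Prod>j\<in>{1..k}. cmod (K j))"
        by (simp add: prod_norm)
      also have "{1..k} = insert k {1..<k}" using k by auto
      also have "(\<Prod>j\<in>insert k {1..<k}. cmod (K j)) = (\<Prod>j\<in>{1..<k}. cmod (K j)) * cmod (K k)"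
        by (simp add: mult.commute)
      also have "\<dots> \<le> Pr * cmod (K k)"
        unfolding Pr_def
      proof (intro mult_right_mono prod_mono conjI)
        fix j
        have "cmod (K j) \<le> (\<Sum>v\<in>{- X j..X j}. 1)" unfolding K_def by (rule order_trans[OF norm_sum]) simp
        also have "\<dots> = 2 * real s * real N ^ j + 1" by (simp add: X_def)
        finally show "cmod (K j) \<le> 2 * real s * real N ^ j + 1" .
      qed auto
      finally show ?thesis by (simp add: K_def X_def)
    qed
    hence "(\<Sum>y'<N. cmod (\<Sum>v\<in>V. e y v * cnj (e y' v))) \<le>
       Pr * (\<Sum>y'<N. cmod (\<Sum>v\<in>{- int (s * N ^ k)..int (s * N ^ k)}. ee ((\<gamma> y k - \<gamma> y' k) * of_int v)))"
      unfolding sum_distrib_left by (rule sum_mono)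
    also have "\<dots> \<le> Pr * B" by (intro mult_left_mono kernel y Pr)
    finally show ?thesis .
  qed
  have "(\<Sum>y<N. cmod (G y) ^ (2 * s)) = (\<Sum>y<N. (cmod (\<Sum>v\<in>V. r v * e y v))\<^sup>2)"
    unfolding Gs[symmetric] norm_power power_mult[symmetric] by (simp add: mult.commute)
  also have "\<dots> \<le> (\<Sum>v\<in>V. (cmod (r v))\<^sup>2) * (Pr * B)"
    by (rule large_sieve) (use finV ker Pr B in auto)
  also have "\<dots> \<le> real (energy k s N) * (Pr * B)"
    using Pr B by (intro mult_right_mono rE) auto
  finally show ?thesis by (simp only: G_def Pr_def)
qed

text \<open>Orthogonality modulo \<open>H\<close> detects the moving window: its points and those of
  the fixed range lie within \<open>N\<close> of 0, so they differ by less than \<open>H\<close> and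
  congruence is equality. A shift of the window changes the kernel only by a unimodular
  factor.\<close>

lemma completion:
  fixes a :: "int \<Rightarrow> complex"
  assumes N: "N \<ge> 1" and y: "y < N" and H: "H = 2 * int N + 1"
  shows "of_int H * cmod (\<Sum>m\<in>{1 - int y..int N - int y}. a m) \<le>
    (\<Sum>h\<in>{0..<H}. cmod (\<Sum>v\<in>{0..<0 + int N}. ee (- (of_int h / of_int H) * of_int v)) *
       cmod (\<Sum>m\<in>{- int N..int N}. a m * ee (of_int h / of_int H * of_int m)))"
proof -
  define W where "W = {1 - int y..int N - int y}"
  define A where "A = {- int N..int N}"
  have WA: "W \<subseteq> A" using y by (auto simp: W_def A_def)
  have H0: "H > 0" using H by simp
  define \<kappa> where "\<kappa> = (\<lambda>h. \<Sum>v\<in>W. ee (- (of_int h / of_int H) * of_int v))"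
  have norm\<kappa>: "cmod (\<kappa> h) = cmod (\<Sum>v\<in>{0..<0 + int N}. ee (- (of_int h / of_int H) * of_int v))" for h
  proof -
    have "\<kappa> h = (\<Sum>v\<in>{0..<0 + int N}. ee (- (of_int h / of_int H) * of_int (v + (1 - int y))))"
      unfolding \<kappa>_def W_def by (rule sum.reindex_bij_witness[of _ "\<lambda>v. v + (1 - int y)" "\<lambda>v. v - (1 - int y)"]) auto
    also have "\<dots> = (\<Sum>v\<in>{0..<0 + int N}. ee (- (of_int h / of_int H) * of_int v)) * ee (- (of_int h / of_int H) * of_int (1 - int y))"
      unfolding sum_distrib_right ee_add[symmetric] of_int_add distrib_left ..
    finally show ?thesis by (simp add: norm_mult)
  qed
  have delta: "(\<Sum>h\<in>{0..<H}. ee (of_int (h * (m - v)) / of_int H)) = (if m = v then of_int H else 0)" if "m \<in> A" "v \<in> W" for m v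
  proof -
    have "v \<in> A" using that WA by auto
    hence "\<bar>m - v\<bar> < H" using that by (auto simp: A_def H)
    hence "H dvd m - v \<longleftrightarrow> m = v"
      using dvd_abs_less[of H "m - v"] by auto
    thus ?thesis using sum_ee_residues[OF H0, of "m - v"] by simp
  qed
  have "of_int H * (\<Sum>m\<in>W. a m) = (\<Sum>m\<in>A. a m * (\<Sum>v\<in>W. if m = v then of_int H else 0))"
  proof -
    have "(\<Sum>m\<in>A. a m * (\<Sum>v\<in>W. if m = v then of_int H else 0)) = (\<Sum>m\<in>A. if m \<in> W then a m * of_int H else 0)"
      by (intro sum.cong refl) (simp add: W_def)
    also have "\<dots> = (\<Sum>m\<in>W. a m * of_int H)"
      using WA by (intro sum.mono_neutral_cong_right) (auto simp: A_def)
    finally show ?thesis by (simp add: sum_distrib_left mult.commute)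
  qed
  also have "\<dots> = (\<Sum>m\<in>A. a m * (\<Sum>v\<in>W. \<Sum>h\<in>{0..<H}. ee (of_int (h * (m - v)) / of_int H)))"
    by (intro sum.cong refl arg_cong2[where f = "(*)"] delta[symmetric])
  also have "\<dots> = (\<Sum>m\<in>A. \<Sum>h\<in>{0..<H}. \<kappa> h * (a m * ee (of_int h / of_int H * of_int m)))"
  proof (intro sum.cong refl)
    fix m
    have "(\<Sum>v\<in>W. \<Sum>h\<in>{0..<H}. ee (of_int (h * (m - v)) / of_int H)) = (\<Sum>h\<in>{0..<H}. \<Sum>v\<in>W. ee (of_int (h * (m - v)) / of_int H))"
      by (rule sum.swap)
    also have "\<dots> = (\<Sum>h\<in>{0..<H}. \<kappa> h * ee (of_int h / of_int H * of_int m))"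
      unfolding \<kappa>_def sum_distrib_right ee_add[symmetric]
      by (intro sum.cong refl arg_cong[where f = ee]) (simp add: diff_divide_distrib right_diff_distrib)
    finally show "a m * (\<Sum>v\<in>W. \<Sum>h\<in>{0..<H}. ee (of_int (h * (m - v)) / of_int H)) = (\<Sum>h\<in>{0..<H}. \<kappa> h * (a m * ee (of_int h / of_int H * of_int m)))"
      by (simp add: sum_distrib_left mult_ac)
  qed
  also have "\<dots> = (\<Sum>h\<in>{0..<H}. \<kappa> h * (\<Sum>m\<in>A. a m * ee (of_int h / of_int H * of_int m)))"
    by (subst sum.swap) (simp add: sum_distrib_left)
  finally have "of_int H * (\<Sum>m\<in>W. a m) = (\<Sum>h\<in>{0..<H}. \<kappa> h * (\<Sum>m\<in>A. a m * ee (of_int h / of_int H * of_int m)))" .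
  hence "cmod (of_int H * (\<Sum>m\<in>W. a m)) \<le> (\<Sum>h\<in>{0..<H}. cmod (\<kappa> h) * cmod (\<Sum>m\<in>A. a m * ee (of_int h / of_int H * of_int m)))"
    by (metis (no_types, lifting) norm_mult norm_sum sum.cong)
  thus ?thesis using H0 by (simp add: norm_mult norm\<kappa> W_def A_def)
qed

text \<open>The points \<open>h / H\<close> are well spaced modulo 1, so completion costs only a
  logarithm after division by \<open>H\<close>.\<close>

lemma completion_kernel_sum:
  assumes N: "N \<ge> 1" and H: "H = 2 * N + 1"
  shows "(\<Sum>h\<in>{0..<int H}. cmod (\<Sum>v\<in>{0..<0 + int N}. ee (- (of_int h / of_int (int H)) * of_int v))) \<le> 2 * real N + 2 * real H * harm (2 * H)"
proof (rule spaced_sum[where f = "\<lambda>h. - (of_int h / of_int (int H))"])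
  fix i j assume ij: "i \<in> {0..<int H}" "j \<in> {0..<int H}" "i \<noteq> j"
  have H0: "real H > 0" using H by simp
  show "nd (- (of_int i / of_int (int H)) - - (of_int j / of_int (int H))) \<ge> 1 / (2 * real H)"
  proof (rule nd_ge)
    fix z :: int
    have "j - i - z * int H \<noteq> 0"
    proof
      assume "j - i - z * int H = 0"
      hence "j - i = int H * z" by (simp add: mult.commute)
      hence "int H dvd j - i" by simp
      thus False using ij zdvd_not_zless[of "i - j" "int H"] zdvd_not_zless[of "j - i" "int H"] by (auto simp: neq_iff dvd_diff_commute)
    qed
    hence "1 \<le> \<bar>j - i - z * int H\<bar>" by linarith
    hence "1 \<le> \<bar>of_int (j - i - z * int H) :: real\<bar>" by (metis of_int_1_le_iff of_int_abs)
    hence "1 / real H \<le> \<bar>of_int (j - i - z * int H) / real H\<bar>" using H0 by (simp add: divide_right_mono)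
    also have "of_int (j - i - z * int H) / real H = - (of_int i / of_int (int H)) - - (of_int j / of_int (int H)) - of_int z"
      using H0 by (simp add: field_simps)
    finally show "1 / (2 * real H) \<le> \<bar>- (of_int i / of_int (int H)) - - (of_int j / of_int (int H)) - of_int z\<bar>"
      using H0 by (simp add: field_simps)
  qed
next
  fix i
  show "cmod (\<Sum>v\<in>{0..<0 + int N}. ee (- (of_int i / of_int (int H)) * of_int v)) * (2 * nd (- (of_int i / of_int (int H)))) \<le> 1"
    by (rule geometric_kernel_bound)
  have "cmod (\<Sum>v\<in>{0..<0 + int N}. ee (- (of_int i / of_int (int H)) * of_int v)) \<le> (\<Sum>v\<in>{0..<0 + int N}. 1)"
    by (rule order_trans[OF norm_sum]) simp
  thus "cmod (\<Sum>v\<in>{0..<0 + int N}. ee (- (of_int i / of_int (int H)) * of_int v)) \<le> real N" by simp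
qed (use H in auto)

lemma nd_minus: "nd (- x) = nd x"
proof -
  have "nd (- x) \<ge> nd x" for x
  proof (rule nd_ge)
    fix z :: int
    have "nd x \<le> \<bar>x - of_int (- z)\<bar>" by (rule nd_le)
    thus "nd x \<le> \<bar>- x - of_int z\<bar>" by simp
  qed
  from this[of x] this[of "- x"] show ?thesis by simp
qed

text \<open>A shift by \<open>y\<close> leaves the top coefficient alone and makes the next one
  affine in \<open>y\<close>, with slope \<open>k + 1\<close> times the top one. This is where a
  rational approximation of the top coefficient becomes spacing of the shifted sums.\<close>

lemma shift_coeffs:
  fixes f :: "real poly"
  assumes "degree f \<le> k + 1"
  defines "g \<equiv> \<lambda>y. pcompose f [:y, 1:]"
  shows "poly f (m + y) = coeff (g y) 0 + (\<Sum>j\<in>{1..k}. coeff (g y) j * m ^ j) + coeff f (k + 1) * m ^ (k + 1)"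
    and "coeff (g y) k = coeff f k + real (k + 1) * coeff f (k + 1) * y"
proof -
  have mono: "pcompose (monom c n) [:y, 1:] = smult c ([:y, 1:] ^ n)" for c n
    by (induction n) (simp_all add: monom_0 monom_Suc pcompose_pCons pcompose_const)
  have "g y = pcompose (\<Sum>n\<le>k + 1. monom (coeff f n) n) [:y, 1:]"
    unfolding g_def using poly_as_sum_of_monoms'[OF assms(1)] by simp
  also have "\<dots> = (\<Sum>n\<le>k + 1. smult (coeff f n) ([:y, 1:] ^ n))" by (simp only: pcompose_sum mono)
  finally have g: "g y = (\<Sum>n\<le>k + 1. smult (coeff f n) ([:y, 1:] ^ n))" .
  have small: "coeff ([:y, 1:] ^ n) i = 0" if "n < i" for n i
    using that degree_power_le[of "[:y, 1:]" n] by (intro coeff_eq_0) auto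
  have low: "(\<Sum>n<k. coeff f n * coeff ([:y, 1:] ^ n) i) = 0" if "i \<ge> k" for i
    using that small by (intro sum.neutral) auto
  have expand: "coeff (g y) i = (\<Sum>n<k. coeff f n * coeff ([:y, 1:] ^ n) i) + coeff f k * coeff ([:y, 1:] ^ k) i + coeff f (k + 1) * coeff ([:y, 1:] ^ (k + 1)) i" for i
    unfolding g by (simp add: coeff_sum lessThan_Suc_atMost[symmetric])
  show ck: "coeff (g y) k = coeff f k + real (k + 1) * coeff f (k + 1) * y"
    unfolding expand low[OF order_refl] using coeff_linear_poly_power[of k "k + 1" y 1] by (simp add: coeff_linear_power)
  have ck1: "coeff (g y) (k + 1) = coeff f (k + 1)"
    unfolding expand low[OF le_add1] using small[of k "k + 1"] coeff_linear_power[of y "k + 1"] by simp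
  have "degree (g y) \<le> k + 1" using assms(1) by (simp add: g_def degree_pcompose)
  hence "poly (\<Sum>i\<le>k + 1. monom (coeff (g y) i) i) m = poly (g y) m" by (simp only: poly_as_sum_of_monoms')
  hence "poly (g y) m = (\<Sum>i\<le>k + 1. coeff (g y) i * m ^ i)" by (simp add: poly_sum poly_monom)
  also have "\<dots> = (\<Sum>i\<le>k. coeff (g y) i * m ^ i) + coeff (g y) (k + 1) * m ^ (k + 1)" by simp
  also have "(\<Sum>i\<le>k. coeff (g y) i * m ^ i) = coeff (g y) 0 + (\<Sum>j\<in>{1..k}. coeff (g y) j * m ^ j)"
    by (simp add: atMost_atLeast0 sum.atLeast_Suc_atMost)
  finally have "poly (g y) m = coeff (g y) 0 + (\<Sum>j\<in>{1..k}. coeff (g y) j * m ^ j) + coeff (g y) (k + 1) * m ^ (k + 1)" .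
  moreover have "poly (g y) m = poly f (m + y)" by (simp add: g_def poly_pcompose add.commute)
  ultimately show "poly f (m + y) = coeff (g y) 0 + (\<Sum>j\<in>{1..k}. coeff (g y) j * m ^ j) + coeff f (k + 1) * m ^ (k + 1)"
    by (simp only: ck1)
qed

text \<open>
  Completing the sum modulo \<open>2 N + 1\<close> makes the range of summation independent of the shift \<open>y\<close>. The additive
  characters only change the linear coefficient; for \<open>k = 1\<close> this is the sieved one, but the change
  does not depend on \<open>y\<close>.
\<close>

lemma weyl_core:
  fixes f :: "real poly"
  assumes k: "k \<ge> 1" and s: "s \<ge> 1" and N: "N \<ge> 1" and f: "degree f \<le> k + 1"
    and r: "coprime b (int r)" "r \<ge> 1" "\<bar>coeff f (k + 1) - of_int b / real r\<bar> \<le> 1 / (real r)\<^sup>2"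
  defines "H \<equiv> 2 * N + 1"
  defines "Z \<equiv> real (energy k s N) * ((\<Prod>j\<in>{1..<k}. 2 * real s * real N ^ j + 1) *
     ((4 * real (k + 1) * real N / real r + 1) * (2 * (2 * real (s * N ^ k) + 1) + 2 * real r * harm (2 * r))))"
  shows "real N * (real H * cmod (\<Sum>n=1..N. ee (poly f (real n)))) \<le>
    (2 * real N + 2 * real H * harm (2 * H)) * root (2 * s) (real N ^ (2 * s - 1) * Z)"
proof -
  define S where "S = (\<Sum>n=1..N. ee (poly f (real n)))"
  define \<beta> where "\<beta> = coeff f (k + 1)"
  define g where "g = (\<lambda>y. pcompose f [:y, 1:])"
  define \<theta> where "\<theta> = (\<lambda>h::int. of_int h / of_int (int H) :: real)"
  define \<kappa> where "\<kappa> = (\<lambda>h. cmod (\<Sum>v\<in>{0..<0 + int N}. ee (- \<theta> h * of_int v)))"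
  define A where "A = {- int N..int N}"
  define \<gamma> where "\<gamma> = (\<lambda>h (y::nat) j. coeff (g (real y)) j + (if j = 1 then \<theta> h else 0))"
  define w where "w = (\<lambda>m::int. ee (\<beta> * of_int m ^ (k + 1)))"
  define Fh where "Fh = (\<lambda>h y. \<Sum>m\<in>A. w m * ee (\<Sum>j\<in>{1..k}. \<gamma> h y j * of_int (m ^ j)))"
  define a where "a = (\<lambda>y m. ee (poly f (of_int m + real y)))"
  have S_shift: "S = (\<Sum>m\<in>{1 - int y..int N - int y}. a y m)" for y
    unfolding S_def a_def
    by (rule sum.reindex_bij_witness[of _ "\<lambda>m. nat (m + int y)" "\<lambda>n. int n - int y"]) auto
  have aF: "cmod (\<Sum>m\<in>A. a y m * ee (\<theta> h * of_int m)) = cmod (Fh h y)" for y h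
  proof -
    have "a y m * ee (\<theta> h * of_int m) = ee (coeff (g (real y)) 0) * (w m * ee (\<Sum>j\<in>{1..k}. \<gamma> h y j * of_int (m ^ j)))" for m
    proof -
      have "(\<Sum>j\<in>{1..k}. (if j = 1 then \<theta> h else 0) * of_int (m ^ j)) = (\<Sum>j\<in>{1}. \<theta> h * of_int (m ^ j))"
        using k by (intro sum.mono_neutral_cong_right) auto
      hence "(\<Sum>j\<in>{1..k}. \<gamma> h y j * of_int (m ^ j)) = (\<Sum>j\<in>{1..k}. coeff (g (real y)) j * of_int m ^ j) + \<theta> h * of_int m"
        by (simp add: \<gamma>_def distrib_right sum.distrib)
      moreover have "poly f (of_int m + real y) = coeff (g (real y)) 0 + (\<Sum>j\<in>{1..k}. coeff (g (real y)) j * of_int m ^ j) + \<beta> * of_int m ^ (k + 1)"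
        unfolding g_def \<beta>_def by (rule shift_coeffs(1)[OF f])
      ultimately show ?thesis by (simp add: a_def w_def flip: ee_add) (simp add: add_ac)
    qed
    hence "(\<Sum>m\<in>A. a y m * ee (\<theta> h * of_int m)) = ee (coeff (g (real y)) 0) * Fh h y"
      by (simp add: Fh_def sum_distrib_left)
    thus ?thesis by (simp add: norm_mult)
  qed
  have step: "real H * cmod S \<le> (\<Sum>h\<in>{0..<int H}. \<kappa> h * cmod (Fh h y))" if y: "y < N" for y
  proof -
    have "of_int (int H) * cmod (\<Sum>m\<in>{1 - int y..int N - int y}. a y m) \<le>
      (\<Sum>h\<in>{0..<int H}. cmod (\<Sum>v\<in>{0..<0 + int N}. ee (- (of_int h / of_int (int H)) * of_int v)) *
       cmod (\<Sum>m\<in>{- int N..int N}. a y m * ee (of_int h / of_int (int H) * of_int m)))"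
      by (rule completion[OF N y]) (simp add: H_def)
    thus ?thesis unfolding \<kappa>_def aF[symmetric] S_shift[of y] A_def \<theta>_def by (simp only: of_int_of_nat_eq)
  qed
  define M where "M = 2 * real (s * N ^ k) + 1"
  define B where "B = (4 * real (k + 1) * real N / real r + 1) * (2 * M + 2 * real r * harm (2 * r))"
  have B: "B \<ge> 0" unfolding B_def M_def by (intro mult_nonneg_nonneg add_nonneg_nonneg harm_nonneg) auto
  have Z: "Z = real (energy k s N) * ((\<Prod>j\<in>{1..<k}. 2 * real s * real N ^ j + 1) * B)"
    by (simp add: Z_def B_def M_def)
  have moment: "(\<Sum>y<N. cmod (Fh h y) ^ (2 * s)) \<le> Z" for h
    unfolding Z Fh_def A_def
  proof (rule shifted_moment[OF k N _ B])
    show "cmod (w n) \<le> 1" for n by (simp add: w_def)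
    fix y assume y: "y < N"
    define K where "K = (\<lambda>y'. cmod (\<Sum>v\<in>{- int (s * N ^ k)..int (s * N ^ k)}. ee ((\<gamma> h y k - \<gamma> h y' k) * of_int v)))"
    have "(\<Sum>y'<N. K y') \<le> B"
      unfolding B_def
    proof (rule reciprocal_distance_sum[where c = "- (\<beta> * real (k + 1) * real y)", OF r[folded \<beta>_def]])
      fix y'
      have diff: "\<gamma> h y k - \<gamma> h y' k = - (\<beta> * real (k + 1) * real y' + - (\<beta> * real (k + 1) * real y))"
        by (simp add: \<gamma>_def g_def shift_coeffs(2)[OF f] \<beta>_def algebra_simps)
      have I: "{- int (s * N ^ k)..int (s * N ^ k)} = {- int (s * N ^ k)..<- int (s * N ^ k) + int (2 * (s * N ^ k) + 1)}"
        by auto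
      show "K y' * (2 * nd (\<beta> * real (k + 1) * real y' + - (\<beta> * real (k + 1) * real y))) \<le> 1"
        unfolding K_def I using geometric_kernel_bound[of "\<gamma> h y k - \<gamma> h y' k"] unfolding diff nd_minus .
      have "K y' \<le> (\<Sum>v\<in>{- int (s * N ^ k)..int (s * N ^ k)}. 1)"
        unfolding K_def by (rule order_trans[OF norm_sum]) simp
      also have "\<dots> = M" by (simp add: M_def)
      finally show "K y' \<le> M" .
    qed (auto simp: M_def)
    thus "(\<Sum>y'<N. cmod (\<Sum>v\<in>{- int (s * N ^ k)..int (s * N ^ k)}. ee ((\<gamma> h y k - \<gamma> h y' k) * of_int v))) \<le> B"
      by (simp only: K_def)
  qed
  have Z0: "Z \<ge> 0" unfolding Z using B by (intro mult_nonneg_nonneg prod_nonneg) auto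
  define U where "U = root (2 * s) (real N ^ (2 * s - 1) * Z)"
  have U: "U \<ge> 0" "U ^ (2 * s) = real N ^ (2 * s - 1) * Z"
    using Z0 s by (auto simp: U_def real_root_pow_pos2)
  have sumF: "(\<Sum>y<N. cmod (Fh h y)) \<le> U" for h
  proof (rule pow_le_base)
    \<comment> \<open>From the first moment over \<open>y\<close> to the one of order
      \<open>2 s\<close>; this puts the root of order \<open>2 s\<close> on the final
      saving.\<close>
    have "(\<Sum>y<N. cmod (Fh h y)) ^ (2 * s) \<le> (\<Sum>y<N. cmod (Fh h y) ^ (2 * s)) ^ 1 * (\<Sum>y<N. 1) ^ (2 * s - 1)"
      by (rule holder_sum_power) (use s in auto)
    also have "\<dots> \<le> Z * real N ^ (2 * s - 1)" using moment[of h] by (simp add: mult_right_mono)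
    finally show "(\<Sum>y<N. cmod (Fh h y)) ^ (2 * s) \<le> U ^ (2 * s)" unfolding U(2) by (simp only: mult.commute)
  qed (use U s in auto)
  have "real N * (real H * cmod S) = (\<Sum>y<N. real H * cmod S)" by simp
  also have "\<dots> \<le> (\<Sum>y<N. \<Sum>h\<in>{0..<int H}. \<kappa> h * cmod (Fh h y))" by (intro sum_mono step) auto
  also have "\<dots> = (\<Sum>h\<in>{0..<int H}. \<kappa> h * (\<Sum>y<N. cmod (Fh h y)))"
    by (subst sum.swap) (simp add: sum_distrib_left)
  also have "\<dots> \<le> (\<Sum>h\<in>{0..<int H}. \<kappa> h * U)"
    by (intro sum_mono mult_left_mono sumF) (simp add: \<kappa>_def)
  also have "\<dots> = (\<Sum>h\<in>{0..<int H}. \<kappa> h) * U" by (simp add: sum_distrib_right)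
  also have "\<dots> \<le> (2 * real N + 2 * real H * harm (2 * H)) * U"
    unfolding \<kappa>_def \<theta>_def by (intro mult_right_mono completion_kernel_sum N U) (simp add: H_def)
  finally show ?thesis by (simp only: S_def U_def)
qed

lemma log_le_powr:
  assumes "\<delta> > 0" "a \<ge> 0" "t \<ge> 0"
  shows "\<exists>C\<ge>1. \<forall>N::nat. N \<ge> 1 \<longrightarrow> a + t * ln (real N) \<le> C * real N powr \<delta>"
proof (intro exI[of _ "1 + a + t / \<delta>"] conjI allI impI)
  show "1 \<le> 1 + a + t / \<delta>" using assms by simp
  fix N :: nat assume N: "N \<ge> 1"
  have "1 \<le> real N powr \<delta>" using N assms by (intro ge_one_powr_ge_zero) auto
  hence "a \<le> (1 + a) * real N powr \<delta>"
    using assms mult_mono[of a "1 + a" 1 "real N powr \<delta>"] by simp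
  moreover have "t * ln (real N) \<le> t * (real N powr \<delta> / \<delta>)"
    using N assms by (intro mult_left_mono ln_powr_bound) auto
  ultimately show "a + t * ln (real N) \<le> (1 + a + t / \<delta>) * real N powr \<delta>" by (simp add: distrib_right)
qed

text \<open>Count powers of \<open>N\<close>: the energy gives \<open>s\<close>, the trivially
  treated coefficients the sum of all \<open>j < k\<close>, and the kernel \<open>k + 1\<close>
  together with the factor \<open>G\<close>, in total \<open>2 s + 1\<close>. With
  \<open>2 s - 1\<close> from Hoelder's inequality, the root of order \<open>2 s\<close> is
  \<open>N * N\<close> times that of \<open>G\<close>, and one \<open>N\<close> is the number of
  shifts.\<close>

theorem weyl_bound:
  assumes d: "d \<ge> 2" and \<epsilon>: "\<epsilon> > 0"
  shows "\<exists>C\<ge>1. \<forall>(N::nat) (f::real poly) b r. N \<ge> 1 \<longrightarrow> degree f \<le> d \<longrightarrow> coprime b (int r) \<longrightarrow> r \<ge> 1 \<longrightarrow>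
     \<bar>coeff f d - of_int b / real r\<bar> \<le> 1 / (real r)\<^sup>2 \<longrightarrow>
     cmod (\<Sum>n=1..N. ee (poly f (real n))) \<le>
       C * real N powr (1 + \<epsilon>) * (1 / real r + 1 / real N + real r / real N ^ d) powr (1 / (real d * (real d - 1)))"
proof -
  define k where "k = d - 1"
  have k: "k \<ge> 1" "d = k + 1" using d by (auto simp: k_def)
  define s where "s = k * (k + 1) div 2"
  have s: "k * (k + 1) = 2 * s" by (simp add: s_def)
  have s1: "s \<ge> 1" using s k by (cases s) auto
  have sd: "real d * (real d - 1) = real (2 * s)"
    unfolding s[symmetric] k(2) by (simp add: algebra_simps)
  \<comment> \<open>One third each for the completion, the energy and the logarithm of
    \<open>r\<close>.\<close>
  define \<delta> where "\<delta> = \<epsilon> / 3"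
  have \<delta>: "\<delta> > 0" using \<epsilon> by (simp add: \<delta>_def)
  obtain CE where CE: "CE \<ge> 1" "\<And>N. N \<ge> 1 \<Longrightarrow> real (energy k s N) \<le> CE * real N powr (real s + \<delta>)"
    using energy_bound[OF k(1) \<delta> s] by blast
  obtain C1 where C1: "C1 \<ge> 1" "\<And>N::nat. N \<ge> 1 \<Longrightarrow> (3 + 2 * ln 6) + 2 * ln (real N) \<le> C1 * real N powr \<delta>"
    using log_le_powr[OF \<delta>, of "3 + 2 * ln 6" 2] by auto
  obtain C2 where C2: "C2 \<ge> 1" "\<And>N::nat. N \<ge> 1 \<Longrightarrow> (1 + ln 2) + real d * ln (real N) \<le> C2 * real N powr \<delta>"
    using log_le_powr[OF \<delta>, of "1 + ln 2" "real d"] by auto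
  define C3 where "C3 = CE * ((3 * real s) ^ (k - 1) * (4 * real (k + 1) * (6 * real s) * (2 * C2)))"
  have C3: "C3 \<ge> 1"
  proof -
    have "1 \<le> (3 * real s) ^ (k - 1)" using s1 by (intro one_le_power) simp
    moreover have "1 \<le> 4 * real (k + 1) * (6 * real s)" using s1 mult_mono[of 1 "4 * real (k + 1)" 1 "6 * real s"] by simp
    hence "1 * 1 \<le> 4 * real (k + 1) * (6 * real s) * (2 * C2)" using C2(1) by (intro mult_mono) auto
    ultimately have "1 * (1 * 1) \<le> CE * ((3 * real s) ^ (k - 1) * (4 * real (k + 1) * (6 * real s) * (2 * C2)))"
      using CE(1) by (intro mult_mono) auto
    thus ?thesis by (simp add: C3_def)
  qed
  show ?thesis
  proof (intro exI[of _ "C1 * C3"] conjI allI impI)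
    show "1 \<le> C1 * C3" using C1(1) C3 mult_mono[of 1 C1 1 C3] by simp
    fix N :: nat and f :: "real poly" and b :: int and r :: nat
    assume N: "N \<ge> 1" and f: "degree f \<le> d" and r: "coprime b (int r)" "r \<ge> 1" "\<bar>coeff f d - of_int b / real r\<bar> \<le> 1 / (real r)\<^sup>2"
    define S where "S = cmod (\<Sum>n=1..N. ee (poly f (real n)))"
    define G where "G = 1 / real r + 1 / real N + real r / real N ^ d"
    define x where "x = real N"
    have x: "x \<ge> 1" using N by (simp add: x_def)
    have rr: "real r \<ge> 1" using r by simp
    have G0: "G > 0" unfolding G_def using N r by (intro add_pos_nonneg add_pos_pos) auto
    have goal: "S \<le> C1 * C3 * x powr (1 + \<epsilon>) * G powr (1 / real (2 * s))"
    \<comment> \<open>For \<open>r > N ^ d\<close> the bound is trivial; otherwise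
      \<open>ln r\<close> is at most \<open>d ln N\<close>.\<close>
    proof (cases "r > N ^ d")
      case True
      have "real N ^ d \<le> real r" using True by (metis less_imp_le of_nat_le_iff of_nat_power)
      hence "1 \<le> real r / real N ^ d" using N by simp
      hence "G \<ge> 1" unfolding G_def using N by (simp add: add_increasing)
      hence G1: "1 \<le> G powr (1 / real (2 * s))" by (intro ge_one_powr_ge_zero) auto
      have "S \<le> (\<Sum>n=1..N. 1)" unfolding S_def by (rule order_trans[OF norm_sum]) simp
      hence "S \<le> x" by (simp add: x_def)
      also have "x = x powr 1" using x by simp
      also have "\<dots> \<le> x powr (1 + \<epsilon>)" using x \<epsilon> by (intro powr_mono) auto
      also have "\<dots> = 1 * x powr (1 + \<epsilon>) * 1" by simp
      also have "\<dots> \<le> C1 * C3 * x powr (1 + \<epsilon>) * G powr (1 / real (2 * s))"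
        using \<open>1 \<le> C1 * C3\<close> G1 by (intro mult_mono) auto
      finally show ?thesis .
    next
      case False
      hence rN: "real r \<le> x ^ d" unfolding x_def by (metis not_less of_nat_le_iff of_nat_power)
      define H where "H = 2 * N + 1"
      define L where "L = 1 + ln (2 * real r)"
      have L1: "L \<ge> 1" using rr by (simp add: L_def)
      have L: "L \<le> C2 * x powr \<delta>"
      proof -
        have "ln (2 * real r) \<le> ln (2 * x ^ d)" using rr rN by (intro ln_mono) auto
        also have "\<dots> = ln 2 + real d * ln x" using x by (simp add: ln_mult ln_realpow)
        finally show ?thesis using C2(2)[OF N] by (simp add: L_def x_def)
      qed
      have harmr: "harm (2 * r) \<le> L" using harm_le[of "2 * r"] r by (simp add: L_def)
      define LG where "LG = 2 * real N + 2 * real H * harm (2 * H)"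
      have LG: "LG \<le> real H * (C1 * x powr \<delta>)"
      proof -
        have "harm (2 * H) \<le> 1 + ln (real (2 * H))" by (rule harm_le) (simp add: H_def)
        also have "ln (real (2 * H)) \<le> ln (6 * x)" unfolding H_def x_def using N by (intro ln_mono) auto
        also have "\<dots> = ln 6 + ln x" using x by (simp add: ln_mult)
        finally have h: "harm (2 * H) \<le> 1 + ln 6 + ln x" by simp
        have "2 * real N \<le> real H" by (simp add: H_def)
        hence "LG \<le> real H * 1 + real H * (2 * harm (2 * H))" by (simp add: LG_def)
        also have "\<dots> = real H * (1 + 2 * harm (2 * H))" by (simp add: algebra_simps)
        also have "\<dots> \<le> real H * (C1 * x powr \<delta>)"
          using h C1(2)[OF N] by (intro mult_left_mono) (auto simp: x_def)
        finally show ?thesis .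
      qed
      define Pr where "Pr = (\<Prod>j\<in>{1..<k}. 2 * real s * x ^ j + 1)"
      define Bk where "Bk = (4 * real (k + 1) * x / real r + 1) * (2 * (2 * real (s * N ^ k) + 1) + 2 * real r * harm (2 * r))"
      define Z where "Z = real (energy k s N) * (Pr * Bk)"
      have core: "x * (real H * S) \<le> LG * root (2 * s) (x ^ (2 * s - 1) * Z)"
        using weyl_core[OF k(1) s1 N _ r(1,2), of f] f r(3)
        unfolding k(2) S_def LG_def H_def Z_def Pr_def Bk_def x_def by blast
      have xs: "1 \<le> real s * x ^ j" for j
        using s1 x one_le_power[of x j] mult_mono[of 1 "real s" 1 "x ^ j"] by simp
      have Pr: "Pr \<le> (3 * real s) ^ (k - 1) * x ^ (\<Sum>j\<in>{1..<k}. j)" "Pr \<ge> 0"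
      proof -
        have "Pr \<le> (\<Prod>j\<in>{1..<k}. (3 * real s) * x ^ j)"
          unfolding Pr_def using xs x by (intro prod_mono) (auto simp: algebra_simps)
        also have "\<dots> = (3 * real s) ^ (k - 1) * x ^ (\<Sum>j\<in>{1..<k}. j)"
          by (simp add: prod.distrib power_sum)
        finally show "Pr \<le> (3 * real s) ^ (k - 1) * x ^ (\<Sum>j\<in>{1..<k}. j)" .
        show "Pr \<ge> 0" unfolding Pr_def using x by (intro prod_nonneg) auto
      qed
      have Bk: "Bk \<le> 4 * real (k + 1) * (6 * real s) * (2 * (L * (x ^ (k + 1) * G)))" "Bk \<ge> 0"
      proof -
        have a: "4 * real (k + 1) * x / real r + 1 \<le> 4 * real (k + 1) * (x / real r + 1)"
          unfolding distrib_left by simp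
        have "2 * (2 * real (s * N ^ k) + 1) \<le> 6 * (real s * x ^ k)" using xs[of k] by (simp add: x_def)
        moreover have "2 * real r * harm (2 * r) \<le> 6 * real s * (real r * L)"
        proof -
          have "2 * real r * harm (2 * r) \<le> 2 * real r * L" using harmr by (intro mult_left_mono) auto
          also have "\<dots> = 2 * (real r * L)" by simp
          also have "\<dots> \<le> 6 * real s * (real r * L)" using s1 L1 by (intro mult_right_mono) auto
          finally show ?thesis .
        qed
        ultimately have b: "2 * (2 * real (s * N ^ k) + 1) + 2 * real r * harm (2 * r) \<le> 6 * real s * (x ^ k + real r * L)"
          by (simp add: algebra_simps)
        have "Bk \<le> 4 * real (k + 1) * (x / real r + 1) * (6 * real s * (x ^ k + real r * L))"
          unfolding Bk_def using a b x by (intro mult_mono) (auto intro!: add_nonneg_nonneg mult_nonneg_nonneg harm_nonneg)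
        also have "\<dots> = 4 * real (k + 1) * (6 * real s) * ((x / real r + 1) * (x ^ k + real r * L))" by simp
        also have "\<dots> \<le> 4 * real (k + 1) * (6 * real s) * (2 * (L * (x ^ (k + 1) * G)))"
        proof (intro mult_left_mono)
          have xk: "x \<le> x ^ k" using x k power_increasing[of 1 k x] by simp
          have "(x / real r + 1) * (x ^ k + real r * L) = 1 * (x ^ (k + 1) / real r) + L * x + 1 * x ^ k + L * real r"
            using rr by (simp add: field_simps)
          also have "\<dots> \<le> L * (x ^ (k + 1) / real r) + L * x ^ k + L * x ^ k + L * real r"
            using L1 xk x by (intro add_mono mult_right_mono mult_left_mono) auto
          also have "\<dots> \<le> 2 * (L * (x ^ (k + 1) / real r)) + 2 * (L * x ^ k) + 2 * (L * real r)"
          proof -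
            have "L * (x ^ (k + 1) / real r) \<ge> 0" "L * real r \<ge> 0" using L1 x by auto
            thus ?thesis by linarith
          qed
          also have "\<dots> = 2 * (L * (x ^ (k + 1) / real r + x ^ k + real r))" by (simp add: distrib_left)
          also have "x ^ (k + 1) / real r + x ^ k + real r = x ^ (k + 1) * G"
            unfolding G_def k(2) x_def[symmetric] using x by (simp add: distrib_left)
          finally show "(x / real r + 1) * (x ^ k + real r * L) \<le> 2 * (L * (x ^ (k + 1) * G))" .
        qed auto
        finally show "Bk \<le> 4 * real (k + 1) * (6 * real s) * (2 * (L * (x ^ (k + 1) * G)))" .
        show "Bk \<ge> 0" unfolding Bk_def using x by (intro mult_nonneg_nonneg add_nonneg_nonneg harm_nonneg) auto
      qed
      have sums: "s + (\<Sum>j\<in>{1..<k}. j) + (k + 1) = 2 * s + 1"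
      proof -
        have "(\<Sum>j\<in>{1..<k}. j) + k = (\<Sum>j\<in>{0..k}. j)"
        proof -
          have "{0..k} = insert 0 (insert k {1..<k})" using k by auto
          thus ?thesis using k by simp
        qed
        also have "\<dots> = s" unfolding gauss_sum_nat s_def by simp
        finally show ?thesis by simp
      qed
      have "Z \<le> (CE * x powr (real s + \<delta>)) * (((3 * real s) ^ (k - 1) * x ^ (\<Sum>j\<in>{1..<k}. j)) * (4 * real (k + 1) * (6 * real s) * (2 * (L * (x ^ (k + 1) * G)))))"
        unfolding Z_def using CE Pr Bk N x by (intro mult_mono) (auto simp: x_def)
      also have "\<dots> \<le> (CE * x powr (real s + \<delta>)) * (((3 * real s) ^ (k - 1) * x ^ (\<Sum>j\<in>{1..<k}. j)) * (4 * real (k + 1) * (6 * real s) * (2 * ((C2 * x powr \<delta>) * (x ^ (k + 1) * G)))))"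
        using L CE(1) G0 x by (intro mult_left_mono mult_right_mono) auto
      also have "\<dots> = C3 * G * (x powr (real s + \<delta>) * x ^ (\<Sum>j\<in>{1..<k}. j) * x ^ (k + 1) * x powr \<delta>)"
        by (simp only: C3_def mult_ac)
      also have "x powr (real s + \<delta>) * x ^ (\<Sum>j\<in>{1..<k}. j) * x ^ (k + 1) * x powr \<delta> = x ^ (s + (\<Sum>j\<in>{1..<k}. j) + (k + 1)) * x powr (2 * \<delta>)"
      proof -
        have "x powr (real s + \<delta>) = x ^ s * x powr \<delta>" using x by (simp add: powr_add powr_realpow)
        hence "x powr (real s + \<delta>) * x ^ (\<Sum>j\<in>{1..<k}. j) * x ^ (k + 1) * x powr \<delta> =
          x ^ s * x ^ (\<Sum>j\<in>{1..<k}. j) * x ^ (k + 1) * (x powr \<delta> * x powr \<delta>)" by (simp only: mult_ac)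
        also have "x powr \<delta> * x powr \<delta> = x powr (2 * \<delta>)" by (simp flip: powr_add)
        finally show ?thesis by (simp only: power_add)
      qed
      also have "\<dots> = x * (x ^ (2 * s) * x powr (2 * \<delta>))" by (simp only: sums) simp
      finally have ZZ: "Z \<le> C3 * G * (x * (x ^ (2 * s) * x powr (2 * \<delta>)))" .
      have "x ^ (2 * s - 1) * Z \<le> x ^ (2 * s - 1) * (C3 * G * (x * (x ^ (2 * s) * x powr (2 * \<delta>))))"
        using ZZ x by (intro mult_left_mono) auto
      also have "\<dots> = C3 * G * (x ^ (2 * s - 1) * x) * x ^ (2 * s) * x powr (2 * \<delta>)" by simp
      also have "x ^ (2 * s - 1) * x = x ^ (2 * s)" using s1 by (simp add: power_Suc2[symmetric] del: power_Suc)
      also have "C3 * G * x ^ (2 * s) * x ^ (2 * s) * x powr (2 * \<delta>) = (x * x) ^ (2 * s) * (C3 * G * x powr (2 * \<delta>))"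
        by (simp add: power_mult_distrib)
      finally have "root (2 * s) (x ^ (2 * s - 1) * Z) \<le> root (2 * s) ((x * x) ^ (2 * s) * (C3 * G * x powr (2 * \<delta>)))"
        using s1 by simp
      also have "\<dots> = x * x * root (2 * s) (C3 * G * x powr (2 * \<delta>))"
        using s1 x by (simp add: real_root_mult real_root_power_cancel)
      also have "root (2 * s) (C3 * G * x powr (2 * \<delta>)) = (C3 * G * x powr (2 * \<delta>)) powr (1 / real (2 * s))"
        using s1 C3 G0 x by (intro root_powr_inverse) auto
      also have "\<dots> = C3 powr (1 / real (2 * s)) * G powr (1 / real (2 * s)) * x powr (2 * \<delta> * (1 / real (2 * s)))"
        by (simp add: powr_mult powr_powr)
      also have "\<dots> \<le> C3 * G powr (1 / real (2 * s)) * x powr (2 * \<delta>)"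
      proof (intro mult_mono)
        have le1: "1 / real (2 * s) \<le> 1" using s1 by simp
        show "C3 powr (1 / real (2 * s)) \<le> C3" using powr_mono[OF le1 C3] C3 by simp
        show "x powr (2 * \<delta> * (1 / real (2 * s))) \<le> x powr (2 * \<delta>)"
          using x \<delta> le1 mult_left_mono[OF le1, of "2 * \<delta>"] by (intro powr_mono) auto
      qed (use C3 in auto)
      finally have rt: "root (2 * s) (x ^ (2 * s - 1) * Z) \<le> x * x * (C3 * G powr (1 / real (2 * s)) * x powr (2 * \<delta>))"
        using x by simp
      have "x * (real H * S) \<le> (real H * (C1 * x powr \<delta>)) * (x * x * (C3 * G powr (1 / real (2 * s)) * x powr (2 * \<delta>)))"
        by (rule order_trans[OF core], rule mult_mono[OF LG rt])
           (use C1(1) Pr Bk x s1 in \<open>auto simp: Z_def\<close>)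
      also have "\<dots> = x * (real H * (C1 * C3 * (x * (x powr \<delta> * x powr (2 * \<delta>))) * G powr (1 / real (2 * s))))"
        by (simp only: mult_ac)
      also have "x * (x powr \<delta> * x powr (2 * \<delta>)) = x powr (1 + \<epsilon>)"
      proof -
        have "x = x powr 1" using x by simp
        hence "x * (x powr \<delta> * x powr (2 * \<delta>)) = x powr 1 * (x powr \<delta> * x powr (2 * \<delta>))" by simp
        also have "\<dots> = x powr (1 + (\<delta> + 2 * \<delta>))" by (simp only: powr_add)
        finally show ?thesis by (simp add: \<delta>_def)
      qed
      finally show ?thesis using x by (simp add: H_def)
    qed
    thus "cmod (\<Sum>n=1..N. ee (poly f (real n))) \<le>
       C1 * C3 * real N powr (1 + \<epsilon>) * (1 / real r + 1 / real N + real r / real N ^ d) powr (1 / (real d * (real d - 1)))"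
      by (simp only: S_def x_def G_def sd)
  qed
qed

section \<open>Rational approximation\<close>

lemma T_eq: "T f h N = (\<Sum>n=1..N. ee (poly (smult (of_int h) f) (real n)))"
proof -
  have "expi (complex_of_real x) = ee x" for x
    by (simp add: expi_def ee_def cis_conv_exp mult_ac)
  thus ?thesis by (simp only: T_def poly_smult)
qed

lemma \<Delta>_bounds:
  assumes "q \<ge> 1" "N \<ge> 1"
  shows "\<bar>of_int h\<bar> / of_int q \<le> \<Delta> d h q N" "1 / real N \<le> \<Delta> d h q N" "of_int q / real N ^ d \<le> \<Delta> d h q N" "\<Delta> d h q N > 0"
proof -
  have 1: "0 \<le> \<bar>of_int h\<bar> * inverse (of_int q :: real)" "0 \<le> inverse (real N)"
    "0 \<le> of_int q * real N powi (- int d)" "0 \<le> of_int (gcd h q) * real N powi (- int d + 1)" "0 < inverse (real N)"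
    using assms by auto
  have 2: "real N powi (- int d) = 1 / real N ^ d" by (simp add: power_int_minus divide_inverse)
  show "\<bar>of_int h\<bar> / of_int q \<le> \<Delta> d h q N" "1 / real N \<le> \<Delta> d h q N" "\<Delta> d h q N > 0"
    using 1 unfolding \<Delta>_def Let_def divide_inverse mult_1_left by linarith+
  have "of_int q / real N ^ d = of_int q * real N powi (- int d)" by (simp add: 2)
  thus "of_int q / real N ^ d \<le> \<Delta> d h q N" using 1 unfolding \<Delta>_def Let_def by linarith
qed

text \<open>Up to a constant this is \<open>r (1 + N ^ d \<bar>\<delta>\<bar>)\<close>, in negative
  powers of which an exponential sum decays around the centre \<open>b / r\<close> of a major
  arc.\<close>

definition lam :: "nat \<Rightarrow> nat \<Rightarrow> nat \<Rightarrow> real \<Rightarrow> real" where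
  "lam d N r \<delta> = real r * max 1 (real N ^ d * \<bar>\<delta>\<bar>)"

lemma lam_ge: "lam d N r \<delta> \<ge> real r" "lam d N r \<delta> \<ge> real r * (real N ^ d * \<bar>\<delta>\<bar>)"
  unfolding lam_def
  using mult_left_mono[of 1 "max 1 (real N ^ d * \<bar>\<delta>\<bar>)" "real r"]
    mult_left_mono[of "real N ^ d * \<bar>\<delta>\<bar>" "max 1 (real N ^ d * \<bar>\<delta>\<bar>)" "real r"] by simp_all

text \<open>
  Compare \<open>b / r\<close> with \<open>h a / q\<close>: if they are equal then \<open>q\<close> divides \<open>h r\<close>, and otherwise they differ by at least \<open>1 / (q r)\<close>.
\<close>

lemma inverse_lam_le:
  assumes adm: "admissible d f a q h" and N: "N \<ge> 1" and br: "coprime b (int r)" "r \<ge> 1"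
  shows "1 / lam d N r (of_int h * coeff f d - of_int b / real r) \<le> 2 * \<Delta> d h q N"
proof -
  define \<alpha> where "\<alpha> = coeff f d"
  define \<delta> where "\<delta> = of_int h * \<alpha> - of_int b / real r"
  from adm have q: "q \<ge> 1" and aq: "coprime a q" and app: "\<bar>\<alpha> - of_int a / of_int q\<bar> < 1 / (of_int q)\<^sup>2" and h: "h \<noteq> 0"
    by (auto simp: admissible_def \<alpha>_def)
  define x where "x = (of_int q :: real)"
  define y where "y = real r"
  define H where "H = \<bar>of_int h :: real\<bar>"
  have x: "x \<ge> 1" "y \<ge> 1" using q br by (auto simp: x_def y_def)
  note D = \<Delta>_bounds[OF q N, where h = h and d = d]
  have lr: "lam d N r \<delta> \<ge> y" "lam d N r \<delta> \<ge> y * (real N ^ d * \<bar>\<delta>\<bar>)" unfolding y_def by (rule lam_ge)+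
  \<comment> \<open>If \<open>\<bar>h\<bar> / q\<close> is at least \<open>1 / (2 r)\<close>, the
    first term of \<Delta> suffices, through \<open>lam \<ge> r\<close>.\<close>
  have first: "1 / lam d N r \<delta> \<le> 2 * \<Delta> d h q N" if "1 / (2 * y) \<le> H / x"
  proof -
    have "1 / lam d N r \<delta> \<le> 1 / y" using lr(1) x by (intro divide_left_mono) auto
    also have "\<dots> = 2 * (1 / (2 * y))" by simp
    also have "\<dots> \<le> 2 * (H / x)" using that by simp
    finally show ?thesis using D(1) by (simp add: H_def x_def)
  qed
  have "1 / lam d N r \<delta> \<le> 2 * \<Delta> d h q N"
  proof (cases "h * a * int r = b * q")
    case True
    have "int r dvd b * q" using True by (metis dvd_triv_right)
    hence "int r dvd q"
      using coprime_dvd_mult_right_iff[of "int r" b q] br(1) by (simp add: coprime_commute)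
    then obtain g where g: "q = int r * g" by (elim dvdE)
    have "int r * (h * a) = int r * (b * g)" using True by (simp add: g mult_ac)
    hence "h * a = b * g" using br by simp
    hence "g dvd h * a" by simp
    moreover have "coprime a g" using aq unfolding g by (simp add: coprime_mult_right_iff)
    ultimately have "g dvd h"
      using coprime_dvd_mult_left_iff[of g a h] by (simp add: coprime_commute)
    hence "\<bar>g\<bar> \<le> \<bar>h\<bar>" using h by (rule dvd_imp_le_int[rotated])
    hence "g \<le> \<bar>h\<bar>" by linarith
    hence "q \<le> int r * \<bar>h\<bar>" unfolding g using br by (intro mult_left_mono) auto
    hence "real_of_int q \<le> real_of_int (int r * \<bar>h\<bar>)" by (simp only: of_int_le_iff)
    hence "x \<le> y * H" by (simp add: x_def y_def H_def)
    hence "1 / y \<le> H / x" using x by (simp add: field_simps)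
    moreover have "1 / (2 * y) \<le> 1 / y" using x by (simp add: field_simps)
    ultimately show ?thesis by (intro first) linarith
  next
    case False
    hence "1 \<le> \<bar>h * a * int r - b * q\<bar>" by linarith
    hence "1 \<le> \<bar>of_int (h * a * int r - b * q) :: real\<bar>" by (metis of_int_1_le_iff of_int_abs)
    also have "of_int (h * a * int r - b * q) = x * y * (of_int h * of_int a / x - of_int b / y)"
      using x by (simp add: x_def y_def field_simps)
    finally have "1 \<le> x * y * \<bar>of_int h * of_int a / x - of_int b / y\<bar>" using x by (simp add: abs_mult)
    moreover have "\<bar>of_int h * of_int a / x - of_int b / y\<bar> \<le> H / x\<^sup>2 + \<bar>\<delta>\<bar>"
    proof -
      define u where "u = of_int h * (\<alpha> - of_int a / x)"
      have u: "\<bar>u\<bar> \<le> H * (1 / x\<^sup>2)"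
        unfolding u_def abs_mult H_def using app by (intro mult_left_mono) (auto simp: x_def)
      have eq: "of_int h * of_int a / x - of_int b / y = \<delta> - u"
        by (simp add: \<delta>_def u_def y_def right_diff_distrib)
      show ?thesis unfolding eq using u abs_triangle_ineq4[of \<delta> u] by simp
    qed
    ultimately have "1 \<le> x * y * (H / x\<^sup>2 + \<bar>\<delta>\<bar>)" using x by (meson mult_left_mono mult_nonneg_nonneg order_trans zero_le_one)
    also have "\<dots> = y * (H / x) + x * (y * \<bar>\<delta>\<bar>)" using x by (simp add: power2_eq_square field_simps)
    finally have "1 \<le> y * (H / x) + x * (y * \<bar>\<delta>\<bar>)" .
    \<comment> \<open>One of the two summands is at least \<open>1 / 2\<close>. The first leads to
      \<open>\<bar>h\<bar> / q\<close>; the second makes \<delta> large and is paid by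
      \<open>q / N ^ d\<close>.\<close>
    then consider "1 / 2 \<le> y * (H / x)" | "1 / 2 \<le> x * (y * \<bar>\<delta>\<bar>)" by linarith
    thus ?thesis
    proof cases
      case 1
      hence "1 / (2 * y) \<le> H / x" using x by (simp add: field_simps)
      thus ?thesis by (rule first)
    next
      case 2
      have Nd: "real N ^ d > 0" using N by simp
      have "real N ^ d / (2 * x) = real N ^ d * (1 / 2 / x)" by simp
      also have "\<dots> \<le> real N ^ d * (y * \<bar>\<delta>\<bar>)"
        using 2 x Nd by (intro mult_left_mono) (auto simp: field_simps)
      also have "\<dots> \<le> lam d N r \<delta>" using lr(2) by (simp add: mult_ac)
      finally have "1 / lam d N r \<delta> \<le> 1 / (real N ^ d / (2 * x))"
        using x Nd lr(1) by (intro divide_left_mono mult_pos_pos) auto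
      also have "\<dots> = 2 * (x / real N ^ d)" by simp
      also have "\<dots> \<le> 2 * \<Delta> d h q N" using D(3) by (simp add: x_def)
      finally show ?thesis .
    qed
  qed
  thus ?thesis by (simp add: \<delta>_def \<alpha>_def)
qed

text \<open>
  If \<open>N\<^sup>d \<bar>\<delta>\<bar> > 1\<close>, Dirichlet's theorem with denominators up to \<open>1 / (r \<bar>\<delta>\<bar>)\<close> yields a fraction other than \<open>b / r\<close>,
  hence one whose denominator is of the order of \<open>1 / (r \<bar>\<delta>\<bar>) = N\<^sup>d / \<lambda>\<close>.
\<close>

lemma second_approximation:
  assumes br: "coprime b (int r)" "r \<ge> 1" and N: "N \<ge> 1" and d: "d \<ge> 1"
    and \<delta>: "\<delta> = \<beta> - of_int b / real r" "2 * (real r)\<^sup>2 * \<bar>\<delta>\<bar> \<le> 1"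
  shows "\<exists>b' r'. coprime b' (int r') \<and> r' \<ge> 1 \<and> \<bar>\<beta> - of_int b' / real r'\<bar> \<le> 1 / (real r')\<^sup>2 \<and>
    1 / real r' + 1 / real N + real r' / real N ^ d \<le> 2 / lam d N r \<delta> + 1 / real N + 2 * lam d N r \<delta> / real N ^ d"
proof (cases "real N ^ d * \<bar>\<delta>\<bar> \<le> 1")
  case True
  hence lam: "lam d N r \<delta> = real r" by (simp add: lam_def)
  have r: "real r \<ge> 1" using br by simp
  have "\<bar>\<delta>\<bar> \<le> 1 / (real r)\<^sup>2"
  proof -
    have "(real r)\<^sup>2 * \<bar>\<delta>\<bar> \<le> 2 * (real r)\<^sup>2 * \<bar>\<delta>\<bar>" by simp
    hence "(real r)\<^sup>2 * \<bar>\<delta>\<bar> \<le> 1" using \<delta>(2) by linarith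
    thus ?thesis using r by (simp add: field_simps)
  qed
  moreover have "1 / real r \<le> 2 / real r" "real r / real N ^ d \<le> 2 * real r / real N ^ d"
    using r N by (auto intro!: divide_right_mono)
  hence "1 / real r + 1 / real N + real r / real N ^ d \<le> 2 / lam d N r \<delta> + 1 / real N + 2 * lam d N r \<delta> / real N ^ d"
    unfolding lam by linarith
  ultimately show ?thesis using br \<delta>(1) by (intro exI[of _ b] exI[of _ r]) simp
next
  case False
  hence lam: "lam d N r \<delta> = real r * (real N ^ d * \<bar>\<delta>\<bar>)" by (simp add: lam_def)
  have \<delta>0: "\<bar>\<delta>\<bar> > 0" using False by auto
  define y where "y = real r"
  have y: "y \<ge> 1" using br by (simp add: y_def)
  \<comment> \<open>This is \<open>lam / N ^ d\<close>; up to rounding, its reciprocal bounds the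
    denominators in Dirichlet's theorem.\<close>
  define e where "e = y * \<bar>\<delta>\<bar>"
  have e0: "e > 0" using y \<delta>0 by (simp add: e_def)
  have ye: "2 * (y * e) \<le> 1" using \<delta>(2) by (simp add: e_def y_def power2_eq_square mult_ac)
  have "e \<le> y * e" using y e0 by simp
  hence e1: "e \<le> 1" using ye e0 by linarith
  define Q where "Q = nat \<lceil>1 / e\<rceil>"
  have Q1: "real Q \<ge> 1 / e" "real Q \<le> 1 / e + 1" "Q > 0"
  proof -
    have "1 / e > 0" using e0 by simp
    thus "real Q \<ge> 1 / e" "real Q \<le> 1 / e + 1" "Q > 0" unfolding Q_def by linarith+
  qed
  have Q2: "real Q \<le> 2 / e"
  proof -
    have "1 \<le> 1 / e" using e0 e1 by simp
    thus ?thesis using Q1(2) by (simp add: field_simps)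
  qed
  obtain b' r'' where b': "coprime b' r''" "0 < r''" "r'' \<le> int Q" "\<bar>of_int r'' * \<beta> - of_int b'\<bar> < 1 / real Q"
    using Dirichlet_approx_coprime[OF Q1(3)] by blast
  define r' where "r' = nat r''"
  have r'': "r'' = int r'" using b' by (simp add: r'_def)
  define z where "z = real r'"
  have z: "z \<ge> 1" "z \<le> real Q" using b' r'' by (auto simp: z_def)
  define \<delta>' where "\<delta>' = \<beta> - of_int b' / z"
  have zd: "z * \<bar>\<delta>'\<bar> < 1 / real Q"
  proof -
    have "z * \<delta>' = of_int r'' * \<beta> - of_int b'" using z by (simp add: \<delta>'_def r'' z_def right_diff_distrib)
    moreover have "\<bar>z * \<delta>'\<bar> = z * \<bar>\<delta>'\<bar>" using z by (simp add: abs_mult)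
    ultimately show ?thesis using b'(4) by simp
  qed
  have invQ: "1 / real Q \<le> e" using Q1 e0 by (simp add: field_simps)
  have ne: "b * int r' \<noteq> b' * int r"
  proof
    assume eq: "b * int r' = b' * int r"
    have "int r dvd int r'" using eq br(1) by (metis coprime_commute coprime_dvd_mult_right_iff dvd_triv_right)
    moreover have "int r' dvd int r" using eq b'(1) r'' by (metis coprime_commute coprime_dvd_mult_right_iff dvd_triv_right)
    ultimately have rr: "r = r'" by (simp add: dvd_antisym)
    hence "b = b'" using eq br by simp
    hence "\<delta>' = \<delta>" by (simp add: \<delta>'_def \<delta>(1) z_def rr)
    hence "e < 1 / real Q" using zd by (simp add: e_def y_def z_def rr)
    thus False using invQ by simp
  qed
  \<comment> \<open>Distinct fractions differ by at least \<open>1 / (y z)\<close>. The hypothesis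
    on \<delta> bounds \<open>y e\<close> by \<open>1 / 2\<close>, so the remaining half must come
    from \<open>z e\<close>.\<close>
  have zlow: "1 / z \<le> 2 * e"
  proof -
    have "1 \<le> \<bar>b * int r' - b' * int r\<bar>" using ne by linarith
    hence "1 \<le> \<bar>of_int (b * int r' - b' * int r) :: real\<bar>" by (metis of_int_1_le_iff of_int_abs)
    also have "of_int (b * int r' - b' * int r) = y * z * (of_int b / y - of_int b' / z)"
      using y z by (simp add: y_def z_def field_simps)
    also have "of_int b / y - of_int b' / z = \<delta>' - \<delta>" by (simp add: \<delta>'_def \<delta>(1) y_def)
    also have "\<bar>y * z * (\<delta>' - \<delta>)\<bar> \<le> y * z * (\<bar>\<delta>'\<bar> + \<bar>\<delta>\<bar>)"
      using y z by (simp add: abs_mult mult_left_mono)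
    also have "\<dots> = y * (z * \<bar>\<delta>'\<bar>) + z * e" by (simp add: e_def algebra_simps)
    also have "\<dots> \<le> y * e + z * e" using zd invQ y e0 z by (intro add_mono mult_left_mono) auto
    finally have "1 / 2 \<le> z * e" using ye by linarith
    thus ?thesis using z by (simp add: field_simps)
  qed
  have Nd: "real N ^ d > 0" using N by simp
  have lame: "lam d N r \<delta> = real N ^ d * e" by (simp add: lam e_def y_def mult_ac)
  have "1 / z + 1 / real N + z / real N ^ d \<le> 2 * e + 1 / real N + 2 / e / real N ^ d"
    using zlow z Q2 Nd by (intro add_mono divide_right_mono) auto
  also have "\<dots> = 2 / lam d N r \<delta> + 1 / real N + 2 * lam d N r \<delta> / real N ^ d"
    unfolding lame using Nd N by (simp add: mult_ac)
  finally have "1 / z + 1 / real N + z / real N ^ d \<le> 2 / lam d N r \<delta> + 1 / real N + 2 * lam d N r \<delta> / real N ^ d" .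
  moreover have "\<bar>\<delta>'\<bar> \<le> 1 / z\<^sup>2"
  proof -
    have "z * (z * \<bar>\<delta>'\<bar>) \<le> real Q * (1 / real Q)" using zd z Q1 by (intro mult_mono) auto
    hence "z\<^sup>2 * \<bar>\<delta>'\<bar> \<le> 1" using Q1 by (simp add: power2_eq_square mult.assoc)
    thus ?thesis using z by (simp add: field_simps)
  qed
  moreover have "coprime b' (int r')" "r' \<ge> 1" using b' r'' by auto
  ultimately show ?thesis unfolding \<delta>'_def z_def by (intro exI[of _ b'] exI[of _ r'] conjI)
qed

text \<open>With the fraction of \<open>second_approximation\<close>, the saving off the centre of
  an arc is governed by \<open>lam\<close> and not just by \<open>r\<close>.\<close>

lemma weyl_lam:
  assumes d: "d \<ge> 2" and \<epsilon>: "\<epsilon> > 0"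
  shows "\<exists>C\<ge>1. \<forall>(N::nat) (f::real poly) b r \<delta>. N \<ge> 1 \<longrightarrow> degree f \<le> d \<longrightarrow> coprime b (int r) \<longrightarrow> r \<ge> 1 \<longrightarrow>
     \<delta> = coeff f d - of_int b / real r \<longrightarrow> 2 * (real r)\<^sup>2 * \<bar>\<delta>\<bar> \<le> 1 \<longrightarrow>
     cmod (\<Sum>n=1..N. ee (poly f (real n))) \<le>
       C * real N powr (1 + \<epsilon>) * (2 / lam d N r \<delta> + 1 / real N + 2 * lam d N r \<delta> / real N ^ d) powr (1 / (real d * (real d - 1)))"
proof -
  obtain C where C: "C \<ge> 1" and W: "\<And>(N::nat) (f::real poly) b r. N \<ge> 1 \<Longrightarrow> degree f \<le> d \<Longrightarrow> coprime b (int r) \<Longrightarrow> r \<ge> 1 \<Longrightarrow>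
     \<bar>coeff f d - of_int b / real r\<bar> \<le> 1 / (real r)\<^sup>2 \<Longrightarrow>
     cmod (\<Sum>n=1..N. ee (poly f (real n))) \<le>
       C * real N powr (1 + \<epsilon>) * (1 / real r + 1 / real N + real r / real N ^ d) powr (1 / (real d * (real d - 1)))"
    using weyl_bound[OF d \<epsilon>] by blast
  show ?thesis
  proof (intro exI[of _ C] conjI allI impI C)
    fix N :: nat and f :: "real poly" and b r \<delta>
    assume N: "N \<ge> 1" and f: "degree f \<le> d" and br: "coprime b (int r)" "r \<ge> 1"
      and \<delta>: "\<delta> = coeff f d - of_int b / real r" "2 * (real r)\<^sup>2 * \<bar>\<delta>\<bar> \<le> 1"
    obtain b' r' where b': "coprime b' (int r')" "r' \<ge> 1" "\<bar>coeff f d - of_int b' / real r'\<bar> \<le> 1 / (real r')\<^sup>2"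
      "1 / real r' + 1 / real N + real r' / real N ^ d \<le> 2 / lam d N r \<delta> + 1 / real N + 2 * lam d N r \<delta> / real N ^ d"
      using second_approximation[OF br N _ \<delta>, of d] d by auto
    have "cmod (\<Sum>n=1..N. ee (poly f (real n))) \<le>
       C * real N powr (1 + \<epsilon>) * (1 / real r' + 1 / real N + real r' / real N ^ d) powr (1 / (real d * (real d - 1)))"
      by (rule W[OF N f b'(1-3)])
    also have "\<dots> \<le> C * real N powr (1 + \<epsilon>) * (2 / lam d N r \<delta> + 1 / real N + 2 * lam d N r \<delta> / real N ^ d) powr (1 / (real d * (real d - 1)))"
      using C d b'(4) by (intro mult_left_mono powr_mono2) (auto intro!: add_nonneg_nonneg)
    finally show "cmod (\<Sum>n=1..N. ee (poly f (real n))) \<le>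
       C * real N powr (1 + \<epsilon>) * (2 / lam d N r \<delta> + 1 / real N + 2 * lam d N r \<delta> / real N ^ d) powr (1 / (real d * (real d - 1)))" .
  qed
qed

text \<open>Apply Dirichlet's theorem with denominators up to \<open>N ^ (d - 1)\<close>. If
  \<open>r > N / 2\<close>, the factor in Weyl's bound at \<open>b / r\<close> is already of order
  \<open>1 / N\<close>. Otherwise \<open>r\<close> is so small that the hypothesis of
  \<open>second_approximation\<close> holds, and \<open>lam\<close> is at most
  \<open>N ^ (d - 1)\<close>.\<close>

lemma dirichlet_dichotomy:
  fixes \<beta> :: real
  assumes d: "d \<ge> 2" and N: "N \<ge> 1"
  obtains b r where "coprime b (int r)" "r \<ge> 1" "\<bar>\<beta> - of_int b / real r\<bar> \<le> 1 / (real r)\<^sup>2"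
    "1 / real r + 1 / real N + real r / real N ^ d \<le> 4 / real N"
  | b r \<delta> where "coprime b (int r)" "r \<ge> 1" "\<delta> = \<beta> - of_int b / real r" "2 * (real r)\<^sup>2 * \<bar>\<delta>\<bar> \<le> 1"
    "lam d N r \<delta> / real N ^ d \<le> 1 / real N"
proof -
  define Q where "Q = N ^ (d - 1)"
  have Q: "Q > 0" using N by (simp add: Q_def)
  obtain b r'' where b: "coprime b r''" "0 < r''" "r'' \<le> int Q" "\<bar>of_int r'' * \<beta> - of_int b\<bar> < 1 / real Q"
    using Dirichlet_approx_coprime[OF Q] by blast
  define r where "r = nat r''"
  have r'': "r'' = int r" using b by (simp add: r_def)
  define z where "z = real r"
  have z: "z \<ge> 1" "z \<le> real Q" using b r'' by (auto simp: z_def)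
  define \<delta> where "\<delta> = \<beta> - of_int b / z"
  have zd: "z * \<bar>\<delta>\<bar> \<le> 1 / real Q"
  proof -
    have "z * \<delta> = of_int r'' * \<beta> - of_int b" using z by (simp add: \<delta>_def r'' z_def right_diff_distrib)
    moreover have "\<bar>z * \<delta>\<bar> = z * \<bar>\<delta>\<bar>" using z by (simp add: abs_mult)
    ultimately show ?thesis using b(4) by simp
  qed
  have br: "coprime b (int r)" "r \<ge> 1" using b r'' by auto
  have NQ: "real N ^ d = real N * real Q" unfolding Q_def using d by (cases d) auto
  have QN: "real Q \<ge> real N"
  proof -
    have "real N ^ 1 \<le> real N ^ (d - 1)" using N d by (intro power_increasing) auto
    thus ?thesis by (simp add: Q_def)
  qed
  have n: "real N \<ge> 1" "real Q > 0" using N Q by auto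
  show thesis
  proof (cases "2 * z > real N")
    case True
    have "z * (z * \<bar>\<delta>\<bar>) \<le> real Q * (1 / real Q)" using zd z Q by (intro mult_mono) auto
    hence "z\<^sup>2 * \<bar>\<delta>\<bar> \<le> 1" using Q by (simp add: power2_eq_square mult.assoc)
    hence "\<bar>\<delta>\<bar> \<le> 1 / z\<^sup>2" using z by (simp add: field_simps)
    moreover have "1 / z \<le> 2 / real N" using True n z by (simp add: field_simps)
    moreover have "z / real N ^ d \<le> 1 / real N" unfolding NQ using z n by (simp add: field_simps)
    ultimately show thesis using that(1)[OF br] by (simp add: \<delta>_def z_def)
  next
    case False
    have "2 * z * (z * \<bar>\<delta>\<bar>) \<le> real Q * (1 / real Q)"
      using zd z False QN Q by (intro mult_mono) auto
    hence 1: "2 * z\<^sup>2 * \<bar>\<delta>\<bar> \<le> 1" using Q by (simp add: power2_eq_square mult.assoc)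
    have "lam d N r \<delta> / real N ^ d \<le> 1 / real N"
    proof (cases "real N ^ d * \<bar>\<delta>\<bar> \<le> 1")
      case True
      hence "lam d N r \<delta> = z" by (simp add: lam_def z_def)
      thus ?thesis unfolding NQ using z n by (simp add: field_simps)
    next
      case False
      hence "lam d N r \<delta> / real N ^ d = z * \<bar>\<delta>\<bar>" using n by (simp add: lam_def z_def)
      also have "\<dots> \<le> 1 / real Q" by (rule zd)
      also have "\<dots> \<le> 1 / real N" using QN n by (intro divide_left_mono) auto
      finally show ?thesis .
    qed
    thus thesis using that(2)[OF br, of \<delta>] 1 by (simp add: \<delta>_def z_def)
  qed
qed

section \<open>Removal of the power of N when \<open>lam\<close> is small\<close>

lemma coeff_pcompose_linear:
  fixes f :: "real poly"
  assumes "degree f \<le> d" "t \<noteq> 0"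
  shows "coeff (pcompose f [:a, t:]) d = coeff f d * t ^ d"
proof (cases "degree f = d")
  case True
  have "lead_coeff (pcompose f [:a, t:]) = lead_coeff f * t ^ degree f"
    using assms by (subst lead_coeff_comp) auto
  thus ?thesis using True assms by (simp add: degree_pcompose)
next
  case False
  hence "degree f < d" using assms by simp
  thus ?thesis using assms by (simp add: coeff_eq_0 degree_pcompose)
qed

text \<open>Every \<open>n\<close> is \<open>t m - c\<close> with \<open>m\<close> the ceiling of
  \<open>n / t\<close> and \<open>c < t\<close>. With this sign of \<open>c\<close> all inner sums
  start at \<open>m = 1\<close>, as in Weyl's bound.\<close>

lemma sum_progressions:
  fixes g :: "nat \<Rightarrow> complex"
  assumes "t \<ge> 1"
  shows "(\<Sum>n=1..N. g n) = (\<Sum>c<t. \<Sum>m=1..(N + c) div t. g (t * m - c))"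
proof -
  define \<phi> where "\<phi> = (\<lambda>n. (n + t - 1) div t)"
  have \<phi>: "n \<le> t * \<phi> n" "t * \<phi> n < n + t" "\<phi> n \<ge> 1" if "n \<ge> 1" for n
  proof -
    have e: "n + t - 1 = t * \<phi> n + (n + t - 1) mod t" unfolding \<phi>_def by simp
    have m: "(n + t - 1) mod t < t" using assms by simp
    show "n \<le> t * \<phi> n" "t * \<phi> n < n + t" using e m assms that by linarith+
    hence "\<phi> n \<noteq> 0" using that by (intro notI) simp
    thus "\<phi> n \<ge> 1" by simp
  qed
  have "(\<Sum>c<t. \<Sum>m=1..(N + c) div t. g (t * m - c)) = (\<Sum>(c, m)\<in>(SIGMA c:{..<t}. {1..(N + c) div t}). g (t * m - c))"
    by (rule sum.Sigma) auto
  also have "\<dots> = (\<Sum>n=1..N. g n)"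
  proof (rule sum.reindex_bij_witness[of _ "\<lambda>n. (t * \<phi> n - n, \<phi> n)" "\<lambda>(c, m). t * m - c"])
    fix x assume "x \<in> (SIGMA c:{..<t}. {1..(N + c) div t})"
    then obtain c m where [simp]: "x = (c, m)" and c: "c < t" and m: "1 \<le> m" "m \<le> (N + c) div t" by auto
    have tm: "t * m \<le> N + c" using m(2) assms by (metis div_times_less_eq_dividend le_trans mult.commute mult_le_mono2)
    have tm1: "t \<le> t * m" using m by simp
    have "\<phi> (t * m - c) = m"
    proof -
      define e where "e = t - 1 - c"
      have e: "e < t" using c by (simp add: e_def)
      have "t * m - c + t - 1 = t * m + e" unfolding e_def using c tm1 by linarith
      thus ?thesis unfolding \<phi>_def using e by simp
    qed
    moreover have "t * m - (t * m - c) = c" using c tm1 by linarith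
    ultimately show "(t * \<phi> (case x of (c, m) \<Rightarrow> t * m - c) - (case x of (c, m) \<Rightarrow> t * m - c), \<phi> (case x of (c, m) \<Rightarrow> t * m - c)) = x"
      by simp
    have "1 \<le> t * m - c" "t * m - c \<le> N" using c tm tm1 by linarith+
    thus "(case x of (c, m) \<Rightarrow> t * m - c) \<in> {1..N}" by simp
  next
    fix n assume n: "n \<in> {1..N}"
    hence n1: "n \<ge> 1" by simp
    note p = \<phi>[OF n1]
    show "(case (t * \<phi> n - n, \<phi> n) of (c, m) \<Rightarrow> t * m - c) = n" using p by simp
    have "n \<le> N" using n by simp
    hence "t * \<phi> n \<le> N + (t * \<phi> n - n)" using p(1) by linarith
    hence "\<phi> n * t \<le> N + (t * \<phi> n - n)" by (simp only: mult.commute)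
    hence "\<phi> n \<le> (N + (t * \<phi> n - n)) div t" using assms by (simp add: less_eq_div_iff_mult_less_eq)
    thus "(t * \<phi> n - n, \<phi> n) \<in> (SIGMA c:{..<t}. {1..(N + c) div t})" using p by auto
  qed auto
  finally show ?thesis by simp
qed

text \<open>
  Progressions \<open>n = t m - c\<close> with \<open>t \<equiv> 1\<close> modulo \<open>r\<close> and of length about \<open>N / t \<approx> L \<approx> 2\<^bsup>d+1\<^esup> \<lambda>\<^sup>2\<close> multiply \<open>\<delta>\<close> by \<open>t\<^sup>d\<close> and keep
  the denominator \<open>r\<close>, so they preserve \<open>\<lambda>\<close> up to constants. Weyl's bound on each of them loses only \<open>L\<^sup>\<epsilon>\<close>,
  which the gap between the two exponents absorbs.
\<close>

lemma eps_removal: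
  assumes d: "d \<ge> 2" and \<sigma>2: "0 < \<sigma>2" "\<sigma>2 < 1 / (real d * (real d - 1))"
  shows "\<exists>C\<ge>1. \<exists>N0. \<forall>N\<ge>N0. \<forall>(f::real poly) b r \<delta>. degree f \<le> d \<longrightarrow> coprime b (int r) \<longrightarrow> r \<ge> 1 \<longrightarrow>
     \<delta> = coeff f d - of_int b / real r \<longrightarrow> lam d N r \<delta> \<le> real N powr (1 / 6) \<longrightarrow>
     cmod (\<Sum>n=1..N. ee (poly f (real n))) \<le> C * real N * lam d N r \<delta> powr (- \<sigma>2)"
proof -
  define \<sigma> where "\<sigma> = 1 / (real d * (real d - 1))"
  have dd: "real d * (real d - 1) \<ge> 2 * 1" using d by (intro mult_mono) auto
  have \<sigma>: "\<sigma> \<le> 1" "\<sigma>2 < \<sigma>" "\<sigma> > 0" using dd \<sigma>2 by (auto simp: \<sigma>_def)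
  \<comment> \<open>Half of the gap: the loss on a progression is about
    \<open>L ^ \<epsilon>\<close>, that is \<open>l ^ (2 \<epsilon>)\<close>, and
    \<open>2 \<epsilon>\<close> is exactly the gap.\<close>
  define \<epsilon> where "\<epsilon> = (\<sigma> - \<sigma>2) / 2"
  have \<epsilon>: "\<epsilon> > 0" "\<epsilon> \<le> 1" using \<sigma> \<sigma>2 by (auto simp: \<epsilon>_def)
  obtain C where C: "C \<ge> 1" and W: "\<And>(N::nat) (f::real poly) b r \<delta>. N \<ge> 1 \<Longrightarrow> degree f \<le> d \<Longrightarrow> coprime b (int r) \<Longrightarrow> r \<ge> 1 \<Longrightarrow>
     \<delta> = coeff f d - of_int b / real r \<Longrightarrow> 2 * (real r)\<^sup>2 * \<bar>\<delta>\<bar> \<le> 1 \<Longrightarrow>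
     cmod (\<Sum>n=1..N. ee (poly f (real n))) \<le>
       C * real N powr (1 + \<epsilon>) * (2 / lam d N r \<delta> + 1 / real N + 2 * lam d N r \<delta> / real N ^ d) powr \<sigma>"
    using weyl_lam[OF d \<epsilon>(1)] unfolding \<sigma>_def by blast
  define c1 where "c1 = (2 ^ (d + 1) + 8 :: real)"
  have c1: "c1 \<ge> 1" by (simp add: c1_def)
  define C' where "C' = C * (4 * 2 ^ (d + 4) * c1)"
  have C': "C' \<ge> 1"
  proof -
    have p: "(1::real) \<le> 2 ^ (d + 4)" by (rule one_le_power) simp
    have "1 * 1 \<le> 4 * 2 ^ (d + 4) * c1" by (rule mult_mono) (use p c1 in linarith)+
    hence "1 * 1 \<le> C * (4 * 2 ^ (d + 4) * c1)" using C by (intro mult_mono) linarith+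
    thus ?thesis by (simp add: C'_def)
  qed
  show ?thesis
  proof (intro exI[of _ "2 * C'"] exI[of _ "4 ^ (d + 2)"] conjI allI impI)
    show "1 \<le> 2 * C'" using C' by simp
    fix N :: nat and f :: "real poly" and b r \<delta>
    assume N0: "N \<ge> 4 ^ (d + 2)" and f: "degree f \<le> d" and br: "coprime b (int r)" "r \<ge> 1"
      and \<delta>: "\<delta> = coeff f d - of_int b / real r" and lamN: "lam d N r \<delta> \<le> real N powr (1 / 6)"
    define x where "x = real N"
    define y where "y = real r"
    define l where "l = lam d N r \<delta>"
    have "(4::nat) ^ (d + 2) \<ge> 1" by simp
    hence N: "N \<ge> 1" using N0 by linarith
    have x: "x \<ge> 1" using N by (simp add: x_def)
    have y: "y \<ge> 1" using br by (simp add: y_def)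
    have ly: "y \<le> l" "y * (x ^ d * \<bar>\<delta>\<bar>) \<le> l" unfolding y_def l_def x_def by (rule lam_ge)+
    have l1: "l \<ge> 1" using ly y by linarith
    have l3: "l ^ 3 \<le> x powr (1 / 2)"
    proof -
      have "l ^ 3 \<le> (x powr (1 / 6)) ^ 3" using lamN l1 by (intro power_mono) (auto simp: l_def x_def)
      also have "\<dots> = x powr (1 / 2)" using x by (simp add: powr_powr flip: powr_realpow)
      finally show ?thesis .
    qed
    \<comment> \<open>The length must be of order \<open>2 ^ (d + 1) l ^ 2\<close> so that the
      condition on \<delta> in \<open>weyl_lam\<close> survives the factor \<open>t ^ d\<close>; see
      \<open>small\<close>.\<close>
    define L where "L = nat \<lceil>2 ^ (d + 1) * l\<^sup>2\<rceil>"
    define w where "w = 2 ^ (d + 1) * l\<^sup>2"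
    have w8: "w \<ge> 8"
    proof -
      have "(2::real) ^ 3 * 1 \<le> 2 ^ (d + 1) * l\<^sup>2"
        using d l1 by (intro mult_mono power_increasing one_le_power) auto
      thus ?thesis by (simp add: w_def)
    qed
    have Lw: "w \<le> real L" "real L \<le> w + 1" unfolding L_def w_def[symmetric] using w8 by linarith+
    have L2: "real L \<le> 2 * w" using Lw w8 by linarith
    have L8: "L \<ge> 8" using Lw w8 by linarith
    have lw: "l\<^sup>2 * 2 ^ (d + 1) \<le> real L" using Lw(1) by (simp add: w_def mult.commute)
    \<comment> \<open>The exponent \<open>1 / 6\<close> and the threshold \<open>4 ^ (d + 2)\<close>
      enter here: \<open>l ^ 3\<close> and \<open>2 ^ (d + 2)\<close> are each at most the square
      root of \<open>N\<close>.\<close>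
    have LlN: "real L * l \<le> x"
    proof -
      have "real L * l \<le> 2 * w * l" using L2 l1 by (intro mult_right_mono) auto
      also have "\<dots> = 2 ^ (d + 2) * l ^ 3" by (simp add: w_def power2_eq_square power3_eq_cube)
      also have "\<dots> \<le> 2 ^ (d + 2) * x powr (1 / 2)" using l3 by (intro mult_left_mono) auto
      also have "\<dots> \<le> x powr (1 / 2) * x powr (1 / 2)"
      proof (intro mult_right_mono)
        have "(2 ^ (d + 2)) ^ 2 = (4 ^ (d + 2) :: real)" by (simp add: power_mult[symmetric] power2_eq_square flip: power_mult_distrib)
        also have "\<dots> \<le> x" unfolding x_def using N0 by (metis of_nat_le_iff of_nat_numeral of_nat_power)
        also have "x = (x powr (1 / 2)) ^ 2" using x by (simp add: powr_powr flip: powr_realpow)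
        finally show "2 ^ (d + 2) \<le> x powr (1 / 2)" by (rule pow_le_base) auto
      qed auto
      also have "\<dots> = x" using x by (simp flip: powr_add)
      finally show ?thesis .
    qed
    have LrN: "L * r \<le> N"
    proof -
      have "real L * y \<le> real L * l" using ly by (intro mult_left_mono) auto
      hence "real (L * r) \<le> real N" using LlN by (simp add: y_def x_def)
      thus ?thesis by (simp only: of_nat_le_iff)
    qed
    define u where "u = N div (L * r)"
    have Lr0: "L * r > 0" using L8 br by simp
    have u1: "u \<ge> 1" using LrN Lr0 by (simp add: u_def div_greater_zero_iff Suc_le_eq)
    \<comment> \<open>A modulus of size about \<open>N / L\<close>, congruent to 1 modulo
      \<open>r\<close>, so that multiplying \<open>b\<close> by \<open>t ^ d\<close> keeps the
      fraction reduced with denominator \<open>r\<close>.\<close>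
    define t where "t = 1 + r * u"
    have Lru: "L * r * u \<le> N" unfolding u_def by simp
    have tL: "t * L \<le> 2 * N"
    proof -
      have "L \<le> L * r" using br by simp
      hence "L \<le> N" using LrN by (rule le_trans)
      moreover have "t * L = L + L * r * u" by (simp add: t_def algebra_simps)
      ultimately show ?thesis using Lru by simp
    qed
    have NLt: "N \<le> 2 * L * t"
    proof -
      have "N < L * r * (u + 1)" unfolding u_def using Lr0 by (simp add: dividend_less_times_div)
      also have "\<dots> \<le> L * r * (2 * u)" using u1 by (intro mult_le_mono2) simp
      also have "\<dots> = 2 * L * (r * u)" by simp
      also have "\<dots> \<le> 2 * L * t" by (intro mult_le_mono2) (simp add: t_def)
      finally show ?thesis by simp
    qed
    have t1: "t \<ge> 1" by (simp add: t_def)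
    have t4: "4 * t \<le> N"
    proof -
      have "t * 8 \<le> t * L" using L8 by (rule mult_le_mono2)
      thus ?thesis using tL by linarith
    qed
    have cop: "coprime (int t) (int r)"
    proof (rule coprimeI)
      fix g assume "g dvd int t" "g dvd int r"
      hence "g dvd int t - int u * int r" by (intro dvd_diff dvd_mult)
      thus "is_unit g" by (simp add: t_def mult.commute)
    qed
    have piece: "cmod (\<Sum>m=1..(N + c) div t. ee (poly f (real (t * m - c)))) \<le> C' * real L * l powr (- \<sigma>2)"
      if c: "c < t" for c
    proof -
      define M where "M = (N + c) div t"
      have Mt: "t * M \<le> 2 * N" "N \<le> 2 * (t * M)"
      proof -
        have "t * M \<le> N + c" by (simp add: M_def)
        thus "t * M \<le> 2 * N" using c t4 by linarith
        have "N + c = t * M + (N + c) mod t" by (simp add: M_def)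
        moreover have "(N + c) mod t < t" using t1 by simp
        ultimately show "N \<le> 2 * (t * M)" using t4 by linarith
      qed
      have LM: "L \<le> 4 * M" "M \<le> 4 * L"
      proof -
        have "t * L \<le> 4 * (t * M)" using tL Mt(2) by linarith
        hence "t * L \<le> t * (4 * M)" by (simp only: mult.left_commute)
        thus "L \<le> 4 * M" using t1 by (simp only: mult_le_cancel1)
        have "2 * L * t = 2 * (t * L)" by simp
        hence "t * M \<le> 4 * (t * L)" using NLt Mt(1) by linarith
        hence "t * M \<le> t * (4 * L)" by (simp only: mult.left_commute)
        thus "M \<le> 4 * L" using t1 by (simp only: mult_le_cancel1)
      qed
      have M1: "M \<ge> 1" using LM L8 by simp
      define fc where "fc = pcompose f [:- real c, real t:]"
      have fc: "degree fc \<le> d" using f t1 by (simp add: fc_def degree_pcompose)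
      have pfc: "poly fc (real m) = poly f (real (t * m - c))" if "m \<in> {1..M}" for m
      proof -
        have "c \<le> t * m" using that c by (metis atLeastAtMost_iff le_trans less_imp_le mult.right_neutral mult_le_mono2)
        hence "real (t * m - c) = - real c + real m * real t" by (simp add: of_nat_diff mult.commute)
        thus ?thesis by (simp add: fc_def poly_pcompose)
      qed
      define bc where "bc = b * int t ^ d"
      have bc: "coprime bc (int r)" using br(1) cop by (simp add: bc_def)
      define \<delta>c where "\<delta>c = coeff fc d - of_int bc / real r"
      have \<delta>c: "\<delta>c = \<delta> * real t ^ d"
        using t1 f by (simp add: \<delta>c_def fc_def coeff_pcompose_linear \<delta> bc_def algebra_simps)
      have tx: "real t * real M \<le> 2 * x" "x \<le> 2 * (real t * real M)" "real t * real L \<le> 2 * x"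
        using Mt tL unfolding x_def by (metis of_nat_le_iff of_nat_mult of_nat_numeral)+
      have lc1: "lam d M r \<delta>c = y * max 1 ((real t * real M) ^ d * \<bar>\<delta>\<bar>)"
        by (simp add: lam_def \<delta>c y_def abs_mult power_mult_distrib mult_ac)
      have l_def': "l = y * max 1 (x ^ d * \<bar>\<delta>\<bar>)" by (simp add: l_def lam_def y_def x_def)
      have maxmul: "max 1 (k * z) \<le> k * max 1 z" if "k \<ge> 1" "z \<ge> 0" for k z :: real
      proof -
        have "1 \<le> k * max 1 z" using that mult_mono[of 1 k 1 "max 1 z"] by simp
        moreover have "k * z \<le> k * max 1 z" using that by (intro mult_left_mono) auto
        ultimately show ?thesis by simp
      qed
      have k2: "(2::real) ^ d \<ge> 1" by simp
      have lcu: "lam d M r \<delta>c \<le> 2 ^ d * l"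
      proof -
        have "(real t * real M) ^ d * \<bar>\<delta>\<bar> \<le> (2 * x) ^ d * \<bar>\<delta>\<bar>" using tx by (intro mult_right_mono power_mono) auto
        hence "max 1 ((real t * real M) ^ d * \<bar>\<delta>\<bar>) \<le> max 1 (2 ^ d * (x ^ d * \<bar>\<delta>\<bar>))"
          by (intro max.mono) (auto simp: power_mult_distrib mult.assoc)
        also have "\<dots> \<le> 2 ^ d * max 1 (x ^ d * \<bar>\<delta>\<bar>)" using x by (intro maxmul) auto
        finally show ?thesis unfolding lc1 l_def' using y by (simp add: mult.left_commute)
      qed
      have lcl: "l \<le> 2 ^ d * lam d M r \<delta>c"
      proof -
        have "x ^ d * \<bar>\<delta>\<bar> \<le> (2 * (real t * real M)) ^ d * \<bar>\<delta>\<bar>" using tx x by (intro mult_right_mono power_mono) auto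
        hence "max 1 (x ^ d * \<bar>\<delta>\<bar>) \<le> max 1 (2 ^ d * ((real t * real M) ^ d * \<bar>\<delta>\<bar>))"
          unfolding power_mult_distrib[of 2] mult.assoc by (rule max.mono[OF order_refl])
        also have "\<dots> \<le> 2 ^ d * max 1 ((real t * real M) ^ d * \<bar>\<delta>\<bar>)" by (intro maxmul) auto
        finally show ?thesis unfolding lc1 l_def' using y by (simp add: mult.left_commute)
      qed
      have Ld: "real L \<le> real L ^ d" using L8 d power_increasing[of 1 d "real L"] by simp
      have small: "2 * (real r)\<^sup>2 * \<bar>\<delta>c\<bar> \<le> 1"
      proof -
        have "real L * (2 * y\<^sup>2 * (\<bar>\<delta>\<bar> * real t ^ d)) \<le> real L ^ d * (2 * y\<^sup>2 * (\<bar>\<delta>\<bar> * real t ^ d))"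
          using Ld by (intro mult_right_mono) auto
        also have "\<dots> = 2 * y\<^sup>2 * \<bar>\<delta>\<bar> * (real t * real L) ^ d" by (simp add: power_mult_distrib mult_ac)
        also have "\<dots> \<le> 2 * y\<^sup>2 * \<bar>\<delta>\<bar> * (2 * x) ^ d" using tx by (intro mult_left_mono power_mono) auto
        also have "\<dots> = 2 ^ (d + 1) * (y * (y * (x ^ d * \<bar>\<delta>\<bar>)))" by (simp add: power_mult_distrib power2_eq_square mult_ac)
        also have "\<dots> \<le> 2 ^ (d + 1) * (l * l)" using ly y x by (intro mult_left_mono mult_mono) auto
        also have "\<dots> \<le> real L * 1" using lw by (simp add: power2_eq_square mult.commute)
        finally have "2 * y\<^sup>2 * (\<bar>\<delta>\<bar> * real t ^ d) \<le> 1" using L8 by (simp only: mult_le_cancel_left_pos)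
        thus ?thesis by (simp add: \<delta>c abs_mult y_def)
      qed
      have lc0: "lam d M r \<delta>c \<ge> 1" unfolding lc1 using y mult_mono[of 1 y 1 "max 1 ((real t * real M) ^ d * \<bar>\<delta>\<bar>)"] by simp
      define Gc where "Gc = 2 / lam d M r \<delta>c + 1 / real M + 2 * lam d M r \<delta>c / real M ^ d"
      \<comment> \<open>All three terms are at most of order \<open>1 / l\<close>: the length
        \<open>M\<close> is comparable to \<open>L\<close>, and \<open>lam\<close> changes by at
        most a factor \<open>2 ^ d\<close>.\<close>
      have Gc: "Gc \<le> c1 / l"
      proof -
        have a: "2 / lam d M r \<delta>c \<le> 2 ^ (d + 1) / l"
          using lcl lc0 l1 by (simp add: field_simps)
        have Lpos: "real L > 0" using L8 by simp
        have LM': "real L \<le> 4 * real M" using LM(1) by linarith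
        have ll: "l \<le> l\<^sup>2" using l1 by (simp add: power2_eq_square)
        have k4: "(2::real) ^ (d + 1) \<ge> 1" by (rule one_le_power) simp
        have lL: "l\<^sup>2 \<le> real L" using lw mult_left_mono[OF k4, of "l\<^sup>2"] by simp
        have b: "1 / real M \<le> 4 / l"
        proof -
          have "l \<le> 4 * real M" using ll lL LM' by linarith
          thus ?thesis using M1 l1 by (simp add: field_simps)
        qed
        have c: "2 * lam d M r \<delta>c / real M ^ d \<le> 4 / l"
        proof -
          have "real M \<le> real M ^ d" using M1 d power_increasing[of 1 d "real M"] by simp
          hence "real L \<le> 4 * real M ^ d" using LM' by linarith
          moreover have "2 * lam d M r \<delta>c * l \<le> 2 * (2 ^ d * l) * l" using lcu l1 by (intro mult_right_mono mult_left_mono) auto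
          hence "2 * lam d M r \<delta>c * l \<le> l\<^sup>2 * 2 ^ (d + 1)" by (simp add: power2_eq_square mult_ac)
          ultimately have "2 * lam d M r \<delta>c * l \<le> 4 * real M ^ d" using lw by linarith
          thus ?thesis using M1 l1 by (simp add: field_simps)
        qed
        have "Gc \<le> 2 ^ (d + 1) / l + 4 / l + 4 / l" unfolding Gc_def using a b c by linarith
        thus ?thesis by (simp add: c1_def add_divide_distrib)
      qed
      have Gc0: "Gc \<ge> 0" unfolding Gc_def using lc0 by (intro add_nonneg_nonneg) auto
      have "cmod (\<Sum>m=1..M. ee (poly f (real (t * m - c)))) = cmod (\<Sum>m=1..M. ee (poly fc (real m)))"
        using pfc by (intro arg_cong[where f = cmod] sum.cong) auto
      also have "\<dots> \<le> C * real M powr (1 + \<epsilon>) * Gc powr \<sigma>"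
        unfolding Gc_def by (rule W[OF M1 fc bc br(2) \<delta>c_def small])
      also have "\<dots> \<le> C * (4 * real L * (2 ^ (d + 4) * l powr (2 * \<epsilon>))) * (c1 * l powr (- \<sigma>))"
      proof (intro mult_mono mult_left_mono)
        have LM': "real M \<le> 4 * real L" using LM(2) by linarith
        have "real M powr (1 + \<epsilon>) = real M * real M powr \<epsilon>" using M1 by (simp add: powr_add)
        also have "\<dots> \<le> (4 * real L) * (2 ^ (d + 4) * l\<^sup>2) powr \<epsilon>"
        proof (intro mult_mono powr_mono2)
          have "4 * real L \<le> 2 ^ (d + 4) * l\<^sup>2" using L2 by (simp add: w_def power_add mult_ac)
          thus "real M \<le> 2 ^ (d + 4) * l\<^sup>2" using LM' by linarith
        qed (use LM' \<epsilon> in auto)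
        also have "(2 ^ (d + 4) * l\<^sup>2) powr \<epsilon> = (2 ^ (d + 4)) powr \<epsilon> * (l\<^sup>2) powr \<epsilon>" by (simp add: powr_mult)
        also have "(l\<^sup>2) powr \<epsilon> = l powr (2 * \<epsilon>)" using l1 by (simp add: powr_powr flip: powr_numeral)
        also have "(2 ^ (d + 4)) powr \<epsilon> \<le> (2 ^ (d + 4) :: real) powr 1" using \<epsilon> by (intro powr_mono) auto
        also have "(2 ^ (d + 4) :: real) powr 1 = 2 ^ (d + 4)" by simp
        finally show "real M powr (1 + \<epsilon>) \<le> 4 * real L * (2 ^ (d + 4) * l powr (2 * \<epsilon>))"
          by (simp add: mult_left_mono mult_right_mono)
        have "Gc powr \<sigma> \<le> (c1 / l) powr \<sigma>" using Gc Gc0 \<sigma> by (intro powr_mono2) auto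
        also have "\<dots> = c1 powr \<sigma> * l powr (- \<sigma>)" using c1 l1 by (simp add: powr_divide powr_minus_divide)
        also have "\<dots> \<le> c1 * l powr (- \<sigma>)" using powr_mono[OF \<sigma>(1) c1] c1 by (intro mult_right_mono) auto
        finally show "Gc powr \<sigma> \<le> c1 * l powr (- \<sigma>)" .
      qed (use C c1 in auto)
      also have "\<dots> = C' * real L * (l powr (2 * \<epsilon>) * l powr (- \<sigma>))" by (simp add: C'_def)
      also have "l powr (2 * \<epsilon>) * l powr (- \<sigma>) = l powr (2 * \<epsilon> + - \<sigma>)" by (rule powr_add[symmetric])
      also have "2 * \<epsilon> + - \<sigma> = - \<sigma>2" by (simp add: \<epsilon>_def field_simps)
      finally show ?thesis by (simp only: M_def)
    qed
    have "cmod (\<Sum>n=1..N. ee (poly f (real n))) = cmod (\<Sum>c<t. \<Sum>m=1..(N + c) div t. ee (poly f (real (t * m - c))))"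
      by (simp only: sum_progressions[OF t1, of "\<lambda>n. ee (poly f (real n))"])
    also have "\<dots> \<le> (\<Sum>c<t. C' * real L * l powr (- \<sigma>2))"
      by (rule order_trans[OF norm_sum]) (intro sum_mono piece, simp)
    also have "\<dots> = C' * (real t * real L) * l powr (- \<sigma>2)" by simp
    also have "\<dots> \<le> C' * (2 * x) * l powr (- \<sigma>2)"
    proof (intro mult_right_mono mult_left_mono)
      show "real t * real L \<le> 2 * x" using tL unfolding x_def by (metis of_nat_le_iff of_nat_mult of_nat_numeral)
    qed (use C' in auto)
    finally show "cmod (\<Sum>n=1..N. ee (poly f (real n))) \<le> 2 * C' * real N * lam d N r \<delta> powr (- \<sigma>2)"
      by (simp add: x_def l_def mult_ac)
  qed
qed

section \<open>Assembly of the two bounds\<close>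

lemma powr_cmult_le:
  fixes c x s :: real
  assumes "c \<ge> 1" "x \<ge> 0" "0 \<le> s" "s \<le> 1"
  shows "(c * x) powr s \<le> c * x powr s"
proof -
  have "(c * x) powr s = c powr s * x powr s" by (simp add: powr_mult)
  also have "\<dots> \<le> c powr 1 * x powr s" using assms by (intro mult_right_mono powr_mono) auto
  finally show ?thesis using assms by simp
qed

lemma admissible_smult:
  assumes "admissible d f a q h"
  shows "degree (smult (of_int h) f) \<le> d" "coeff (smult (of_int h) f) d = of_int h * coeff f d" "q \<ge> 1"
  using assms by (auto simp: admissible_def)

lemma lam_pos: "r \<ge> 1 \<Longrightarrow> lam d N r \<delta> \<ge> 1"
  using lam_ge(1)[of r d N \<delta>] by linarith

text \<open>The constant is \<open>4 + 1 + 2\<close>: \<open>inverse_lam_le\<close> turns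
  \<open>2 / lam\<close> into \<open>4 \<Delta>\<close>, and the last term is at most
  \<open>2 / N\<close>.\<close>

lemma gap_bound:
  assumes adm: "admissible d f a q h" and N: "N \<ge> 1" and br: "coprime b (int r)" "r \<ge> 1"
    and \<delta>: "\<delta> = of_int h * coeff f d - of_int b / real r" and le: "lam d N r \<delta> / real N ^ d \<le> 1 / real N"
  shows "2 / lam d N r \<delta> + 1 / real N + 2 * lam d N r \<delta> / real N ^ d \<le> 7 * \<Delta> d h q N"
proof -
  have "1 / lam d N r \<delta> \<le> 2 * \<Delta> d h q N" unfolding \<delta> by (rule inverse_lam_le[OF adm N br])
  moreover have "1 / real N \<le> \<Delta> d h q N" by (rule \<Delta>_bounds(2)[OF admissible_smult(3)[OF adm] N])
  ultimately show ?thesis using le by simp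
qed

text \<open>Weyl's bound is used with \<open>\<epsilon> / 2\<close>; the other half absorbs the
  constant \<open>7 C\<close> for large \<open>N\<close>, with a threshold depending only on
  \<open>d\<close> and \<epsilon>.\<close>

theorem first_bound:
  assumes d: "d \<ge> 2" and \<epsilon>: "\<epsilon> > 0"
  shows "\<exists>N0::nat. \<forall>N\<ge>N0. \<forall>f a q h. admissible d f a q h \<longrightarrow>
     cmod (T f h N) \<le> real N powr (1 + \<epsilon>) * \<Delta> d h q N powr (1 / (real d * (real d - 1)))"
proof -
  define \<sigma> where "\<sigma> = 1 / (real d * (real d - 1))"
  have dd: "real d * (real d - 1) \<ge> 2 * 1" using d by (intro mult_mono) auto
  have \<sigma>: "0 \<le> \<sigma>" "\<sigma> \<le> 1" using dd by (auto simp: \<sigma>_def)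
  have e2: "\<epsilon> / 2 > 0" using \<epsilon> by simp
  obtain C1 where C1: "C1 \<ge> 1" and W1: "\<And>(N::nat) (f::real poly) b r. N \<ge> 1 \<Longrightarrow> degree f \<le> d \<Longrightarrow> coprime b (int r) \<Longrightarrow> r \<ge> 1 \<Longrightarrow>
     \<bar>coeff f d - of_int b / real r\<bar> \<le> 1 / (real r)\<^sup>2 \<Longrightarrow>
     cmod (\<Sum>n=1..N. ee (poly f (real n))) \<le> C1 * real N powr (1 + \<epsilon> / 2) * (1 / real r + 1 / real N + real r / real N ^ d) powr \<sigma>"
    using weyl_bound[OF d e2] unfolding \<sigma>_def by blast
  obtain C2 where C2: "C2 \<ge> 1" and W2: "\<And>(N::nat) (f::real poly) b r \<delta>. N \<ge> 1 \<Longrightarrow> degree f \<le> d \<Longrightarrow> coprime b (int r) \<Longrightarrow> r \<ge> 1 \<Longrightarrow>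
     \<delta> = coeff f d - of_int b / real r \<Longrightarrow> 2 * (real r)\<^sup>2 * \<bar>\<delta>\<bar> \<le> 1 \<Longrightarrow>
     cmod (\<Sum>n=1..N. ee (poly f (real n))) \<le> C2 * real N powr (1 + \<epsilon> / 2) * (2 / lam d N r \<delta> + 1 / real N + 2 * lam d N r \<delta> / real N ^ d) powr \<sigma>"
    using weyl_lam[OF d e2] unfolding \<sigma>_def by blast
  define C where "C = C1 + C2"
  define N0 where "N0 = nat \<lceil>(7 * C) powr (2 / \<epsilon>)\<rceil> + 1"
  show ?thesis
  proof (intro exI[of _ N0] allI impI)
    fix N f a q h assume N0: "N \<ge> N0" and adm: "admissible d f a q h"
    have N: "N \<ge> 1" using N0 by (simp add: N0_def)
    have C: "C \<ge> 1" using C1 C2 by (simp add: C_def)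
    have big: "7 * C \<le> real N powr (\<epsilon> / 2)"
    proof -
      have "(7 * C) powr (2 / \<epsilon>) \<le> real N" using N0 unfolding N0_def by linarith
      hence "((7 * C) powr (2 / \<epsilon>)) powr (\<epsilon> / 2) \<le> real N powr (\<epsilon> / 2)" using e2 by (intro powr_mono2) auto
      thus ?thesis using C \<epsilon> by (simp add: powr_powr)
    qed
    define D where "D = \<Delta> d h q N"
    note A = admissible_smult[OF adm]
    have D: "1 / real N \<le> D" "D > 0" unfolding D_def using \<Delta>_bounds[OF A(3) N] by auto
    have "\<exists>G. 0 \<le> G \<and> G \<le> 7 * D \<and> cmod (T f h N) \<le> C * real N powr (1 + \<epsilon> / 2) * G powr \<sigma>"
    proof (rule dirichlet_dichotomy[OF d N, of "of_int h * coeff f d"])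
      fix b r assume br: "coprime b (int r)" "r \<ge> 1" and ap: "\<bar>of_int h * coeff f d - of_int b / real r\<bar> \<le> 1 / (real r)\<^sup>2"
        and G: "1 / real r + 1 / real N + real r / real N ^ d \<le> 4 / real N"
      let ?G = "1 / real r + 1 / real N + real r / real N ^ d"
      have "cmod (T f h N) \<le> C1 * real N powr (1 + \<epsilon> / 2) * ?G powr \<sigma>"
        unfolding T_eq by (rule W1[OF N A(1) br]) (use ap A(2) in simp)
      also have "\<dots> \<le> C * real N powr (1 + \<epsilon> / 2) * ?G powr \<sigma>"
        using C2 by (intro mult_right_mono) (auto simp: C_def)
      finally show ?thesis using G D by (intro exI[of _ ?G]) (auto intro!: add_nonneg_nonneg)
    next
      fix b r \<delta> assume br: "coprime b (int r)" "r \<ge> 1" and \<delta>: "\<delta> = of_int h * coeff f d - of_int b / real r" "2 * (real r)\<^sup>2 * \<bar>\<delta>\<bar> \<le> 1"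
        and le: "lam d N r \<delta> / real N ^ d \<le> 1 / real N"
      let ?G = "2 / lam d N r \<delta> + 1 / real N + 2 * lam d N r \<delta> / real N ^ d"
      have "cmod (T f h N) \<le> C2 * real N powr (1 + \<epsilon> / 2) * ?G powr \<sigma>"
        unfolding T_eq by (rule W2[OF N A(1) br]) (use \<delta> A(2) in simp_all)
      also have "\<dots> \<le> C * real N powr (1 + \<epsilon> / 2) * ?G powr \<sigma>"
        using C1 by (intro mult_right_mono) (auto simp: C_def)
      finally show ?thesis using gap_bound[OF adm N br \<delta>(1) le] lam_pos[OF br(2), of d N \<delta>]
        by (intro exI[of _ ?G]) (auto intro!: add_nonneg_nonneg simp: D_def)
    qed
    then obtain G where G: "0 \<le> G" "G \<le> 7 * D" "cmod (T f h N) \<le> C * real N powr (1 + \<epsilon> / 2) * G powr \<sigma>" by blast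
    have "G powr \<sigma> \<le> (7 * D) powr \<sigma>" using G \<sigma> by (intro powr_mono2) auto
    also have "\<dots> \<le> 7 * D powr \<sigma>" using D \<sigma> by (intro powr_cmult_le) auto
    finally have "C * real N powr (1 + \<epsilon> / 2) * G powr \<sigma> \<le> C * real N powr (1 + \<epsilon> / 2) * (7 * D powr \<sigma>)"
      using C by (intro mult_left_mono) auto
    also have "\<dots> = (7 * C) * (real N powr (1 + \<epsilon> / 2) * D powr \<sigma>)" by simp
    also have "\<dots> \<le> real N powr (\<epsilon> / 2) * (real N powr (1 + \<epsilon> / 2) * D powr \<sigma>)"
      using big by (intro mult_right_mono) auto
    also have "\<dots> = real N powr (1 + \<epsilon>) * D powr \<sigma>" by (simp add: add_ac flip: powr_add mult.assoc)
    finally show "cmod (T f h N) \<le> real N powr (1 + \<epsilon>) * \<Delta> d h q N powr (1 / (real d * (real d - 1)))"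
      using G(3) by (simp add: D_def \<sigma>_def)
  qed
qed

text \<open>Whenever the factor \<open>G\<close> of Weyl's bound is at most a negative power of
  \<open>N\<close>, its surplus power \<open>\<sigma> - s2\<close> pays for the loss. This settles
  large denominators, where \<open>G\<close> is of order \<open>1 / N\<close>, and
  \<open>lam\<close> above \<open>N ^ (1 / 6)\<close>; below that, \<open>eps_removal\<close> takes
  over.\<close>

theorem second_bound:
  assumes d: "d \<ge> 2"
  shows "\<exists>c::real. c > 0 \<and> (\<exists>N0::nat. \<forall>N\<ge>N0. \<forall>f a q h. admissible d f a q h \<longrightarrow>
     cmod (T f h N) \<le> c * (real N * \<Delta> d h q N powr (1 / ((real d)\<^sup>2 - real d + 2)) * ln (real N)))"
proof -
  define \<sigma> where "\<sigma> = 1 / (real d * (real d - 1))"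
  define s2 where "s2 = 1 / ((real d)\<^sup>2 - real d + 2)"
  have dd: "real d * (real d - 1) \<ge> 2 * 1" using d by (intro mult_mono) auto
  have sq: "(real d)\<^sup>2 - real d + 2 = real d * (real d - 1) + 2" by (simp add: power2_eq_square algebra_simps)
  have \<sigma>: "\<sigma> \<le> 1" "s2 < \<sigma>" "s2 > 0"
    using dd unfolding \<sigma>_def s2_def sq by (auto intro!: divide_strict_left_mono)
  define \<epsilon> where "\<epsilon> = \<sigma> - s2"
  have \<epsilon>: "\<epsilon> > 0" "\<epsilon> / 6 > 0" "\<epsilon> \<le> 1" using \<sigma> by (auto simp: \<epsilon>_def)
  obtain C1 where C1: "C1 \<ge> 1" and W1: "\<And>(N::nat) (f::real poly) b r. N \<ge> 1 \<Longrightarrow> degree f \<le> d \<Longrightarrow> coprime b (int r) \<Longrightarrow> r \<ge> 1 \<Longrightarrow>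
     \<bar>coeff f d - of_int b / real r\<bar> \<le> 1 / (real r)\<^sup>2 \<Longrightarrow>
     cmod (\<Sum>n=1..N. ee (poly f (real n))) \<le> C1 * real N powr (1 + \<epsilon>) * (1 / real r + 1 / real N + real r / real N ^ d) powr \<sigma>"
    using weyl_bound[OF d \<epsilon>(1)] unfolding \<sigma>_def by blast
  obtain C2 where C2: "C2 \<ge> 1" and W2: "\<And>(N::nat) (f::real poly) b r \<delta>. N \<ge> 1 \<Longrightarrow> degree f \<le> d \<Longrightarrow> coprime b (int r) \<Longrightarrow> r \<ge> 1 \<Longrightarrow>
     \<delta> = coeff f d - of_int b / real r \<Longrightarrow> 2 * (real r)\<^sup>2 * \<bar>\<delta>\<bar> \<le> 1 \<Longrightarrow>
     cmod (\<Sum>n=1..N. ee (poly f (real n))) \<le> C2 * real N powr (1 + \<epsilon> / 6) * (2 / lam d N r \<delta> + 1 / real N + 2 * lam d N r \<delta> / real N ^ d) powr \<sigma>"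
    using weyl_lam[OF d \<epsilon>(2)] unfolding \<sigma>_def by blast
  obtain C3 M0 where C3: "C3 \<ge> 1" and W3: "\<And>(N::nat) (f::real poly) b r \<delta>. N \<ge> M0 \<Longrightarrow> degree f \<le> d \<Longrightarrow> coprime b (int r) \<Longrightarrow> r \<ge> 1 \<Longrightarrow>
     \<delta> = coeff f d - of_int b / real r \<Longrightarrow> lam d N r \<delta> \<le> real N powr (1 / 6) \<Longrightarrow>
     cmod (\<Sum>n=1..N. ee (poly f (real n))) \<le> C3 * real N * lam d N r \<delta> powr (- s2)"
    using eps_removal[OF d \<sigma>(3)] \<sigma>(2) unfolding \<sigma>_def by blast
  define C where "C = 4 * C1 + 35 * C2 + 2 * C3"
  have C: "C > 0" using C1 C2 C3 by (simp add: C_def)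
  have main: "cmod (T f h N) \<le> C * (real N * \<Delta> d h q N powr s2)"
    if N: "N \<ge> 1" "N \<ge> M0" and adm: "admissible d f a q h" for N f a q h
  proof -
    define x where "x = real N"
    have x: "x \<ge> 1" using N by (simp add: x_def)
    define D where "D = \<Delta> d h q N"
    note A = admissible_smult[OF adm]
    have D: "1 / x \<le> D" "D > 0" unfolding D_def x_def using \<Delta>_bounds[OF A(3) N(1)] by auto
    have conc: "cmod (T f h N) \<le> C * (x * D powr s2)" if "cmod (T f h N) \<le> K * (x * D powr s2)" "K \<le> C" for K
      using that x by (meson mult_right_mono order_trans mult_nonneg_nonneg powr_ge_zero zero_le_one)
    have "cmod (T f h N) \<le> C * (x * D powr s2)"
    proof (rule dirichlet_dichotomy[OF d N(1), of "of_int h * coeff f d"])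
      fix b r assume br: "coprime b (int r)" "r \<ge> 1" and ap: "\<bar>of_int h * coeff f d - of_int b / real r\<bar> \<le> 1 / (real r)\<^sup>2"
        and G: "1 / real r + 1 / real N + real r / real N ^ d \<le> 4 / real N"
      have "cmod (T f h N) \<le> C1 * x powr (1 + \<epsilon>) * (1 / real r + 1 / real N + real r / real N ^ d) powr \<sigma>"
        unfolding T_eq x_def by (rule W1[OF N(1) A(1) br]) (use ap A(2) in simp)
      also have "\<dots> \<le> C1 * x powr (1 + \<epsilon>) * (4 * (1 / x)) powr \<sigma>"
        using C1 G \<sigma> by (intro mult_left_mono powr_mono2) (auto intro!: add_nonneg_nonneg simp: x_def)
      also have "\<dots> \<le> C1 * x powr (1 + \<epsilon>) * (4 * (1 / x) powr \<sigma>)"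
        using C1 x \<sigma> by (intro mult_left_mono powr_cmult_le) auto
      also have "(1 / x) powr \<sigma> = x powr (- \<epsilon>) * (1 / x) powr s2"
        using x by (simp add: \<epsilon>_def powr_divide flip: powr_minus_divide powr_add)
      also have "C1 * x powr (1 + \<epsilon>) * (4 * (x powr (- \<epsilon>) * (1 / x) powr s2)) = 4 * C1 * ((x powr (1 + \<epsilon>) * x powr (- \<epsilon>)) * (1 / x) powr s2)"
        by simp
      also have "x powr (1 + \<epsilon>) * x powr (- \<epsilon>) = x" using x by (simp flip: powr_add)
      also have "4 * C1 * (x * (1 / x) powr s2) \<le> 4 * C1 * (x * D powr s2)"
        using C1 x D \<sigma> by (intro mult_left_mono powr_mono2) auto
      finally show ?thesis by (rule conc) (use C2 C3 in \<open>simp add: C_def\<close>)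
    next
      fix b r \<delta> assume br: "coprime b (int r)" "r \<ge> 1" and \<delta>: "\<delta> = of_int h * coeff f d - of_int b / real r" "2 * (real r)\<^sup>2 * \<bar>\<delta>\<bar> \<le> 1"
        and le: "lam d N r \<delta> / real N ^ d \<le> 1 / real N"
      define l where "l = lam d N r \<delta>"
      have l1: "l \<ge> 1" unfolding l_def by (rule lam_pos[OF br(2)])
      show ?thesis
      proof (cases "l \<le> x powr (1 / 6)")
        case True
        have "cmod (T f h N) \<le> C3 * x * l powr (- s2)"
          unfolding T_eq x_def l_def by (rule W3[OF N(2) A(1) br]) (use \<delta> A(2) True in \<open>simp_all add: l_def x_def\<close>)
        also have "l powr (- s2) = (1 / l) powr s2" using l1 by (simp add: powr_divide powr_minus_divide)
        also have "C3 * x * (1 / l) powr s2 \<le> C3 * x * (2 * D) powr s2"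
          using C3 x l1 \<sigma> inverse_lam_le[OF adm N(1) br] unfolding \<delta>(1)[symmetric] l_def[symmetric] D_def
          by (intro mult_left_mono powr_mono2) auto
        also have "\<dots> \<le> C3 * x * (2 * D powr s2)"
          using C3 x D \<sigma> by (intro mult_left_mono powr_cmult_le) auto
        also have "\<dots> = 2 * C3 * (x * D powr s2)" by simp
        finally show ?thesis by (rule conc) (use C1 C2 in \<open>simp add: C_def\<close>)
      next
        case False
        define G where "G = 2 / l + 1 / x + 2 * l / x ^ d"
        have G7: "G \<le> 7 * D" unfolding G_def l_def x_def D_def by (rule gap_bound[OF adm N(1) br \<delta>(1) le])
        have G0: "G > 0" unfolding G_def using l1 x by (intro add_pos_nonneg add_pos_pos) auto
        have G5: "G \<le> 5 * x powr (- 1 / 6)"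
        proof -
          have "1 / l \<le> 1 / x powr (1 / 6)" using False l1 x by (intro divide_left_mono) auto
          also have "\<dots> = x powr (- 1 / 6)" by (simp add: powr_minus_divide)
          finally have a: "2 / l \<le> 2 * x powr (- 1 / 6)" by simp
          have "1 / x = x powr (- 1)" using x by (simp add: powr_minus_divide)
          also have "\<dots> \<le> x powr (- 1 / 6)" using x by (intro powr_mono) auto
          finally have b: "1 / x \<le> x powr (- 1 / 6)" .
          have "2 * l / x ^ d \<le> 2 * (1 / x)" using le by (simp add: l_def x_def)
          thus ?thesis unfolding G_def using a b by linarith
        qed
        have "cmod (T f h N) \<le> C2 * x powr (1 + \<epsilon> / 6) * G powr \<sigma>"
          unfolding T_eq x_def G_def l_def by (rule W2[OF N(1) A(1) br]) (use \<delta> A(2) in simp_all)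
        \<comment> \<open>The first factor is at most \<open>5 N ^ (- \<epsilon> / 6)\<close> and
          cancels the loss \<open>N ^ (\<epsilon> / 6)\<close>, for which \<open>weyl_lam\<close>
          was taken with \<open>\<epsilon> / 6\<close>.\<close>
        also have "G powr \<sigma> = G powr \<epsilon> * G powr s2" by (simp add: \<epsilon>_def flip: powr_add)
        also have "C2 * x powr (1 + \<epsilon> / 6) * (G powr \<epsilon> * G powr s2) \<le>
          C2 * x powr (1 + \<epsilon> / 6) * ((5 * (x powr (- 1 / 6)) powr \<epsilon>) * (7 * D powr s2))"
        proof (intro mult_left_mono mult_mono)
          have "G powr \<epsilon> \<le> (5 * x powr (- 1 / 6)) powr \<epsilon>" using G0 G5 \<epsilon> by (intro powr_mono2) auto
          also have "\<dots> \<le> 5 * (x powr (- 1 / 6)) powr \<epsilon>" using \<epsilon> by (intro powr_cmult_le) auto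
          finally show "G powr \<epsilon> \<le> 5 * (x powr (- 1 / 6)) powr \<epsilon>" .
          have "G powr s2 \<le> (7 * D) powr s2" using G0 G7 \<sigma> by (intro powr_mono2) auto
          also have "\<dots> \<le> 7 * D powr s2" using D \<sigma> by (intro powr_cmult_le) auto
          finally show "G powr s2 \<le> 7 * D powr s2" .
        qed (use C2 in auto)
        also have "\<dots> = 35 * C2 * ((x powr (1 + \<epsilon> / 6) * (x powr (- 1 / 6)) powr \<epsilon>) * D powr s2)" by simp
        also have "x powr (1 + \<epsilon> / 6) * (x powr (- 1 / 6)) powr \<epsilon> = x"
          using x by (simp add: powr_powr flip: powr_add)
        finally show ?thesis by (rule conc) (use C1 C3 in \<open>simp add: C_def\<close>)
      qed
    qed
    thus ?thesis by (simp only: x_def D_def)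
  qed
  show ?thesis
  \<comment> \<open>From \<open>N \<ge> 3\<close> on, \<open>ln N \<ge> 1\<close>, so the factor
    \<open>ln N\<close> may be inserted.\<close>
  proof (intro exI[of _ C] exI[of _ "M0 + 3"] conjI allI impI C)
    fix N f a q h assume N: "N \<ge> M0 + 3" and adm: "admissible d f a q h"
    have "cmod (T f h N) \<le> C * (real N * \<Delta> d h q N powr s2)" by (rule main[OF _ _ adm]) (use N in auto)
    also have "\<dots> \<le> C * (real N * \<Delta> d h q N powr s2 * ln (real N))"
    proof (intro mult_left_mono)
      have "exp 1 \<le> real N" using N exp_le by (auto intro: order_trans)
      hence "1 \<le> ln (real N)" using N by (simp add: ln_ge_iff)
      hence "real N * \<Delta> d h q N powr s2 * 1 \<le> real N * \<Delta> d h q N powr s2 * ln (real N)"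
        by (intro mult_left_mono) auto
      thus "real N * \<Delta> d h q N powr s2 \<le> real N * \<Delta> d h q N powr s2 * ln (real N)" by simp
    qed (use C in auto)
    finally show "cmod (T f h N) \<le> C * (real N * \<Delta> d h q N powr (1 / ((real d)\<^sup>2 - real d + 2)) * ln (real N))"
      by (simp only: s2_def)
  qed
qed

theorem lemma3p2:
  fixes d :: nat
  assumes "d \<ge> 2"
  shows
    "(\<forall>\<epsilon>::real. \<epsilon> > 0 \<longrightarrow>
        (\<exists>N0::nat. \<forall>N\<ge>N0. \<forall>(f::real poly) (a::int) (q::int) (h::int).
           admissible d f a q h \<longrightarrow>
           cmod (T f h N)
             \<le> real N powr (1 + \<epsilon>) * \<Delta> d h q N powr (1 / (real d * (real d - 1)))))
     \<and>
     (\<exists>c::real. c > 0 \<and>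
        (\<exists>N0::nat. \<forall>N\<ge>N0. \<forall>(f::real poly) (a::int) (q::int) (h::int).
           admissible d f a q h \<longrightarrow>
           cmod (T f h N)
             \<le> c * (real N * \<Delta> d h q N powr (1 / ((real d)\<^sup>2 - real d + 2)) * ln (real N))))"
  using first_bound[OF assms] second_bound[OF assms] by blast

end
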